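(* Let $H=\bigoplus_{n\in\mathbb{N}_0}H(n)$ be a graded Hopf algebra over a field $\Bbbk$ and let $L=\bigoplus_{n\in\mathbb{N}_0}L(n)$ be a graded left $H$-comodule algebra. If $L$ is right $H$-simple, then $L$ is (isomorphic, as a graded $H$-comodule algebra, to) a graded $H$-comodule subalgebra of $H^{\mathrm{coinv}}\#L(0)$.
   Context: Everything is over a field $\Bbbk$. A graded Hopf algebra is a Hopf algebra with an $\mathbb{N}_0$-grading of its underlying vector space such that multiplication, unit, comultiplication and counit preserve the grading (tensor products have the total grading; $\Bbbk$ is in degree $0$). A left $H$-comodule algebra is an algebra $L$ that is a left $H$-comodule whose coaction $\rho\colon L\to H\otimes L$, $\ell\mapsto\ell_{(-1)}\otimes\ell_{(0)}$, is an algebra map; it is graded if it has an $\mathbb{N}_0$-grading preserved by multiplication, unit and coaction. Then $L(0)$ is a left $H(0)$-comodule algebra by restriction. A graded $H$-comodule subalgebra is a subalgebra that is an $H$-subcomodule and a graded subspace, with the induced grading. $L$ is right $H$-simple if $L\neq0$ and its only right ideals that are $H$-subcomodules are $0$ and $L$. Let $\pi\colon H\to H(0)$ be the canonical projection and $\iota\colon H(0)\to H$ the inclusion; both are Hopf algebra maps. $H^{\mathrm{coinv}}=\{r\in H\mid r_{(1)}\otimes\pi(r_{(2)})=r\otimes1\}$, with $\Delta(r)=r_{(1)}\otimes r_{(2)}$. For a left $H(0)$-comodule algebra $E$, $H^{\mathrm{coinv}}\#E$ is the left $H$-comodule algebra with underlying vector space $H^{\mathrm{coinv}}\otimes E$,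 multiplication $(a\otimes\ell)(b\otimes m)=a\,\iota(\ell_{(-2)})\,b\,\iota(S(\ell_{(-1)}))\otimes\ell_{(0)}m$ ($S$ the antipode of $H(0)$), and $H$-coaction $\rho(a\otimes\ell)=a_{(1)}\iota(\ell_{(-1)})\otimes a_{(2)}\otimes\ell_{(0)}$. It is graded with degree $n$ component $(H(n)\cap H^{\mathrm{coinv}})\otimes E$. *)

theory Defs
  imports Complex_Main "HOL-Library.Function_Algebras"
begin

section \<open>Vector spaces and tensor products\<close>

text \<open>
  A vector space is a subspace \<open>carrier V\<close> of an ambient type, on which \<open>scale V\<close> is a
  vector space structure in the sense of \<^locale>\<open>vector_space\<close>. Carriers are needed because
  subspaces such as \<open>H(0)\<close>, \<open>L(0)\<close> and tensor products occur as structures in their own right.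
  All further operations are only required to be (multi)linear on carriers; their values elsewhere
  are irrelevant.
\<close>

record ('k, 'a) vspace =
  carrier :: "'a set"
  scale :: "'k \<Rightarrow> 'a \<Rightarrow> 'a"

definition vspace :: "('k::field, 'a::ab_group_add, 'm) vspace_scheme \<Rightarrow> bool" where
  "vspace V \<longleftrightarrow> vector_space (scale V) \<and> module.subspace (scale V) (carrier V)"

definition linear_map ::
  "('k::field, 'a::ab_group_add, 'm) vspace_scheme \<Rightarrow> ('k, 'b::ab_group_add, 'n) vspace_scheme
    \<Rightarrow> ('a \<Rightarrow> 'b) \<Rightarrow> bool" where
  "linear_map V W f \<longleftrightarrow>
    (\<forall>x\<in>carrier V. f x \<in> carrier W) \<and>
    (\<forall>x\<in>carrier V. \<forall>y\<in>carrier V. f (x + y) = f x + f y) \<and>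
    (\<forall>c. \<forall>x\<in>carrier V. f (scale V c x) = scale W c (f x))"

definition bilinear_map ::
  "('k::field, 'a::ab_group_add, 'm) vspace_scheme \<Rightarrow> ('k, 'b::ab_group_add, 'n) vspace_scheme
    \<Rightarrow> ('k, 'c::ab_group_add, 'p) vspace_scheme \<Rightarrow> ('a \<Rightarrow> 'b \<Rightarrow> 'c) \<Rightarrow> bool" where
  "bilinear_map V W X f \<longleftrightarrow>
    (\<forall>v\<in>carrier V. linear_map W X (f v)) \<and> (\<forall>w\<in>carrier W. linear_map V X (\<lambda>v. f v w))"

definition bilinear_form ::
  "('k::field, 'a::ab_group_add, 'm) vspace_scheme \<Rightarrow> ('k, 'b::ab_group_add, 'n) vspace_scheme
    \<Rightarrow> ('a \<Rightarrow> 'b \<Rightarrow> 'k) \<Rightarrow> bool" where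
  "bilinear_form V W \<beta> \<longleftrightarrow>
    (\<forall>v. Vector_Spaces.linear (scale W) (*) (\<beta> v)) \<and>
    (\<forall>w. Vector_Spaces.linear (scale V) (*) (\<lambda>v. \<beta> v w))"

text \<open>
  The tensor product is realised inside the space of functionals on bilinear forms:
  \<open>v \<otimes> w\<close> is evaluation at \<open>(v, w)\<close>, and \<open>V \<otimes> W\<close> is the span of these simple tensors.
  Over a field this is the usual tensor product: the universal property is proved in
  \<open>tensor_universal\<close> and \<open>tensor_universal_unique\<close> below. The forms range over the ambient
  spaces, so that \<open>V' \<otimes> W'\<close> is literally a subspace of \<open>V \<otimes> W\<close> for subspaces
  \<open>V'\<close> of \<open>V\<close> and \<open>W'\<close> of \<open>W\<close>.
\<close>

type_synonym ('k, 'a, 'b) tensor = "('a \<Rightarrow> 'b \<Rightarrow> 'k) \<Rightarrow> 'k"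

definition tens ::
  "('k::field, 'a::ab_group_add, 'm) vspace_scheme \<Rightarrow> ('k, 'b::ab_group_add, 'n) vspace_scheme
    \<Rightarrow> 'a \<Rightarrow> 'b \<Rightarrow> ('k, 'a, 'b) tensor" where
  "tens V W v w = (\<lambda>\<beta>. if bilinear_form V W \<beta> then \<beta> v w else 0)"

definition tscale :: "'k::field \<Rightarrow> ('k, 'a, 'b) tensor \<Rightarrow> ('k, 'a, 'b) tensor" where
  "tscale c t = (\<lambda>\<beta>. c * t \<beta>)"

definition tensor_space ::
  "('k::field, 'a::ab_group_add, 'm) vspace_scheme \<Rightarrow> ('k, 'b::ab_group_add, 'n) vspace_scheme
    \<Rightarrow> ('k, ('k, 'a, 'b) tensor) vspace" (infixr \<open>\<otimes>\<close> 70) where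
  "V \<otimes> W =
    \<lparr>carrier = module.span tscale {tens V W v w | v w. v \<in> carrier V \<and> w \<in> carrier W},
     scale = tscale\<rparr>"

text \<open>
  \<open>tlift V W X f\<close> is the linear map \<open>V \<otimes> W \<rightarrow> X\<close> induced by a bilinear map
  \<open>f : V \<times> W \<rightarrow> X\<close>. It plays the role of Sweedler notation: a term
  \<open>f x\<^sub>(\<^sub>1\<^sub>) x\<^sub>(\<^sub>2\<^sub>)\<close> is written \<open>tlift H H X f (comul H x)\<close>.
\<close>

definition tlift ::
  "('k::field, 'a::ab_group_add, 'm) vspace_scheme \<Rightarrow> ('k, 'b::ab_group_add, 'n) vspace_scheme
    \<Rightarrow> ('k, 'c::ab_group_add, 'p) vspace_scheme \<Rightarrow> ('a \<Rightarrow> 'b \<Rightarrow> 'c)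
    \<Rightarrow> ('k, 'a, 'b) tensor \<Rightarrow> 'c" where
  "tlift V W X f = (SOME g. linear_map (V \<otimes> W) X g \<and>
    (\<forall>v\<in>carrier V. \<forall>w\<in>carrier W. g (tens V W v w) = f v w))"

lemma carrier_tensor [simp]:
  "carrier (V \<otimes> W) = module.span tscale {tens V W v w | v w. v \<in> carrier V \<and> w \<in> carrier W}"
  and scale_tensor [simp]: "scale (V \<otimes> W) = tscale"
  by (simp_all add: tensor_space_def)

lemma vector_space_tscale:
  "vector_space (tscale :: 'k::field \<Rightarrow> ('k, 'a, 'b) tensor \<Rightarrow> ('k, 'a, 'b) tensor)"
  by unfold_locales (auto simp: tscale_def algebra_simps)

lemma vector_space_field: "vector_space ((*) :: 'k::field \<Rightarrow> 'k \<Rightarrow> 'k)"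
  by unfold_locales (auto simp: algebra_simps)

lemma vspace_tensor:
  fixes V :: "('k::field, 'a::ab_group_add, 'm) vspace_scheme"
    and W :: "('k, 'b::ab_group_add, 'n) vspace_scheme"
  shows "vspace (V \<otimes> W)"
proof -
  interpret T: vector_space "tscale :: 'k \<Rightarrow> ('k, 'a, 'b) tensor \<Rightarrow> _"
    by (rule vector_space_tscale)
  show ?thesis
    unfolding vspace_def by (simp add: T.vector_space_axioms T.subspace_span)
qed

lemma tens_in_carrier:
  fixes V :: "('k::field, 'a::ab_group_add, 'm) vspace_scheme"
    and W :: "('k, 'b::ab_group_add, 'n) vspace_scheme"
  assumes "v \<in> carrier V" and "w \<in> carrier W"
  shows "tens V W v w \<in> carrier (V \<otimes> W)"
proof -
  interpret T: vector_space "tscale :: 'k \<Rightarrow> ('k, 'a, 'b) tensor \<Rightarrow> _"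
    by (rule vector_space_tscale)
  show ?thesis
    using assms by (auto intro!: T.span_base)
qed

lemma tens_bilinear:
  assumes "vspace V" and "vspace W"
  shows "bilinear_map V W (V \<otimes> W) (tens V W)"
proof -
  have lin: "module_hom (scale W) (*) (\<beta> v)" "module_hom (scale V) (*) (\<lambda>v. \<beta> v w)"
    if "bilinear_form V W \<beta>" for \<beta> v w
    using that unfolding bilinear_form_def Vector_Spaces.linear_def by auto
  show ?thesis
    unfolding bilinear_map_def linear_map_def
    by (intro conjI ballI allI tens_in_carrier)
      (auto simp: tens_def tscale_def fun_eq_iff
         module_hom.add[OF lin(1)] module_hom.scale[OF lin(1)]
         module_hom.add[OF lin(2)] module_hom.scale[OF lin(2)])
qed

lemma functionals_separate:
  assumes "vector_space s" and "x \<noteq> 0"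
  shows "\<exists>l. Vector_Spaces.linear s (*) l \<and> l x \<noteq> 0"
proof -
  interpret vector_space_pair s "(*)"
    using assms(1) vector_space_field by (simp add: vector_space_pair_def)
  have "vs1.independent {x}"
    using assms(2) by simp
  from linear_independent_extend[OF this, of "\<lambda>_. 1"] show ?thesis
    by auto
qed

lemma subspace_projection:
  assumes "vspace V"
  shows "\<exists>p. Vector_Spaces.linear (scale V) (scale V) p \<and> range p \<subseteq> carrier V \<and>
    (\<forall>x\<in>carrier V. p x = x)"
proof -
  interpret vector_space_pair "scale V" "scale V"
    using assms by (simp add: vector_space_pair_def vspace_def)
  show ?thesis
    using linear_exists_left_inverse_on[OF vs1.linear_id, of "carrier V"] assms
    by (auto simp: vspace_def)
qed

theorem tensor_universal:
  fixes V :: "('k::field, 'a::ab_group_add, 'm) vspace_scheme"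
    and W :: "('k, 'b::ab_group_add, 'n) vspace_scheme"
    and X :: "('k, 'c::ab_group_add, 'p) vspace_scheme"
  assumes V: "vspace V" and W: "vspace W" and X: "vspace X" and f: "bilinear_map V W X f"
  shows "\<exists>g. linear_map (V \<otimes> W) X g \<and>
    (\<forall>v\<in>carrier V. \<forall>w\<in>carrier W. g (tens V W v w) = f v w)"
proof -
  obtain p where p: "Vector_Spaces.linear (scale V) (scale V) p" "\<And>x. p x \<in> carrier V"
    "\<And>x. x \<in> carrier V \<Longrightarrow> p x = x"
    using subspace_projection[OF V] by blast
  obtain q where q: "Vector_Spaces.linear (scale W) (scale W) q" "\<And>x. q x \<in> carrier W"
    "\<And>x. x \<in> carrier W \<Longrightarrow> q x = x"
    using subspace_projection[OF W] by blast
  interpret vX: vector_space "scale X"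
    using X by (simp add: vspace_def)
  interpret T: vector_space_pair
    "tscale :: 'k \<Rightarrow> ('k, 'a, 'b) tensor \<Rightarrow> _" "scale X"
    using vector_space_tscale vX.vector_space_axioms by (simp add: vector_space_pair_def)
  define S where "S = {tens V W v w | v w. v \<in> carrier V \<and> w \<in> carrier W}"
  obtain B where B: "B \<subseteq> S" "T.vs1.independent B" "S \<subseteq> T.vs1.span B"
    by (rule T.vs1.maximal_independent_subset)
  have "\<forall>b\<in>B. \<exists>v w. v \<in> carrier V \<and> w \<in> carrier W \<and> b = tens V W v w"
    using B(1) unfolding S_def by blast
  then obtain bv bw where b: "\<And>b. b \<in> B \<Longrightarrow> bv b \<in> carrier V" "\<And>b. b \<in> B \<Longrightarrow> bw b \<in> carrier W"
    "\<And>b. b \<in> B \<Longrightarrow> b = tens V W (bv b) (bw b)"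
    by metis
  obtain g where g: "Vector_Spaces.linear tscale (scale X) g"
    "\<And>b. b \<in> B \<Longrightarrow> g b = f (bv b) (bw b)"
    using T.linear_independent_extend[OF B(2), of "\<lambda>b. f (bv b) (bw b)"] by blast
  have form: "bilinear_form V W (\<lambda>v w. l (f (p v) (q w)))"
    if l: "Vector_Spaces.linear (scale X) (*) l" for l
  proof -
    have *: "module_hom (scale V) (scale V) p" "module_hom (scale W) (scale W) q"
      "module_hom (scale X) (*) l"
      using p(1) q(1) l by (simp_all add: Vector_Spaces.linear_def)
    show ?thesis
      unfolding bilinear_form_def Vector_Spaces.linear_iff
      using V W f p(2) q(2) vector_space_field
      by (simp add: vspace_def bilinear_map_def linear_map_def *[THEN module_hom.add]
          *[THEN module_hom.scale])
  qed
  have key: "g (tens V W v w) = f v w" if v: "v \<in> carrier V" and w: "w \<in> carrier W" for v w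
  proof (rule ccontr)
    assume "g (tens V W v w) \<noteq> f v w"
    then obtain l where l: "Vector_Spaces.linear (scale X) (*) l" "l (g (tens V W v w) - f v w) \<noteq> 0"
      using functionals_separate[OF vX.vector_space_axioms, of "g (tens V W v w) - f v w"] by auto
    let ?F = "\<lambda>v w. l (f (p v) (q w))"
    have ev: "Vector_Spaces.linear tscale (*) (\<lambda>t :: ('k, 'a, 'b) tensor. t ?F)"
      unfolding Vector_Spaces.linear_iff
      using vector_space_tscale vector_space_field by (simp add: tscale_def)
    have lg: "Vector_Spaces.linear tscale (*) (l \<circ> g)"
      using g(1) l(1) by (rule Vector_Spaces.linear_compose)
    interpret P: vector_space_pair "tscale :: 'k \<Rightarrow> ('k, 'a, 'b) tensor \<Rightarrow> _" "(*)"
      using vector_space_tscale vector_space_field by (simp add: vector_space_pair_def)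
    have "(l \<circ> g) (tens V W v w) = tens V W v w ?F"
    proof (rule P.linear_eq_on[OF lg ev])
      show "tens V W v w \<in> T.vs1.span B"
        using B(3) v w unfolding S_def by blast
      show "(l \<circ> g) t = t ?F" if "t \<in> B" for t
      proof -
        have "t ?F = tens V W (bv t) (bw t) ?F"
          using b(3)[OF that] by simp
        also have "\<dots> = l (f (bv t) (bw t))"
          using form[OF l(1)] b(1,2)[OF that] p(3) q(3) by (simp add: tens_def)
        finally show ?thesis
          using g(2)[OF that] by simp
      qed
    qed
    also have "\<dots> = l (f v w)"
      using form[OF l(1)] v w p(3) q(3) by (simp add: tens_def)
    finally have "l (g (tens V W v w)) - l (f v w) = 0"
      by simp
    moreover have "module_hom (scale X) (*) l"
      using l(1) by (simp add: Vector_Spaces.linear_def)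
    ultimately show False
      using l(2) by (simp add: module_hom.diff)
  qed
  have gl: "module_hom tscale (scale X) g"
    using g(1) by (simp add: Vector_Spaces.linear_def)
  have "g t \<in> carrier X" if "t \<in> T.vs1.span S" for t
    using that
  proof (rule T.vs1.span_induct)
    have "T.vs1.subspace (g -` carrier X)"
      using X by (intro module_hom.subspace_vimage[OF gl]) (simp add: vspace_def)
    then show "T.vs1.subspace {t. g t \<in> carrier X}"
      by (simp add: vimage_def)
    show "g t \<in> carrier X" if "t \<in> S" for t
      using that f key unfolding S_def bilinear_map_def linear_map_def by auto
  qed
  then have "linear_map (V \<otimes> W) X g"
    unfolding linear_map_def carrier_tensor scale_tensor S_def[symmetric]
    using module_hom.add[OF gl] module_hom.scale[OF gl] by blast
  with key show ?thesis
    by blast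
qed

theorem tensor_universal_unique:
  fixes V :: "('k::field, 'a::ab_group_add, 'm) vspace_scheme"
    and W :: "('k, 'b::ab_group_add, 'n) vspace_scheme"
    and X :: "('k, 'c::ab_group_add, 'p) vspace_scheme"
    and t :: "('k, 'a, 'b) tensor"
  assumes X: "vspace X" and g: "linear_map (V \<otimes> W) X g" and h: "linear_map (V \<otimes> W) X h"
    and eq: "\<And>v w. v \<in> carrier V \<Longrightarrow> w \<in> carrier W \<Longrightarrow> g (tens V W v w) = h (tens V W v w)"
    and t: "t \<in> carrier (V \<otimes> W)"
  shows "g t = h t"
proof -
  interpret vX: vector_space "scale X"
    using X by (simp add: vspace_def)
  interpret T: vector_space "tscale :: 'k \<Rightarrow> ('k, 'a, 'b) tensor \<Rightarrow> _"
    by (rule vector_space_tscale)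
  let ?S = "{tens V W v w | v w. v \<in> carrier V \<and> w \<in> carrier W}"
  have z: "k 0 = 0" if "linear_map (V \<otimes> W) X k" for k
  proof -
    have "k (tscale 0 0) = scale X 0 (k 0)"
      using that T.span_zero[of ?S] unfolding linear_map_def carrier_tensor scale_tensor by blast
    then show ?thesis
      by simp
  qed
  have "t \<in> T.span ?S"
    using t by simp
  then have "t \<in> T.span ?S \<and> g t = h t"
  proof (induction rule: T.span_induct_alt)
    case base
    show ?case
      using z[OF g] z[OF h] T.span_zero[of ?S] by (simp only: simp_thms)
  next
    case (step c x y)
    then have x: "x \<in> T.span ?S" and y: "y \<in> T.span ?S" and gx: "g x = h x"
      using eq by (auto intro: T.span_base)
    then have cx: "tscale c x \<in> T.span ?S"
      by (blast intro: T.span_scale)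
    have lin: "k (tscale c x + y) = scale X c (k x) + k y" if "linear_map (V \<otimes> W) X k" for k
    proof -
      have "k (tscale c x + y) = k (tscale c x) + k y"
        using that y cx unfolding linear_map_def carrier_tensor scale_tensor by blast
      moreover have "k (tscale c x) = scale X c (k x)"
        using that x unfolding linear_map_def carrier_tensor scale_tensor by blast
      ultimately show ?thesis
        by (rule trans[OF _ arg_cong])
    qed
    have "g y = h y"
      using step.IH by blast
    then have "g (tscale c x + y) = h (tscale c x + y)"
      unfolding lin[OF g] lin[OF h] gx by (rule arg_cong)
    then show ?case
      using T.span_add[OF cx y] by blast
  qed
  then show ?thesis
    by simp
qed

lemma tlift:
  assumes "vspace V" and "vspace W" and "vspace X" and "bilinear_map V W X f"
  shows tlift_linear: "linear_map (V \<otimes> W) X (tlift V W X f)"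
    and tlift_tens: "\<And>v w. v \<in> carrier V \<Longrightarrow> w \<in> carrier W \<Longrightarrow> tlift V W X f (tens V W v w) = f v w"
  using someI_ex[OF tensor_universal[OF assms]] unfolding tlift_def by blast+


section \<open>Gradings\<close>

text \<open>
  \<open>V\<close> is the internal direct sum of the \<open>G n\<close>: every element has exactly one
  finitely supported decomposition into homogeneous components.
\<close>

definition is_decomp :: "(nat \<Rightarrow> 'a::ab_group_add set) \<Rightarrow> 'a \<Rightarrow> (nat \<Rightarrow> 'a) \<Rightarrow> bool" where
  "is_decomp G x f \<longleftrightarrow>
    (\<forall>n. f n \<in> G n) \<and> finite {n. f n \<noteq> 0} \<and> x = (\<Sum>n | f n \<noteq> 0. f n)"

definition grading ::
  "('k::field, 'a::ab_group_add, 'm) vspace_scheme \<Rightarrow> (nat \<Rightarrow> 'a set) \<Rightarrow> bool" where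
  "grading V G \<longleftrightarrow>
    (\<forall>n. G n \<subseteq> carrier V \<and> module.subspace (scale V) (G n)) \<and>
    (\<forall>x\<in>carrier V. \<exists>!f. is_decomp G x f)"

definition component :: "(nat \<Rightarrow> 'a::ab_group_add set) \<Rightarrow> nat \<Rightarrow> 'a \<Rightarrow> 'a" where
  "component G n x = (THE f. is_decomp G x f) n"

definition tensor_grading ::
  "('k::field, 'a::ab_group_add, 'm) vspace_scheme \<Rightarrow> (nat \<Rightarrow> 'a set)
    \<Rightarrow> ('k, 'b::ab_group_add, 'n) vspace_scheme \<Rightarrow> (nat \<Rightarrow> 'b set)
    \<Rightarrow> nat \<Rightarrow> ('k, 'a, 'b) tensor set" where
  "tensor_grading V G W G' n =
    module.span tscale {tens V W v w | v w i j. v \<in> G i \<and> w \<in> G' j \<and> i + j = n}"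


section \<open>Algebras\<close>

record ('k, 'a) algebra = "('k, 'a) vspace" +
  mult :: "'a \<Rightarrow> 'a \<Rightarrow> 'a"
  unit :: "'a"

definition algebra :: "('k::field, 'a::ab_group_add, 'm) algebra_scheme \<Rightarrow> bool" where
  "algebra A \<longleftrightarrow>
    vspace A \<and> bilinear_map A A A (mult A) \<and> unit A \<in> carrier A \<and>
    (\<forall>x\<in>carrier A. \<forall>y\<in>carrier A. \<forall>z\<in>carrier A.
      mult A (mult A x y) z = mult A x (mult A y z)) \<and>
    (\<forall>x\<in>carrier A. mult A (unit A) x = x \<and> mult A x (unit A) = x)"

definition algebra_hom ::
  "('k::field, 'a::ab_group_add, 'm) algebra_scheme \<Rightarrow> ('k, 'b::ab_group_add, 'n) algebra_scheme
    \<Rightarrow> ('a \<Rightarrow> 'b) \<Rightarrow> bool" where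
  "algebra_hom A B f \<longleftrightarrow>
    linear_map A B f \<and> f (unit A) = unit B \<and>
    (\<forall>x\<in>carrier A. \<forall>y\<in>carrier A. f (mult A x y) = mult B (f x) (f y))"

definition graded_algebra ::
  "('k::field, 'a::ab_group_add, 'm) algebra_scheme \<Rightarrow> (nat \<Rightarrow> 'a set) \<Rightarrow> bool" where
  "graded_algebra A G \<longleftrightarrow>
    algebra A \<and> grading A G \<and> unit A \<in> G 0 \<and>
    (\<forall>i j. \<forall>x\<in>G i. \<forall>y\<in>G j. mult A x y \<in> G (i + j))"

definition ground_algebra :: "('k::field, 'k) algebra" where
  "ground_algebra = \<lparr>carrier = UNIV, scale = (*), mult = (*), unit = 1\<rparr>"

definition tensor_algebra ::
  "('k::field, 'a::ab_group_add, 'm) algebra_scheme \<Rightarrow> ('k, 'b::ab_group_add, 'n) algebra_scheme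
    \<Rightarrow> ('k, ('k, 'a, 'b) tensor) algebra" where
  "tensor_algebra A B =
    \<lparr>carrier = carrier (A \<otimes> B), scale = scale (A \<otimes> B),
     mult = (\<lambda>t u. tlift A B (A \<otimes> B) (\<lambda>a b. tlift A B (A \<otimes> B)
       (\<lambda>a' b'. tens A B (mult A a a') (mult B b b')) u) t),
     unit = tens A B (unit A) (unit B)\<rparr>"


section \<open>Graded Hopf algebras\<close>

record ('k, 'h) hopf_algebra = "('k, 'h) algebra" +
  comul :: "'h \<Rightarrow> ('k, 'h, 'h) tensor"
  counit :: "'h \<Rightarrow> 'k"
  antipode :: "'h \<Rightarrow> 'h"

text \<open>
  In the coassociativity axiom both sides are taken in \<open>H \<otimes> (H \<otimes> H)\<close>, i.e. the
  associativity isomorphism is applied to \<open>(\<Delta> \<otimes> id) \<Delta>(x)\<close>.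
\<close>

definition coalgebra :: "('k::field, 'h::ab_group_add, 'm) hopf_algebra_scheme \<Rightarrow> bool" where
  "coalgebra H \<longleftrightarrow>
    linear_map H (H \<otimes> H) (comul H) \<and> linear_map H ground_algebra (counit H) \<and>
    (\<forall>x\<in>carrier H.
      tlift H H (H \<otimes> H \<otimes> H) (\<lambda>a b. tlift H H (H \<otimes> H \<otimes> H)
          (\<lambda>a1 a2. tens H (H \<otimes> H) a1 (tens H H a2 b)) (comul H a)) (comul H x)
      = tlift H H (H \<otimes> H \<otimes> H) (\<lambda>a b. tens H (H \<otimes> H) a (comul H b)) (comul H x)) \<and>
    (\<forall>x\<in>carrier H.
      tlift H H H (\<lambda>a b. scale H (counit H a) b) (comul H x) = x \<and>
      tlift H H H (\<lambda>a b. scale H (counit H b) a) (comul H x) = x)"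

definition hopf_algebra :: "('k::field, 'h::ab_group_add, 'm) hopf_algebra_scheme \<Rightarrow> bool" where
  "hopf_algebra H \<longleftrightarrow>
    algebra H \<and> coalgebra H \<and>
    algebra_hom H (tensor_algebra H H) (comul H) \<and> algebra_hom H ground_algebra (counit H) \<and>
    linear_map H H (antipode H) \<and>
    (\<forall>x\<in>carrier H.
      tlift H H H (\<lambda>a b. mult H (antipode H a) b) (comul H x) = scale H (counit H x) (unit H) \<and>
      tlift H H H (\<lambda>a b. mult H a (antipode H b)) (comul H x) = scale H (counit H x) (unit H))"

definition graded_hopf_algebra ::
  "('k::field, 'h::ab_group_add, 'm) hopf_algebra_scheme \<Rightarrow> (nat \<Rightarrow> 'h set) \<Rightarrow> bool" where
  "graded_hopf_algebra H G \<longleftrightarrow>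
    hopf_algebra H \<and> graded_algebra H G \<and>
    (\<forall>n. \<forall>x\<in>G n. comul H x \<in> tensor_grading H G H G n) \<and>
    (\<forall>n>0. \<forall>x\<in>G n. counit H x = 0)"

text \<open>
  The degree-zero part, with the restricted operations. For a graded Hopf algebra \<open>H\<close> this is the
  Hopf algebra \<open>H(0)\<close>. The antipode of \<open>H\<close> maps \<open>H(0)\<close> to itself (its degree-preserving part
  is again a convolution inverse of the identity, so by uniqueness it is homogeneous of degree
  \<open>0\<close>) and restricts to the antipode of \<open>H(0)\<close>. The inclusion \<open>\<iota>\<close> is invisible in the
  formulas below.
\<close>

definition degree_zero :: "('k, 'a, 'm) vspace_scheme \<Rightarrow> (nat \<Rightarrow> 'a set) \<Rightarrow> ('k, 'a, 'm) vspace_scheme"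
  where "degree_zero V G = V\<lparr>carrier := G 0\<rparr>"

definition coinvariants ::
  "('k::field, 'h::ab_group_add, 'm) hopf_algebra_scheme \<Rightarrow> (nat \<Rightarrow> 'h set) \<Rightarrow> 'h set" where
  "coinvariants H G =
    {r \<in> carrier H.
      tlift H H (H \<otimes> H) (\<lambda>a b. tens H H a (component G 0 b)) (comul H r) = tens H H r (unit H)}"


section \<open>Comodule algebras\<close>

record ('k, 'h, 'l) comodule_algebra = "('k, 'l) algebra" +
  coact :: "'l \<Rightarrow> ('k, 'h, 'l) tensor"

definition comodule_algebra ::
  "('k::field, 'h::ab_group_add, 'm) hopf_algebra_scheme
    \<Rightarrow> ('k, 'h, 'l::ab_group_add, 'n) comodule_algebra_scheme \<Rightarrow> bool" where
  "comodule_algebra H L \<longleftrightarrow>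
    algebra L \<and> algebra_hom L (tensor_algebra H L) (coact L) \<and>
    (\<forall>x\<in>carrier L.
      tlift H L (H \<otimes> H \<otimes> L) (\<lambda>h l. tlift H H (H \<otimes> H \<otimes> L)
          (\<lambda>h1 h2. tens H (H \<otimes> L) h1 (tens H L h2 l)) (comul H h)) (coact L x)
      = tlift H L (H \<otimes> H \<otimes> L) (\<lambda>h l. tens H (H \<otimes> L) h (coact L l)) (coact L x)) \<and>
    (\<forall>x\<in>carrier L. tlift H L L (\<lambda>h l. scale L (counit H h) l) (coact L x) = x)"

definition graded_comodule_algebra ::
  "('k::field, 'h::ab_group_add, 'm) hopf_algebra_scheme \<Rightarrow> (nat \<Rightarrow> 'h set)
    \<Rightarrow> ('k, 'h, 'l::ab_group_add, 'n) comodule_algebra_scheme \<Rightarrow> (nat \<Rightarrow> 'l set) \<Rightarrow> bool" where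
  "graded_comodule_algebra H HG L LG \<longleftrightarrow>
    comodule_algebra H L \<and> graded_algebra L LG \<and>
    (\<forall>n. \<forall>x\<in>LG n. coact L x \<in> tensor_grading H HG L LG n)"

definition subcomodule ::
  "('k::field, 'h::ab_group_add, 'm) hopf_algebra_scheme
    \<Rightarrow> ('k, 'h, 'l::ab_group_add, 'n) comodule_algebra_scheme \<Rightarrow> 'l set \<Rightarrow> bool" where
  "subcomodule H L M \<longleftrightarrow>
    M \<subseteq> carrier L \<and> module.subspace (scale L) M \<and>
    (\<forall>x\<in>M. coact L x \<in> carrier (H \<otimes> L\<lparr>carrier := M\<rparr>))"

definition right_ideal :: "('k::field, 'l::ab_group_add, 'n) algebra_scheme \<Rightarrow> 'l set \<Rightarrow> bool" where
  "right_ideal L I \<longleftrightarrow>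
    I \<subseteq> carrier L \<and> module.subspace (scale L) I \<and> (\<forall>x\<in>I. \<forall>y\<in>carrier L. mult L x y \<in> I)"

definition right_simple ::
  "('k::field, 'h::ab_group_add, 'm) hopf_algebra_scheme
    \<Rightarrow> ('k, 'h, 'l::ab_group_add, 'n) comodule_algebra_scheme \<Rightarrow> bool" where
  "right_simple H L \<longleftrightarrow>
    carrier L \<noteq> {0} \<and>
    (\<forall>I. right_ideal L I \<and> subcomodule H L I \<longrightarrow> I = {0} \<or> I = carrier L)"

definition graded_comodule_subalgebra ::
  "('k::field, 'h::ab_group_add, 'm) hopf_algebra_scheme
    \<Rightarrow> ('k, 'h, 'l::ab_group_add, 'n) comodule_algebra_scheme \<Rightarrow> (nat \<Rightarrow> 'l set)
    \<Rightarrow> 'l set \<Rightarrow> bool" where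
  "graded_comodule_subalgebra H L LG M \<longleftrightarrow>
    subcomodule H L M \<and> unit L \<in> M \<and> (\<forall>x\<in>M. \<forall>y\<in>M. mult L x y \<in> M) \<and>
    grading (L\<lparr>carrier := M\<rparr>) (\<lambda>n. LG n \<inter> M)"

definition graded_comodule_algebra_iso ::
  "('k::field, 'h::ab_group_add, 'm) hopf_algebra_scheme
    \<Rightarrow> ('k, 'h, 'l::ab_group_add, 'n) comodule_algebra_scheme \<Rightarrow> (nat \<Rightarrow> 'l set)
    \<Rightarrow> ('k, 'h, 'a::ab_group_add, 'p) comodule_algebra_scheme \<Rightarrow> (nat \<Rightarrow> 'a set)
    \<Rightarrow> ('l \<Rightarrow> 'a) \<Rightarrow> bool" where
  "graded_comodule_algebra_iso H L LG M MG \<phi> \<longleftrightarrow>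
    algebra_hom L M \<phi> \<and> bij_betw \<phi> (carrier L) (carrier M) \<and> (\<forall>n. \<phi> ` LG n = MG n) \<and>
    (\<forall>x\<in>carrier L. coact M (\<phi> x) = tlift H L (H \<otimes> M) (\<lambda>h l. tens H M h (\<phi> l)) (coact L x))"


section \<open>The comodule algebra on the coinvariants tensored with an H(0)-comodule algebra\<close>

text \<open>
  Here \<open>E\<close> is a left \<open>H(0)\<close>-comodule algebra. In the multiplication,
  \<open>\<ell>\<^sub>(\<^sub>-\<^sub>2\<^sub>) \<otimes> \<ell>\<^sub>(\<^sub>-\<^sub>1\<^sub>) \<otimes> \<ell>\<^sub>(\<^sub>0\<^sub>)\<close> is obtained
  by applying the coaction of \<open>E\<close> to \<open>\<ell>\<close> and then again to the second leg. The values of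
  the multiplication and the coaction lie in \<open>R \<otimes> E\<close> and \<open>H \<otimes> (R \<otimes> E)\<close>,
  where \<open>R\<close> is the space of coinvariants, but the individual summands need not; hence they are formed in
  \<open>H \<otimes> E\<close> and \<open>H \<otimes> (H \<otimes> E)\<close>.
\<close>

definition smash ::
  "('k::field, 'h::ab_group_add, 'm) hopf_algebra_scheme \<Rightarrow> (nat \<Rightarrow> 'h set)
    \<Rightarrow> ('k, 'h, 'l::ab_group_add, 'n) comodule_algebra_scheme
    \<Rightarrow> ('k, 'h, ('k, 'h, 'l) tensor) comodule_algebra" where
  "smash H G E = (let H0 = degree_zero H G; R = H\<lparr>carrier := coinvariants H G\<rparr> in
    \<lparr>carrier = carrier (R \<otimes> E), scale = scale (R \<otimes> E),
     mult = (\<lambda>t u.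
       tlift R E (H \<otimes> E) (\<lambda>a l. tlift R E (H \<otimes> E) (\<lambda>b m.
         tlift H0 E (H \<otimes> E) (\<lambda>l2 e. tlift H0 E (H \<otimes> E) (\<lambda>l1 l0.
           tens H E (mult H (mult H (mult H a l2) b) (antipode H0 l1)) (mult E l0 m))
         (coact E e)) (coact E l)) u) t),
     unit = tens H E (unit H) (unit E),
     coact =
       tlift R E (H \<otimes> H \<otimes> E) (\<lambda>a l.
         tlift H H (H \<otimes> H \<otimes> E) (\<lambda>a1 a2. tlift H0 E (H \<otimes> H \<otimes> E) (\<lambda>l1 l0.
           tens H (H \<otimes> E) (mult H a1 l1) (tens H E a2 l0))
         (coact E l)) (comul H a))\<rparr>)"

definition smash_grading ::
  "('k::field, 'h::ab_group_add, 'm) hopf_algebra_scheme \<Rightarrow> (nat \<Rightarrow> 'h set)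
    \<Rightarrow> ('k, 'h, 'l::ab_group_add, 'n) comodule_algebra_scheme
    \<Rightarrow> nat \<Rightarrow> ('k, 'h, 'l) tensor set" where
  "smash_grading H G E n = carrier (H\<lparr>carrier := G n \<inter> coinvariants H G\<rparr> \<otimes> E)"

end

theory Submission
  imports Defs
begin

text \<open>
  Let \<open>\<pi>\<close> be the projection of \<open>L\<close> onto \<open>L(0)\<close>. Then \<open>\<psi> = (id \<otimes> \<pi>) \<rho>\<close> is an algebra map from
  \<open>L\<close> into the cotensor product of \<open>H\<close> and \<open>L(0)\<close> over \<open>H(0)\<close>. Its kernel is a right ideal and a
  subcomodule not containing \<open>1\<close>, so it vanishes as \<open>L\<close> is right \<open>H\<close>-simple. The embedding is
  \<open>\<phi> = \<theta> \<psi>\<close>, where \<open>\<theta>(h \<otimes> l) = h S(l\<^sub>(\<^sub>-\<^sub>1\<^sub>)) \<otimes> l\<^sub>(\<^sub>0\<^sub>)\<close> has the inverse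
  \<open>\<theta>'(h \<otimes> l) = h l\<^sub>(\<^sub>-\<^sub>1\<^sub>) \<otimes> l\<^sub>(\<^sub>0\<^sub>)\<close>. Both are defined on all of \<open>H \<otimes> L\<close>, and since \<open>\<theta>'\<close> carries
  the smash multiplication to the tensor product multiplication, multiplicativity of \<open>\<phi>\<close> follows
  from injectivity of \<open>\<theta>'\<close>; no anti-multiplicativity of the antipode is needed. Coinvariance is
  tested on slices: a tensor lies in \<open>K \<otimes> W\<close> iff all its contractions by functionals on \<open>W\<close>
  lie in \<open>K\<close>.
\<close>

section \<open>Linear maps and sums over tensors\<close>

text \<open>The target arises because \<open>H\<close> is itself a smash product of its coinvariants
  with \<open>H(0)\<close>: the cotensor product of \<open>H\<close> and \<open>L(0)\<close> over
  \<open>H(0)\<close> becomes the coinvariants tensored with \<open>L(0)\<close>, and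
  \<open>\<theta>\<close> is this identification. The grading by natural numbers matters because i +
  j = 0 forces i = j = 0; hence the projections onto degree zero are multiplicative and compatible
  with the coactions. The kernel of \<open>\<psi>\<close> misses 1 because the counit, applied to
  the first leg of \<open>\<psi>\<close>, gives the projection of \<open>L\<close>. The obstacle is
  that properties of a tensor cannot be read off the summands of a representation: the left legs
  chosen for \<open>\<phi> x\<close> need be neither coinvariant nor homogeneous. So identities
  between tensors are stated after applying an arbitrary bilinear or trilinear \<open>F\<close>, and
  membership in a subspace is tested by contraction. Degrees are compared after
  \<open>\<theta>'\<close>, which on \<open>H \<otimes> L(0)\<close> multiplies the first leg by
  elements of degree zero.\<close>

declare carrier_tensor [simp del]

lemma vspace_closed:
  fixes V :: "('k::field, 'a::ab_group_add, 'm) vspace_scheme"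
  assumes "vspace V"
  shows vspace_zero: "0 \<in> carrier V"
    and vspace_add: "x \<in> carrier V \<Longrightarrow> y \<in> carrier V \<Longrightarrow> x + y \<in> carrier V"
    and vspace_diff: "x \<in> carrier V \<Longrightarrow> y \<in> carrier V \<Longrightarrow> x - y \<in> carrier V"
    and vspace_scale: "x \<in> carrier V \<Longrightarrow> scale V c x \<in> carrier V"
proof -
  interpret V: vector_space "scale V" using assms by (simp add: vspace_def)
  show "0 \<in> carrier V" "x \<in> carrier V \<Longrightarrow> y \<in> carrier V \<Longrightarrow> x + y \<in> carrier V"
    "x \<in> carrier V \<Longrightarrow> y \<in> carrier V \<Longrightarrow> x - y \<in> carrier V"
    "x \<in> carrier V \<Longrightarrow> scale V c x \<in> carrier V"
    using assms by (auto simp: vspace_def V.subspace_0 V.subspace_add V.subspace_diff V.subspace_scale)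
qed

lemma vspace_sum: "vspace V \<Longrightarrow> (\<And>i. i \<in> A \<Longrightarrow> x i \<in> carrier V) \<Longrightarrow> sum x A \<in> carrier V"
  by (induction A rule: infinite_finite_induct) (auto intro: vspace_zero vspace_add)

lemma linear_mapD:
  assumes "linear_map V W f"
  shows linear_map_carrier: "x \<in> carrier V \<Longrightarrow> f x \<in> carrier W"
    and linear_map_add: "x \<in> carrier V \<Longrightarrow> y \<in> carrier V \<Longrightarrow> f (x + y) = f x + f y"
    and linear_map_scale: "x \<in> carrier V \<Longrightarrow> f (scale V c x) = scale W c (f x)"
  using assms by (auto simp: linear_map_def)

lemma linear_map_zero: "vspace V \<Longrightarrow> linear_map V W f \<Longrightarrow> f 0 = 0"
  using linear_map_add[of V W f 0 0] vspace_zero[of V] by auto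

lemma linear_map_sum:
  assumes "vspace V" "linear_map V W f" "\<And>i. i \<in> A \<Longrightarrow> x i \<in> carrier V"
  shows "f (sum x A) = (\<Sum>i\<in>A. f (x i))"
  using assms(3)
  by (induction A rule: infinite_finite_induct)
    (auto simp: linear_map_zero[OF assms(1,2)] linear_map_add[OF assms(2)] vspace_sum[OF assms(1)])

lemma linear_map_diff:
  assumes "vspace V" "linear_map V W f" "x \<in> carrier V" "y \<in> carrier V"
  shows "f (x - y) = f x - f y"
proof -
  have "f ((x - y) + y) = f (x - y) + f y"
    using assms by (intro linear_map_add vspace_diff)
  then show ?thesis by simp
qed

lemma linear_map_zero_fun:
  assumes "vspace W"
  shows "linear_map V W (\<lambda>x. 0)"
proof -
  interpret W: vector_space "scale W" using assms by (simp add: vspace_def)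
  show ?thesis using vspace_zero[OF assms] by (simp add: linear_map_def)
qed

lemma linear_map_scaling:
  assumes "vspace V"
  shows "linear_map V V (scale V c)"
proof -
  interpret V: vector_space "scale V" using assms by (simp add: vspace_def)
  show ?thesis
    unfolding linear_map_def
    by (intro conjI ballI allI vspace_scale[OF assms] V.scale_right_distrib)
      (simp_all only: V.scale_scale mult.commute)
qed

text \<open>Serves for the coinvariants, an equalizer of two maps into \<open>H \<otimes> H\<close>,
  and, with \<open>g\<close> zero, for the kernel of \<open>\<psi>\<close>.\<close>

lemma linear_map_equalizer:
  assumes V: "vspace V" and f: "linear_map V W f" and g: "linear_map V W g"
  shows "vspace (V\<lparr>carrier := {x \<in> carrier V. f x = g x}\<rparr>)"
proof -
  interpret V: vector_space "scale V" using V by (simp add: vspace_def)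
  have "V.subspace {x \<in> carrier V. f x = g x}"
    by (rule V.subspaceI)
      (auto simp: linear_map_zero[OF V f] linear_map_zero[OF V g] linear_map_add[OF f] linear_map_add[OF g]
        linear_map_scale[OF f] linear_map_scale[OF g] vspace_closed[OF V])
  then show ?thesis by (simp add: vspace_def V.vector_space_axioms)
qed

lemma bilinear_mapI:
  assumes "\<And>v. v \<in> carrier V \<Longrightarrow> linear_map W X (f v)"
    and "\<And>w. w \<in> carrier W \<Longrightarrow> linear_map V X (\<lambda>v. f v w)"
  shows "bilinear_map V W X f"
  using assms by (simp add: bilinear_map_def)

lemma bilinear_mapD:
  assumes "bilinear_map V W X f"
  shows bilinear_map_right: "v \<in> carrier V \<Longrightarrow> linear_map W X (f v)"
    and bilinear_map_left: "w \<in> carrier W \<Longrightarrow> linear_map V X (\<lambda>v. f v w)"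
    and bilinear_map_carrier: "v \<in> carrier V \<Longrightarrow> w \<in> carrier W \<Longrightarrow> f v w \<in> carrier X"
  using assms by (auto simp: bilinear_map_def linear_map_def)

lemma linear_map_id: "linear_map V V (\<lambda>x. x)"
  by (simp add: linear_map_def)

lemma linear_map_compose:
  "linear_map V W f \<Longrightarrow> linear_map U V g \<Longrightarrow> linear_map U X (\<lambda>x. f (g x))"
  if "X = W"
  using that by (simp add: linear_map_def)

lemma linear_map_bilinear:
  assumes "bilinear_map V W X f"
  shows linear_map_bilinear_left: "linear_map U V g \<Longrightarrow> w \<in> carrier W \<Longrightarrow> linear_map U X (\<lambda>x. f (g x) w)"
    and linear_map_bilinear_right: "linear_map U W h \<Longrightarrow> v \<in> carrier V \<Longrightarrow> linear_map U X (\<lambda>x. f v (h x))"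
  using assms by (auto simp: bilinear_map_def linear_map_def)

text \<open>The forms that define \<open>tens\<close> range over the ambient spaces, so the carriers
  do not enter. Hence \<open>tens H E\<close> and \<open>tens H L\<close> are the same function, and
  tensor products of subspaces embed by inclusion.\<close>

lemma tens_cong: "scale V = scale V' \<Longrightarrow> scale W = scale W' \<Longrightarrow> tens V W = tens V' W'"
  by (simp add: tens_def[abs_def] bilinear_form_def)

lemma tens_scale_left:
  assumes "vspace V" "vspace W" "v \<in> carrier V" "w \<in> carrier W"
  shows "tens V W (scale V c v) w = scale (V \<otimes> W) c (tens V W v w)"
  by (rule linear_map_scale[OF bilinear_map_left[OF tens_bilinear[OF assms(1,2)] assms(4)] assms(3)])

lemma tensor_mono:
  fixes V :: "('k::field, 'a::ab_group_add, 'm) vspace_scheme"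
    and W :: "('k, 'b::ab_group_add, 'n) vspace_scheme"
  assumes "scale V' = scale V" "scale W' = scale W" "carrier V' \<subseteq> carrier V" "carrier W' \<subseteq> carrier W"
  shows "carrier (V' \<otimes> W') \<subseteq> carrier (V \<otimes> W)"
proof -
  interpret T: vector_space "tscale :: 'k \<Rightarrow> ('k, 'a, 'b) tensor \<Rightarrow> _"
    by (rule vector_space_tscale)
  show ?thesis
    unfolding carrier_tensor tens_cong[OF assms(1,2)] using assms(3,4) by (intro T.span_mono) auto
qed

text \<open>A scalar in front of a simple tensor is absorbed into its left factor, so the step adds
  a bare simple tensor.\<close>

lemma tensor_carrier_induct [consumes 1, case_names zero add]:
  fixes V :: "('k::field, 'a::ab_group_add, 'm) vspace_scheme"
    and W :: "('k, 'b::ab_group_add, 'n) vspace_scheme"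
  assumes t: "t \<in> carrier (V \<otimes> W)" and V: "vspace V" "vspace W"
    and "P 0"
    and step: "\<And>v w u. v \<in> carrier V \<Longrightarrow> w \<in> carrier W \<Longrightarrow> u \<in> carrier (V \<otimes> W) \<Longrightarrow> P u \<Longrightarrow> P (tens V W v w + u)"
  shows "P t"
proof -
  interpret T: vector_space "tscale :: 'k \<Rightarrow> ('k, 'a, 'b) tensor \<Rightarrow> _"
    by (rule vector_space_tscale)
  have "t \<in> T.span {tens V W v w | v w. v \<in> carrier V \<and> w \<in> carrier W}"
    using t by (simp add: carrier_tensor)
  then have "t \<in> carrier (V \<otimes> W) \<and> P t"
  proof (induction rule: T.span_induct_alt)
    case base
    show ?case by (rule conjI[OF vspace_zero[OF vspace_tensor] assms(4)])
  next
    case (step c x y)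
    then obtain v w where x: "x = tens V W v w" "v \<in> carrier V" "w \<in> carrier W" by auto
    have "tscale c x = tens V W (scale V c v) w"
      using linear_map_scale[OF bilinear_map_left[OF tens_bilinear[OF V] x(3)] x(2)] x(1) by simp
    moreover have "tscale c x + y \<in> carrier (V \<otimes> W)"
      using step(2) vspace_scale[OF vspace_tensor tens_in_carrier[OF x(2,3)]]
      by (intro vspace_add[OF vspace_tensor]) (simp_all only: x(1) scale_tensor)
    ultimately show ?case
      using step(2) assms(5)[OF vspace_scale[OF V(1) x(2)] x(3), of y c] x by metis
  qed
  then show ?thesis ..
qed

text \<open>
  A term \<open>f x\<^sub>(\<^sub>1\<^sub>) x\<^sub>(\<^sub>2\<^sub>)\<close> is summed over a chosen representation by simple tensors. The
  representation of a junk argument is empty, so that congruence and exchange of sums need no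
  membership or bilinearity assumptions.
\<close>

definition tensor_rep where
  "tensor_rep V W t = (if t \<in> carrier (V \<otimes> W)
    then SOME xs. set xs \<subseteq> carrier V \<times> carrier W \<and>
      t = (\<Sum>i<length xs. tens V W (fst (xs ! i)) (snd (xs ! i))) else [])"

definition sweedler ::
  "('k::field, 'a::ab_group_add, 'm) vspace_scheme \<Rightarrow> ('k, 'b::ab_group_add, 'n) vspace_scheme
    \<Rightarrow> ('k, 'a, 'b) tensor \<Rightarrow> ('a \<Rightarrow> 'b \<Rightarrow> 'c::ab_group_add) \<Rightarrow> 'c" where
  "sweedler V W t f =
    (\<Sum>i<length (tensor_rep V W t). f (fst (tensor_rep V W t ! i)) (snd (tensor_rep V W t ! i)))"

lemma tensor_rep_ex:
  assumes "vspace V" "vspace W" "t \<in> carrier (V \<otimes> W)"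
  shows "\<exists>xs. set xs \<subseteq> carrier V \<times> carrier W \<and>
      t = (\<Sum>i<length xs. tens V W (fst (xs ! i)) (snd (xs ! i)))"
proof (rule tensor_carrier_induct[OF assms(3,1,2)])
  show "\<exists>xs. set xs \<subseteq> carrier V \<times> carrier W \<and>
      0 = (\<Sum>i<length xs. tens V W (fst (xs ! i)) (snd (xs ! i)))"
    by (intro exI[of _ "[]"]) auto
next
  fix v w u
  assume "v \<in> carrier V" "w \<in> carrier W" and "\<exists>xs. set xs \<subseteq> carrier V \<times> carrier W \<and>
      u = (\<Sum>i<length xs. tens V W (fst (xs ! i)) (snd (xs ! i)))"
  then show "\<exists>xs. set xs \<subseteq> carrier V \<times> carrier W \<and>
      tens V W v w + u = (\<Sum>i<length xs. tens V W (fst (xs ! i)) (snd (xs ! i)))"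
    apply clarify subgoal for xs
      by (rule exI[of _ "(v, w) # xs"]) (auto simp: sum.lessThan_Suc_shift simp del: sum.lessThan_Suc)
    done
qed

lemma tensor_rep:
  assumes "vspace V" "vspace W" "t \<in> carrier (V \<otimes> W)"
  shows "set (tensor_rep V W t) \<subseteq> carrier V \<times> carrier W"
    and "(\<Sum>i<length (tensor_rep V W t).
      tens V W (fst (tensor_rep V W t ! i)) (snd (tensor_rep V W t ! i))) = t"
  using someI_ex[OF tensor_rep_ex[OF assms]] assms(3) unfolding tensor_rep_def by auto

lemma tensor_rep_carrier:
  assumes "vspace V" "vspace W" "i < length (tensor_rep V W t)"
  shows "fst (tensor_rep V W t ! i) \<in> carrier V" "snd (tensor_rep V W t ! i) \<in> carrier W"
proof -
  have "t \<in> carrier (V \<otimes> W)"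
    using assms(3) by (auto simp: tensor_rep_def split: if_splits)
  from tensor_rep(1)[OF assms(1,2) this] assms(3) have
    "tensor_rep V W t ! i \<in> carrier V \<times> carrier W" by (meson nth_mem subsetD)
  then show "fst (tensor_rep V W t ! i) \<in> carrier V" "snd (tensor_rep V W t ! i) \<in> carrier W"
    by auto
qed

lemma sweedler_cong:
  assumes "vspace V" "vspace W" "t = t'"
    and "\<And>v w. v \<in> carrier V \<Longrightarrow> w \<in> carrier W \<Longrightarrow> f v w = g v w"
  shows "sweedler V W t f = sweedler V W t' g"
  unfolding sweedler_def using assms tensor_rep_carrier[OF assms(1,2)] by (auto intro!: sum.cong)

lemma sweedler_carrier:
  assumes "vspace V" "vspace W" "vspace X"
    and "\<And>v w. v \<in> carrier V \<Longrightarrow> w \<in> carrier W \<Longrightarrow> f v w \<in> carrier X"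
  shows "sweedler V W t f \<in> carrier X"
  unfolding sweedler_def using assms tensor_rep_carrier[OF assms(1,2)] by (auto intro!: vspace_sum)

lemma sweedler_swap:
  "sweedler V W t (\<lambda>a b. sweedler V' W' u (\<lambda>c d. f a b c d)) =
    sweedler V' W' u (\<lambda>c d. sweedler V W t (\<lambda>a b. f a b c d))"
  unfolding sweedler_def by (rule sum.swap)

lemma linear_map_sweedler:
  assumes "vspace V" "vspace W" "vspace X" "linear_map X Y g"
    and "\<And>v w. v \<in> carrier V \<Longrightarrow> w \<in> carrier W \<Longrightarrow> f v w \<in> carrier X"
  shows "g (sweedler V W t f) = sweedler V W t (\<lambda>v w. g (f v w))"
  unfolding sweedler_def using assms tensor_rep_carrier[OF assms(1,2)]
  by (subst linear_map_sum[OF assms(3,4)]) auto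

lemma sweedler_tens_id:
  assumes "vspace V" "vspace W" "t \<in> carrier (V \<otimes> W)"
  shows "sweedler V W t (tens V W) = t"
  unfolding sweedler_def by (rule tensor_rep(2)[OF assms])

text \<open>Independence of the chosen representation: once the summand extends to a linear map on
  the tensor product, the sum is the value of that map, whichever representation was picked.\<close>

lemma sweedler_eq_linear_map:
  assumes "vspace V" "vspace W" "vspace X" "t \<in> carrier (V \<otimes> W)"
    and "linear_map (V \<otimes> W) X g"
    and "\<And>v w. v \<in> carrier V \<Longrightarrow> w \<in> carrier W \<Longrightarrow> g (tens V W v w) = f v w"
  shows "sweedler V W t f = g t"
proof -
  have "g t = g (sweedler V W t (tens V W))"
    using sweedler_tens_id[OF assms(1,2,4)] by simp
  also have "\<dots> = sweedler V W t f"
    by (subst linear_map_sweedler[OF assms(1,2) vspace_tensor assms(5)])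
      (auto intro: tens_in_carrier sweedler_cong assms)
  finally show ?thesis by simp
qed

lemma linear_map_cong:
  assumes "\<And>x. x \<in> carrier V \<Longrightarrow> f x = g x" "vspace V"
  shows "linear_map V W f \<longleftrightarrow> linear_map V W g"
  using assms vspace_add[OF assms(2)] vspace_scale[OF assms(2)] unfolding linear_map_def by auto

lemma linear_map_sweedler_tensor:
  assumes "vspace V" "vspace W" "vspace X" "bilinear_map V W X f"
  shows "linear_map (V \<otimes> W) X (\<lambda>t. sweedler V W t f)"
proof -
  obtain g where g: "linear_map (V \<otimes> W) X g"
    "\<forall>v\<in>carrier V. \<forall>w\<in>carrier W. g (tens V W v w) = f v w"
    using tensor_universal[OF assms] by blast
  then have "sweedler V W t f = g t" if "t \<in> carrier (V \<otimes> W)" for t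
    using sweedler_eq_linear_map[OF assms(1-3) that g(1)] by auto
  then show ?thesis
    using linear_map_cong[OF _ vspace_tensor, of V W "\<lambda>t. sweedler V W t f" g X] g(1) by auto
qed

lemma sweedler_tens:
  assumes "vspace V" "vspace W" "vspace X" "bilinear_map V W X f" "v \<in> carrier V" "w \<in> carrier W"
  shows "sweedler V W (tens V W v w) f = f v w"
proof -
  obtain g where g: "linear_map (V \<otimes> W) X g"
    "\<forall>v\<in>carrier V. \<forall>w\<in>carrier W. g (tens V W v w) = f v w"
    using tensor_universal[OF assms(1-4)] by blast
  then show ?thesis
    using sweedler_eq_linear_map[OF assms(1-3) tens_in_carrier g(1)] assms by auto
qed

lemma linear_map_sweedler_arg:
  assumes "vspace V" "vspace W" "vspace X" "bilinear_map V W X f" "linear_map U (V \<otimes> W) g"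
  shows "linear_map U X (\<lambda>x. sweedler V W (g x) f)"
  using linear_map_compose[OF refl linear_map_sweedler_tensor[OF assms(1-4)] assms(5)] .

lemma linear_map_sum_fun:
  assumes "vspace X" "\<And>i. i \<in> A \<Longrightarrow> linear_map U X (f i)"
  shows "linear_map U X (\<lambda>x. \<Sum>i\<in>A. f i x)"
proof -
  interpret X: vector_space "scale X" using assms(1) by (simp add: vspace_def)
  show ?thesis
    using assms(2) unfolding linear_map_def
    by (auto simp: sum.distrib X.scale_sum_right intro!: vspace_sum[OF assms(1)])
qed

lemma linear_map_sweedler_body:
  assumes "vspace V" "vspace W" "vspace X"
    and "\<And>v w. v \<in> carrier V \<Longrightarrow> w \<in> carrier W \<Longrightarrow> linear_map U X (\<lambda>x. f x v w)"
  shows "linear_map U X (\<lambda>x. sweedler V W t (f x))"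
  unfolding sweedler_def
  by (rule linear_map_sum_fun[OF assms(3)]) (auto intro!: assms(4) tensor_rep_carrier[OF assms(1,2)])

lemma sweedler_sweedler:
  assumes "vspace V" "vspace W" "vspace V'" "vspace W'" "vspace X" "bilinear_map V' W' X g"
    and "\<And>v w. v \<in> carrier V \<Longrightarrow> w \<in> carrier W \<Longrightarrow> f v w \<in> carrier (V' \<otimes> W')"
  shows "sweedler V' W' (sweedler V W t f) g = sweedler V W t (\<lambda>v w. sweedler V' W' (f v w) g)"
  by (rule linear_map_sweedler[OF assms(1,2) vspace_tensor linear_map_sweedler_tensor[OF assms(3-6)]
        assms(7)])

text \<open>The representations of \<open>t\<close> chosen in the small and in the large tensor
  product may differ. Bilinearity on the large carriers makes both sums the value of one linear
  map.\<close>

lemma sweedler_sub: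
  assumes "vspace V'" "vspace W'" "vspace V" "vspace W" "vspace X"
    and "scale V' = scale V" "scale W' = scale W" "carrier V' \<subseteq> carrier V" "carrier W' \<subseteq> carrier W"
    and "bilinear_map V W X f" "t \<in> carrier (V' \<otimes> W')"
  shows "sweedler V W t f = sweedler V' W' t f"
proof -
  have "sweedler V' W' t f = (\<lambda>t. sweedler V W t f) t"
  proof (rule sweedler_eq_linear_map[OF assms(1,2,5,11)])
    have "linear_map (V \<otimes> W) X (\<lambda>t. sweedler V W t f)"
      by (rule linear_map_sweedler_tensor[OF assms(3,4,5,10)])
    then show "linear_map (V' \<otimes> W') X (\<lambda>t. sweedler V W t f)"
      using tensor_mono[OF assms(6-9)] by (auto simp: linear_map_def subset_iff)
    show "sweedler V W (tens V' W' v w) f = f v w" if "v \<in> carrier V'" "w \<in> carrier W'" for v w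
      using tens_cong[OF assms(6,7)] sweedler_tens[OF assms(3,4,5,10)] that assms(8,9) by auto
  qed
  then show ?thesis by simp
qed

text \<open>Bridge from the definitions, which use \<open>tlift\<close> on subspaces with a smaller
  target, to sums over ambient spaces. The function \<open>g\<close> has to agree with the bilinear
  \<open>f\<close> only on the small carriers, which leaves room for rewriting inside
  \<open>g\<close>.\<close>

lemma tlift_eq_sweedler:
  assumes "vspace V'" "vspace W'" "vspace V" "vspace W" "vspace X" "vspace X'"
    and "scale V' = scale V" "scale W' = scale W" "carrier V' \<subseteq> carrier V" "carrier W' \<subseteq> carrier W"
    and "scale X' = scale X"
    and "bilinear_map V W X f" "t \<in> carrier (V' \<otimes> W')"
    and "\<And>v w. v \<in> carrier V' \<Longrightarrow> w \<in> carrier W' \<Longrightarrow> f v w \<in> carrier X'"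
    and "\<And>v w. v \<in> carrier V' \<Longrightarrow> w \<in> carrier W' \<Longrightarrow> g v w = f v w"
  shows "tlift V' W' X' g t = sweedler V W t f"
proof -
  have "bilinear_map V' W' X' f"
    using assms(7-12,14) unfolding bilinear_map_def linear_map_def by (auto simp: subset_iff)
  then have "bilinear_map V' W' X' g"
    unfolding bilinear_map_def
    using linear_map_cong[of W' "f _" "g _" X'] linear_map_cong[of V' "\<lambda>v. f v _" "\<lambda>v. g v _" X'] assms(1,2,15)
    by metis
  note T = tlift_linear[OF assms(1,2,6) this] tlift_tens[OF assms(1,2,6) this]
  have "sweedler V' W' t f = tlift V' W' X' g t"
    using T assms(13,15) by (intro sweedler_eq_linear_map[OF assms(1,2,6)]) auto
  then show ?thesis using sweedler_sub[OF assms(1-5,7-10,12,13)] by simp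
qed

lemma tlift_sweedler:
  assumes "vspace V" "vspace W" "vspace X" "bilinear_map V W X f" "t \<in> carrier (V \<otimes> W)"
  shows "tlift V W X f t = sweedler V W t f"
  by (rule tlift_eq_sweedler[OF assms(1,2,1,2,3,3)])
    (auto intro: assms bilinear_map_carrier[OF assms(4)])

lemma sweedler_sub_carrier:
  assumes "vspace V'" "vspace W'" "vspace V" "vspace W" "vspace X" "vspace X'"
    and "scale V' = scale V" "scale W' = scale W" "carrier V' \<subseteq> carrier V" "carrier W' \<subseteq> carrier W"
    and "bilinear_map V W X f" "t \<in> carrier (V' \<otimes> W')"
    and "\<And>v w. v \<in> carrier V' \<Longrightarrow> w \<in> carrier W' \<Longrightarrow> f v w \<in> carrier X'"
  shows "sweedler V W t f \<in> carrier X'"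
  unfolding sweedler_sub[OF assms(1-5,7-12)]
  by (rule sweedler_carrier[OF assms(1,2,6)]) (rule assms(13))

text \<open>Equality and membership are proved together because lifts occur nested: membership of an
  inner value is what the enclosing lift demands of its summand.\<close>

lemma tlift_sub_sweedler:
  assumes "vspace V'" "vspace W'" "vspace V" "vspace W" "vspace X" "vspace X'"
    and "scale V' = scale V" "scale W' = scale W" "carrier V' \<subseteq> carrier V" "carrier W' \<subseteq> carrier W"
    and "scale X' = scale X"
    and "bilinear_map V W X f" "t \<in> carrier (V' \<otimes> W')"
    and "\<And>v w. v \<in> carrier V' \<Longrightarrow> w \<in> carrier W' \<Longrightarrow> g v w = f v w \<and> f v w \<in> carrier X'"
  shows "tlift V' W' X' g t = sweedler V W t f \<and> sweedler V W t f \<in> carrier X'"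
  using tlift_eq_sweedler[OF assms(1-13)] sweedler_sub_carrier[OF assms(1-10,12,13)] assms(14) by blast

lemma tlift_sweedler_cong:
  assumes "vspace V" "vspace W" "vspace X" "bilinear_map V W X f" "t \<in> carrier (V \<otimes> W)"
    and "\<And>v w. v \<in> carrier V \<Longrightarrow> w \<in> carrier W \<Longrightarrow> g v w = f v w"
  shows "tlift V W X g t = sweedler V W t f"
  by (rule tlift_eq_sweedler[OF assms(1,2,1,2,3,3)])
    (auto intro: assms bilinear_map_carrier[OF assms(4)])

text \<open>Identities in a threefold tensor product are tested on these maps, which avoids fixing a
  bracketing.\<close>

definition trilinear_map where
  "trilinear_map A B C X F \<longleftrightarrow>
    (\<forall>b\<in>carrier B. \<forall>c\<in>carrier C. linear_map A X (\<lambda>a. F a b c)) \<and>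
    (\<forall>a\<in>carrier A. \<forall>c\<in>carrier C. linear_map B X (\<lambda>b. F a b c)) \<and>
    (\<forall>a\<in>carrier A. \<forall>b\<in>carrier B. linear_map C X (\<lambda>c. F a b c))"

lemma trilinear_mapI:
  assumes "\<And>b c. b \<in> carrier B \<Longrightarrow> c \<in> carrier C \<Longrightarrow> linear_map A X (\<lambda>a. F a b c)"
    and "\<And>a c. a \<in> carrier A \<Longrightarrow> c \<in> carrier C \<Longrightarrow> linear_map B X (\<lambda>b. F a b c)"
    and "\<And>a b. a \<in> carrier A \<Longrightarrow> b \<in> carrier B \<Longrightarrow> linear_map C X (\<lambda>c. F a b c)"
  shows "trilinear_map A B C X F"
  using assms by (simp add: trilinear_map_def)

lemma linear_map_trilinear:
  assumes "trilinear_map A B C X F"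
  shows "linear_map U A f \<Longrightarrow> b \<in> carrier B \<Longrightarrow> c \<in> carrier C \<Longrightarrow> linear_map U X (\<lambda>x. F (f x) b c)"
    and "linear_map U B g \<Longrightarrow> a \<in> carrier A \<Longrightarrow> c \<in> carrier C \<Longrightarrow> linear_map U X (\<lambda>x. F a (g x) c)"
    and "linear_map U C h \<Longrightarrow> a \<in> carrier A \<Longrightarrow> b \<in> carrier B \<Longrightarrow> linear_map U X (\<lambda>x. F a b (h x))"
    and "a \<in> carrier A \<Longrightarrow> b \<in> carrier B \<Longrightarrow> c \<in> carrier C \<Longrightarrow> F a b c \<in> carrier X"
  using assms by (simp_all add: trilinear_map_def linear_map_def)

lemma linear_map_tens_left:
  "vspace A \<Longrightarrow> vspace B \<Longrightarrow> linear_map U A f \<Longrightarrow> b \<in> carrier B \<Longrightarrow>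
    linear_map U (A \<otimes> B) (\<lambda>x. tens A B (f x) b)"
  and linear_map_tens_right:
  "vspace A \<Longrightarrow> vspace B \<Longrightarrow> linear_map U B g \<Longrightarrow> a \<in> carrier A \<Longrightarrow>
    linear_map U (A \<otimes> B) (\<lambda>x. tens A B a (g x))"
  by (intro linear_map_bilinear_left[OF tens_bilinear] linear_map_bilinear_right[OF tens_bilinear];
      assumption)+

section \<open>Slices of tensors and gradings\<close>

text \<open>\<open>B\<close> is a basis of the carrier with coordinates \<open>l b\<close> defined
  on the ambient space. The expansion is claimed for every finite \<open>F'\<close> between
  \<open>F\<close> and \<open>B\<close>, so that the supports of several vectors can be united into
  one.\<close>

lemma dual_basis:
  fixes W :: "('k::field, 'b::ab_group_add, 'n) vspace_scheme"
  assumes "vspace W"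
  shows "\<exists>B l. B \<subseteq> carrier W \<and> (\<forall>b. Vector_Spaces.linear (scale W) (*) (l b)) \<and>
    (\<forall>w\<in>carrier W. \<exists>F. finite F \<and> F \<subseteq> B \<and>
      (\<forall>F'. finite F' \<longrightarrow> F \<subseteq> F' \<longrightarrow> F' \<subseteq> B \<longrightarrow> w = (\<Sum>b\<in>F'. scale W (l b w) b)))"
proof -
  interpret W: vector_space_pair "scale W" "(*)"
    using assms vector_space_field by (simp add: vector_space_pair_def vspace_def)
  obtain B where B: "B \<subseteq> carrier W" "W.vs1.independent B" "carrier W \<subseteq> W.vs1.span B"
    by (rule W.vs1.maximal_independent_subset)
  have "\<forall>b. \<exists>l. Vector_Spaces.linear (scale W) (*) l \<and> (\<forall>x\<in>B. l x = (if x = b then 1 else 0))"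
    by (rule allI) (rule W.linear_independent_extend[OF B(2)])
  then obtain l where l: "\<And>b. Vector_Spaces.linear (scale W) (*) (l b)"
    "\<And>b x. x \<in> B \<Longrightarrow> l b x = (if x = b then 1 else 0)"
    by metis
  have hom: "module_hom (scale W) (*) (l b)" for b
    using l(1) by (simp add: Vector_Spaces.linear_def)
  have "\<exists>F. finite F \<and> F \<subseteq> B \<and>
      (\<forall>F'. finite F' \<longrightarrow> F \<subseteq> F' \<longrightarrow> F' \<subseteq> B \<longrightarrow> w = (\<Sum>b\<in>F'. scale W (l b w) b))"
    if "w \<in> W.vs1.span B" for w
    using that
  proof (induction rule: W.vs1.span_induct_alt)
    case base
    show ?case by (rule exI[of _ "{}"]) (simp add: module_hom.zero[OF hom])
  next
    case (step c x y)
    then obtain F where F: "finite F" "F \<subseteq> B"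
      "\<And>F'. finite F' \<Longrightarrow> F \<subseteq> F' \<Longrightarrow> F' \<subseteq> B \<Longrightarrow> y = (\<Sum>b\<in>F'. scale W (l b y) b)" by blast
    show ?case
    proof (intro exI[of _ "insert x F"] conjI allI impI)
      show "finite (insert x F)" "insert x F \<subseteq> B" using F step by auto
      fix F' assume F': "finite F'" "insert x F \<subseteq> F'" "F' \<subseteq> B"
      have "(\<Sum>b\<in>F'. scale W (l b (scale W c x + y)) b) =
          (\<Sum>b\<in>F'. scale W (c * (if x = b then 1 else 0)) b) + (\<Sum>b\<in>F'. scale W (l b y) b)"
        using F' l(2)[OF step(1)]
        by (simp add: module_hom.add[OF hom] module_hom.scale[OF hom] W.vs1.scale_left_distrib sum.distrib)
      also have "(\<Sum>b\<in>F'. scale W (c * (if x = b then 1 else 0)) b) =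
          (\<Sum>b\<in>F'. if x = b then scale W c b else 0)"
        by (rule sum.cong) auto
      also have "\<dots> = scale W c x" using F' by simp
      also have "(\<Sum>b\<in>F'. scale W (l b y) b) = y" using F(3)[of F'] F' by auto
      finally show "scale W c x + y = (\<Sum>b\<in>F'. scale W (l b (scale W c x + y)) b)" by simp
    qed
  qed
  from this[OF subsetD[OF B(3)]] show ?thesis
    by (rule_tac exI[of _ B], rule_tac exI[of _ l], intro conjI B(1) allI ballI l(1))
qed

lemma dual_basis_family:
  fixes W :: "('k::field, 'b::ab_group_add, 'n) vspace_scheme"
  assumes "vspace W" "finite I" "\<And>i. i \<in> I \<Longrightarrow> w i \<in> carrier W"
  obtains F l where "finite F" "F \<subseteq> carrier W" "\<And>b. Vector_Spaces.linear (scale W) (*) (l b)"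
    "\<And>i. i \<in> I \<Longrightarrow> w i = (\<Sum>b\<in>F. scale W (l b (w i)) b)"
proof -
  obtain B l where B: "B \<subseteq> carrier W" "\<forall>b. Vector_Spaces.linear (scale W) (*) (l b)"
    and ex: "\<forall>w\<in>carrier W. \<exists>F. finite F \<and> F \<subseteq> B \<and>
      (\<forall>F'. finite F' \<longrightarrow> F \<subseteq> F' \<longrightarrow> F' \<subseteq> B \<longrightarrow> w = (\<Sum>b\<in>F'. scale W (l b w) b))"
    using dual_basis[OF assms(1)] by (elim exE conjE)
  have "\<forall>i\<in>I. \<exists>F. finite F \<and> F \<subseteq> B \<and>
      (\<forall>F'. finite F' \<longrightarrow> F \<subseteq> F' \<longrightarrow> F' \<subseteq> B \<longrightarrow> w i = (\<Sum>b\<in>F'. scale W (l b (w i)) b))"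
    by (intro ballI bspec[OF ex] assms(3))
  from bchoice[OF this] obtain F where F: "\<forall>i\<in>I. finite (F i) \<and> F i \<subseteq> B \<and>
      (\<forall>F'. finite F' \<longrightarrow> F i \<subseteq> F' \<longrightarrow> F' \<subseteq> B \<longrightarrow> w i = (\<Sum>b\<in>F'. scale W (l b (w i)) b))"
    by (elim exE)
  show ?thesis
  proof (rule that[of "\<Union>i\<in>I. F i" l])
    show "w i = (\<Sum>b\<in>\<Union> (F ` I). scale W (l b (w i)) b)" if "i \<in> I" for i
      by (rule F[THEN bspec, OF that, THEN conjunct2, THEN conjunct2, THEN spec, THEN mp, THEN mp, THEN mp])
        (use F that assms(2) in \<open>auto simp: subset_iff\<close>)
    show "finite (\<Union> (F ` I))" "\<Union> (F ` I) \<subseteq> carrier W"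
      using F B(1) assms(2) by (auto simp: subset_iff)
    show "Vector_Spaces.linear (scale W) (*) (l b)" for b
      using B(2) by (rule spec)
  qed
qed

lemma bilinear_map_slice_right:
  assumes "vspace V" "Vector_Spaces.linear (scale W) (*) l"
  shows "bilinear_map V W V (\<lambda>v w. scale V (l w) v)"
proof -
  interpret V: vector_space "scale V" using assms(1) by (simp add: vspace_def)
  have hom: "module_hom (scale W) (*) l" using assms(2) by (simp add: Vector_Spaces.linear_def)
  show ?thesis
    by (auto simp: bilinear_map_def linear_map_def module_hom.add[OF hom] module_hom.scale[OF hom]
        V.scale_left_distrib V.scale_right_distrib mult.commute vspace_scale[OF assms(1)])
qed

lemma bilinear_map_slice_left:
  assumes "vspace W" "Vector_Spaces.linear (scale V) (*) l"
  shows "bilinear_map V W W (\<lambda>v w. scale W (l v) w)"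
proof -
  interpret W: vector_space "scale W" using assms(1) by (simp add: vspace_def)
  have hom: "module_hom (scale V) (*) l" using assms(2) by (simp add: Vector_Spaces.linear_def)
  show ?thesis
    by (auto simp: bilinear_map_def linear_map_def module_hom.add[OF hom] module_hom.scale[OF hom]
        W.scale_left_distrib W.scale_right_distrib mult.commute vspace_scale[OF assms(1)])
qed

text \<open>Expanding the right legs over finitely many basis vectors and moving the coordinates to
  the left gives \<open>t\<close> as a sum of terms k \<otimes> b, where k is the contraction of
  \<open>t\<close> with the coordinate of b and hence lies in \<open>K\<close>.\<close>

lemma tensor_slices_right:
  assumes V: "vspace V" and W: "vspace W" and K: "vspace K" "scale K = scale V"
    and t: "t \<in> carrier (V \<otimes> W)"
    and slice: "\<And>l. Vector_Spaces.linear (scale W) (*) l \<Longrightarrow>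
      sweedler V W t (\<lambda>v w. scale V (l w) v) \<in> carrier K"
  shows "t \<in> carrier (K \<otimes> W)"
proof -
  define xs where "xs = tensor_rep V W t"
  note c = tensor_rep_carrier[OF V W, of _ t, folded xs_def]
  note bil = bilinear_mapD[OF tens_bilinear[OF V W]]
  have "snd (xs ! i) \<in> carrier W" if "i \<in> {..<length xs}" for i
    using c(2) that by simp
  then show ?thesis
  proof (rule dual_basis_family[OF W finite_lessThan])
    fix F l
    assume F: "finite F" "F \<subseteq> carrier W" "\<And>b. Vector_Spaces.linear (scale W) (*) (l b)"
      and eq: "\<And>i. i \<in> {..<length xs} \<Longrightarrow> snd (xs ! i) = (\<Sum>b\<in>F. scale W (l b (snd (xs ! i))) b)"
    have "t = (\<Sum>i<length xs. tens V W (fst (xs ! i)) (snd (xs ! i)))"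
      unfolding xs_def by (rule tensor_rep(2)[OF V W t, symmetric])
    also have "\<dots> = (\<Sum>i<length xs. \<Sum>b\<in>F. tens V W (scale V (l b (snd (xs ! i))) (fst (xs ! i))) b)"
    proof (rule sum.cong[OF refl])
      fix i assume i': "i \<in> {..<length xs}"
      then have i: "i < length xs" by simp
      have "tens V W (fst (xs ! i)) (snd (xs ! i)) =
          (\<Sum>b\<in>F. tens V W (fst (xs ! i)) (scale W (l b (snd (xs ! i))) b))"
        using F(2) by (subst eq[OF i'], subst linear_map_sum[OF W bil(1)[OF c(1)[OF i]]])
          (auto intro: vspace_scale[OF W])
      also have "\<dots> = (\<Sum>b\<in>F. tens V W (scale V (l b (snd (xs ! i))) (fst (xs ! i))) b)"
        using F(2) c[OF i]
        by (intro sum.cong) (auto simp: linear_map_scale[OF bil(1)] linear_map_scale[OF bil(2)])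
      finally show "tens V W (fst (xs ! i)) (snd (xs ! i)) = \<dots>" .
    qed
    also have "\<dots> = (\<Sum>b\<in>F. \<Sum>i<length xs. tens V W (scale V (l b (snd (xs ! i))) (fst (xs ! i))) b)"
      by (rule sum.swap)
    also have "\<dots> = (\<Sum>b\<in>F. tens V W (sweedler V W t (\<lambda>v w. scale V (l b w) v)) b)"
      unfolding sweedler_def xs_def[symmetric] using F(2) c
      by (intro sum.cong refl, subst linear_map_sum[OF V bil(2)]) (auto intro: vspace_scale[OF V])
    also have "\<dots> = (\<Sum>b\<in>F. tens K W (sweedler V W t (\<lambda>v w. scale V (l b w) v)) b)"
      using tens_cong[OF K(2), of W W] by simp
    also have "\<dots> \<in> carrier (K \<otimes> W)"
      using F slice by (intro vspace_sum[OF vspace_tensor] tens_in_carrier) auto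
    finally show ?thesis .
  qed
qed

text \<open>The mirror image: left legs are expanded and the coordinates move right. It yields that
  the kernel of \<open>\<psi>\<close> is a subcomodule.\<close>

lemma tensor_slices_left:
  assumes V: "vspace V" and W: "vspace W" and K: "vspace K" "scale K = scale W"
    and t: "t \<in> carrier (V \<otimes> W)"
    and slice: "\<And>l. Vector_Spaces.linear (scale V) (*) l \<Longrightarrow>
      sweedler V W t (\<lambda>v w. scale W (l v) w) \<in> carrier K"
  shows "t \<in> carrier (V \<otimes> K)"
proof -
  define xs where "xs = tensor_rep V W t"
  note c = tensor_rep_carrier[OF V W, of _ t, folded xs_def]
  note bil = bilinear_mapD[OF tens_bilinear[OF V W]]
  have "fst (xs ! i) \<in> carrier V" if "i \<in> {..<length xs}" for i
    using c(1) that by simp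
  then show ?thesis
  proof (rule dual_basis_family[OF V finite_lessThan])
    fix F l
    assume F: "finite F" "F \<subseteq> carrier V" "\<And>b. Vector_Spaces.linear (scale V) (*) (l b)"
      and eq: "\<And>i. i \<in> {..<length xs} \<Longrightarrow> fst (xs ! i) = (\<Sum>b\<in>F. scale V (l b (fst (xs ! i))) b)"
    have "t = (\<Sum>i<length xs. tens V W (fst (xs ! i)) (snd (xs ! i)))"
      unfolding xs_def by (rule tensor_rep(2)[OF V W t, symmetric])
    also have "\<dots> = (\<Sum>i<length xs. \<Sum>b\<in>F. tens V W b (scale W (l b (fst (xs ! i))) (snd (xs ! i))))"
    proof (rule sum.cong[OF refl])
      fix i assume i': "i \<in> {..<length xs}"
      then have i: "i < length xs" by simp
      have "tens V W (fst (xs ! i)) (snd (xs ! i)) =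
          (\<Sum>b\<in>F. tens V W (scale V (l b (fst (xs ! i))) b) (snd (xs ! i)))"
        using F(2) by (subst eq[OF i'], subst linear_map_sum[OF V bil(2)[OF c(2)[OF i]]])
          (auto intro: vspace_scale[OF V])
      also have "\<dots> = (\<Sum>b\<in>F. tens V W b (scale W (l b (fst (xs ! i))) (snd (xs ! i))))"
        using F(2) c[OF i]
        by (intro sum.cong) (auto simp: linear_map_scale[OF bil(1)] linear_map_scale[OF bil(2)])
      finally show "tens V W (fst (xs ! i)) (snd (xs ! i)) = \<dots>" .
    qed
    also have "\<dots> = (\<Sum>b\<in>F. \<Sum>i<length xs. tens V W b (scale W (l b (fst (xs ! i))) (snd (xs ! i))))"
      by (rule sum.swap)
    also have "\<dots> = (\<Sum>b\<in>F. tens V W b (sweedler V W t (\<lambda>v w. scale W (l b v) w)))"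
      unfolding sweedler_def xs_def[symmetric] using F(2) c
      by (intro sum.cong refl, subst linear_map_sum[OF W bil(1)]) (auto intro: vspace_scale[OF W])
    also have "\<dots> = (\<Sum>b\<in>F. tens V K b (sweedler V W t (\<lambda>v w. scale W (l b v) w)))"
      using tens_cong[OF _ K(2), of V V] by simp
    also have "\<dots> \<in> carrier (V \<otimes> K)"
      using F slice by (intro vspace_sum[OF vspace_tensor] tens_in_carrier) auto
    finally show ?thesis .
  qed
qed

section \<open>Homogeneous components of a graded space\<close>

lemma is_decomp_component:
  assumes "grading V G" "x \<in> carrier V"
  shows "is_decomp G x (\<lambda>n. component G n x)"
proof -
  have "\<exists>!f. is_decomp G x f" using assms unfolding grading_def by simp
  from theI'[OF this] show ?thesis unfolding component_def .
qed

text \<open>Any finite set containing the support may be used: in a sum of two decompositions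
  components can cancel, so the exact support is not at hand.\<close>

lemma is_decompI:
  fixes f :: "nat \<Rightarrow> 'a::ab_group_add"
  assumes "\<And>n. f n \<in> G n" "finite F" "\<And>n. n \<notin> F \<Longrightarrow> f n = 0" "x = sum f F"
  shows "is_decomp G x f"
proof -
  have "{n. f n \<noteq> 0} \<subseteq> F" using assms(3) by auto
  moreover have "sum f F = sum f {n. f n \<noteq> 0}"
    using assms(2,3) by (intro sum.mono_neutral_right) auto
  ultimately show ?thesis
    using assms unfolding is_decomp_def by (auto intro: finite_subset)
qed

lemma component_unique:
  assumes "grading V G" "x \<in> carrier V" "is_decomp G x f"
  shows "component G n x = f n"
proof -
  have "(THE f. is_decomp G x f) = f"
    using assms unfolding grading_def by (intro the1_equality) auto
  then show ?thesis by (simp add: component_def)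
qed

lemma grading_vspace:
  assumes "vspace V" "grading V G"
  shows "vspace (V\<lparr>carrier := G n\<rparr>)"
  using assms by (simp add: vspace_def grading_def)

lemma grading_subset: "grading V G \<Longrightarrow> G n \<subseteq> carrier V"
  by (simp add: grading_def)

lemma component_in: "grading V G \<Longrightarrow> x \<in> carrier V \<Longrightarrow> component G n x \<in> G n"
  by (drule (1) is_decomp_component) (simp add: is_decomp_def)

lemma component_homogeneous:
  assumes "vspace V" "grading V G" "x \<in> G m"
  shows "component G n x = (if n = m then x else 0)"
proof (rule component_unique[OF assms(2)])
  show "x \<in> carrier V" using assms grading_subset by blast
  show "is_decomp G x (\<lambda>n. if n = m then x else 0)"
    using assms vspace_zero[OF grading_vspace[OF assms(1,2)]]
    by (intro is_decompI[of _ _ "{m}"]) auto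
qed

text \<open>Componentwise sums and multiples of decompositions are again decompositions, so
  uniqueness of the decomposition forces linearity.\<close>

lemma linear_map_component:
  assumes V: "vspace V" and G: "grading V G"
  shows "linear_map V V (component G n)"
proof -
  interpret V: vector_space "scale V" using V by (simp add: vspace_def)
  note D = is_decomp_component[OF G, unfolded is_decomp_def]
  have *: "V.subspace (G n)" for n using G by (simp add: grading_def)
  show ?thesis unfolding linear_map_def
  proof (intro conjI ballI allI)
    fix x assume x: "x \<in> carrier V"
    show "component G n x \<in> carrier V" using component_in[OF G x] grading_subset[OF G] by blast
    show "component G n (scale V c x) = scale V c (component G n x)" for c
    proof (rule component_unique[OF G vspace_scale[OF V x]], rule is_decompI)
      show "finite {n. component G n x \<noteq> 0}" using D[OF x] by blast
      show "scale V c x = (\<Sum>n\<in>{n. component G n x \<noteq> 0}. scale V c (component G n x))"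
        using D[OF x] by (simp add: V.scale_sum_right[symmetric])
    qed (auto intro: V.subspace_scale[OF *] component_in[OF G x])
    fix y assume y: "y \<in> carrier V"
    show "component G n (x + y) = component G n x + component G n y"
    proof (rule component_unique[OF G vspace_add[OF V x y]], rule is_decompI)
      let ?F = "{n. component G n x \<noteq> 0} \<union> {n. component G n y \<noteq> 0}"
      show fin: "finite ?F" using D[OF x] D[OF y] by blast
      have "(\<Sum>n\<in>?F. component G n x) = x"
        using D[OF x] fin by (subst sum.mono_neutral_right[of ?F "{n. component G n x \<noteq> 0}"]) auto
      moreover have "(\<Sum>n\<in>?F. component G n y) = y"
        using D[OF y] fin by (subst sum.mono_neutral_right[of ?F "{n. component G n y \<noteq> 0}"]) auto
      ultimately show "x + y = (\<Sum>n\<in>?F. component G n x + component G n y)"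
        by (simp add: sum.distrib)
    qed (auto intro: V.subspace_add[OF *] component_in[OF G x] component_in[OF G y])
  qed
qed

lemma linear_map_eq_on_homogeneous:
  assumes V: "vspace V" and G: "grading V G" and f: "linear_map V W f" and g: "linear_map V W g"
    and "\<And>n x. x \<in> G n \<Longrightarrow> f x = g x" and x: "x \<in> carrier V"
  shows "f x = g x"
proof -
  have D: "x = (\<Sum>n | component G n x \<noteq> 0. component G n x)"
    using is_decomp_component[OF G x, unfolded is_decomp_def] by blast
  have c: "component G n x \<in> carrier V" for n
    using component_in[OF G x] grading_subset[OF G] by blast
  have "f x = (\<Sum>n | component G n x \<noteq> 0. f (component G n x))"
    by (subst D, rule linear_map_sum[OF V f c])
  also have "\<dots> = (\<Sum>n | component G n x \<noteq> 0. g (component G n x))"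
    using assms(5) component_in[OF G x] by (intro sum.cong) auto
  also have "\<dots> = g x"
    by (subst (2) D, rule linear_map_sum[OF V g c, symmetric])
  finally show ?thesis .
qed

text \<open>The coaction of a homogeneous element lies in a span of simple tensors whose degrees add
  up to \<open>n\<close>, but the representation picked by \<open>sweedler\<close> need not consist
  of such tensors. Linearity in the tensor bridges this gap.\<close>

lemma linear_map_eq_on_tensor_grading:
  fixes V :: "('k::field, 'a::ab_group_add, 'm) vspace_scheme"
    and W :: "('k, 'b::ab_group_add, 'n) vspace_scheme"
  assumes V: "vspace V" "grading V G" and W: "vspace W" "grading W G'"
    and f: "linear_map (V \<otimes> W) X f" and g: "linear_map (V \<otimes> W) X g"
    and eq: "\<And>i j v w. v \<in> G i \<Longrightarrow> w \<in> G' j \<Longrightarrow> i + j = n \<Longrightarrow> f (tens V W v w) = g (tens V W v w)"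
    and t: "t \<in> tensor_grading V G W G' n"
  shows "f t = g t"
proof -
  interpret T: vector_space "tscale :: 'k \<Rightarrow> ('k, 'a, 'b) tensor \<Rightarrow> _"
    by (rule vector_space_tscale)
  let ?S = "{tens V W v w | v w i j. v \<in> G i \<and> w \<in> G' j \<and> i + j = n}"
  have "t \<in> T.span ?S"
    using t by (simp add: tensor_grading_def)
  then have "t \<in> carrier (V \<otimes> W) \<and> f t = g t"
  proof (induction rule: T.span_induct_alt)
    case base
    show ?case
      unfolding linear_map_zero[OF vspace_tensor f] linear_map_zero[OF vspace_tensor g]
      by (intro conjI vspace_zero[OF vspace_tensor] refl)
  next
    case (step c x y)
    from step(1) obtain v w i j where x: "x = tens V W v w" "v \<in> G i" "w \<in> G' j" "i + j = n"
      unfolding mem_Collect_eq by (elim exE conjE)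
    have xc: "x \<in> carrier (V \<otimes> W)"
      unfolding x(1) using x(2,3) grading_subset[OF V(2)] grading_subset[OF W(2)]
      by (intro tens_in_carrier) blast+
    have cx: "tscale c x \<in> carrier (V \<otimes> W)"
      using vspace_scale[OF vspace_tensor xc, of c] by (simp only: scale_tensor)
    have yc: "y \<in> carrier (V \<otimes> W)" and fy: "f y = g y" using step(2) by blast+
    have "f x = g x" unfolding x(1) by (rule eq[OF x(2-4)])
    then have "f (tscale c x) = g (tscale c x)"
      using linear_map_scale[OF f xc, of c] linear_map_scale[OF g xc, of c] by (simp only: scale_tensor)
    then have "f (tscale c x + y) = g (tscale c x + y)"
      by (simp only: linear_map_add[OF f cx yc] linear_map_add[OF g cx yc] fy)
    with vspace_add[OF vspace_tensor cx yc] show ?case by blast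
  qed
  then show ?thesis ..
qed

lemma tensor_grading_0:
  "tensor_grading V G W G' 0 = carrier (V\<lparr>carrier := G 0\<rparr> \<otimes> W\<lparr>carrier := G' 0\<rparr>)"
  using tens_cong[of "V\<lparr>carrier := G 0\<rparr>" V "W\<lparr>carrier := G' 0\<rparr>" W]
  by (simp add: tensor_grading_def carrier_tensor)

text \<open>Both sides are linear in \<open>x\<close>, and right multiplication of a homogeneous
  \<open>x\<close> by \<open>a\<close> keeps its degree. This makes the untwisting compatible with
  the grading.\<close>

lemma component_mult_zero:
  assumes A: "graded_algebra A G" and x: "x \<in> carrier A" and a: "a \<in> G 0"
  shows "component G n (mult A x a) = mult A (component G n x) a"
proof -
  from A have v: "vspace A" and g: "grading A G" and b: "bilinear_map A A A (mult A)"
    and m: "\<And>i j x y. x \<in> G i \<Longrightarrow> y \<in> G j \<Longrightarrow> mult A x y \<in> G (i + j)"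
    by (simp_all add: graded_algebra_def algebra_def)
  have a': "a \<in> carrier A" using a grading_subset[OF g] by blast
  note c = linear_map_component[OF v g]
  note l = linear_map_bilinear_left[OF b _ a']
  show ?thesis
  proof (rule linear_map_eq_on_homogeneous[OF v g linear_map_compose[OF refl c l] l _ x])
    show "linear_map A A (\<lambda>x. x)" by (rule linear_map_id)
    show "linear_map A A (component G n)" by (rule c)
    show "component G n (mult A x a) = mult A (component G n x) a" if "x \<in> G i" for i x
      using component_homogeneous[OF v g m[OF that a]] component_homogeneous[OF v g that]
        linear_map_zero[OF v bilinear_map_left[OF b a']] by simp
  qed
qed

text \<open>A product of homogeneous elements has degree zero only if both factors do, since i + j =
  0 forces i = j = 0 in the natural numbers. By linearity in each factor this suffices.\<close>

lemma component_zero_mult: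
  assumes A: "graded_algebra A G" and x: "x \<in> carrier A" and y: "y \<in> carrier A"
  shows "component G 0 (mult A x y) = mult A (component G 0 x) (component G 0 y)"
proof -
  from A have v: "vspace A" and g: "grading A G" and b: "bilinear_map A A A (mult A)"
    and m: "\<And>i j x y. x \<in> G i \<Longrightarrow> y \<in> G j \<Longrightarrow> mult A x y \<in> G (i + j)"
    by (simp_all add: graded_algebra_def algebra_def)
  note c = linear_map_component[OF v g]
  note ch = component_homogeneous[OF v g]
  note cc = linear_map_carrier[OF c]
  have G: "\<And>i x. x \<in> G i \<Longrightarrow> x \<in> carrier A" using grading_subset[OF g] by blast
  have z: "x \<in> carrier A \<Longrightarrow> mult A x 0 = 0" "x \<in> carrier A \<Longrightarrow> mult A 0 x = 0" for x
    using linear_map_zero[OF v bilinear_map_left[OF b]] linear_map_zero[OF v bilinear_map_right[OF b]]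
    by auto
  show ?thesis
  proof (rule linear_map_eq_on_homogeneous[OF v g _ _ _ x])
    show "linear_map A A (\<lambda>x. component G 0 (mult A x y))"
      by (intro linear_map_compose[OF refl c] linear_map_bilinear_left[OF b] linear_map_id y)
    show "linear_map A A (\<lambda>x. mult A (component G 0 x) (component G 0 y))"
      by (intro linear_map_bilinear_left[OF b] c cc y)
    fix i x assume x: "x \<in> G i"
    show "component G 0 (mult A x y) = mult A (component G 0 x) (component G 0 y)"
    proof (rule linear_map_eq_on_homogeneous[OF v g _ _ _ y])
      show "linear_map A A (\<lambda>y. component G 0 (mult A x y))"
        by (intro linear_map_compose[OF refl c] linear_map_bilinear_right[OF b] linear_map_id G[OF x])
      show "linear_map A A (\<lambda>y. mult A (component G 0 x) (component G 0 y))"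
        by (intro linear_map_bilinear_right[OF b] c cc G[OF x])
      show "component G 0 (mult A x y) = mult A (component G 0 x) (component G 0 y)"
        if y: "y \<in> G j" for j y
        using ch[OF m[OF x y]] ch[OF x] ch[OF y] z[OF G[OF x]] z[OF G[OF y]] z[OF vspace_zero[OF v]]
        by simp
    qed
  qed
qed

section \<open>Sweedler calculus in a comodule algebra\<close>

locale graded_comodule_setting =
  fixes H :: "('k::field, 'h::ab_group_add) hopf_algebra"
    and HG :: "nat \<Rightarrow> 'h set"
    and L :: "('k, 'h, 'l::ab_group_add) comodule_algebra"
    and LG :: "nat \<Rightarrow> 'l set"
  assumes graded_hopf: "graded_hopf_algebra H HG"
    and graded_comodule: "graded_comodule_algebra H HG L LG"
begin

abbreviation mH (infixl \<open>\<cdot>\<close> 70) where "x \<cdot> y \<equiv> mult H x y"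
abbreviation mL (infixl \<open>\<star>\<close> 70) where "x \<star> y \<equiv> mult L x y"
abbreviation "\<rho> \<equiv> coact L"
abbreviation "\<Delta> \<equiv> comul H"
abbreviation "\<S> \<equiv> antipode H"
abbreviation "\<epsilon> \<equiv> counit H"
abbreviation "\<Sigma>L \<equiv> sweedler H L"
abbreviation "\<Sigma>H \<equiv> sweedler H H"

lemma hopf: "algebra H" "coalgebra H" "algebra_hom H (tensor_algebra H H) \<Delta>"
    "algebra_hom H ground_algebra \<epsilon>" "linear_map H H \<S>"
    "\<And>x. x \<in> carrier H \<Longrightarrow> tlift H H H (\<lambda>a b. \<S> a \<cdot> b) (\<Delta> x) = scale H (\<epsilon> x) (unit H)"
    "\<And>x. x \<in> carrier H \<Longrightarrow> tlift H H H (\<lambda>a b. a \<cdot> \<S> b) (\<Delta> x) = scale H (\<epsilon> x) (unit H)"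
    "graded_algebra H HG"
  and comodule: "algebra L" "algebra_hom L (tensor_algebra H L) \<rho>"
    "graded_algebra L LG"
    "\<And>n x. x \<in> LG n \<Longrightarrow> \<rho> x \<in> tensor_grading H HG L LG n"
  using graded_hopf graded_comodule
  by (simp_all add: graded_hopf_algebra_def hopf_algebra_def graded_comodule_algebra_def
      comodule_algebra_def)

lemma vH: "vspace H" and vL: "vspace L"
  and grH: "grading H HG" and grL: "grading L LG"
  using hopf(1,8) comodule(1,3) by (simp_all add: algebra_def graded_algebra_def)

lemma unit_carrier: "unit H \<in> carrier H" "unit L \<in> carrier L"
  using hopf(1) comodule(1) by (simp_all add: algebra_def)

lemma mult_bilinear: "bilinear_map H H H (mult H)" "bilinear_map L L L (mult L)"
  using hopf(1) comodule(1) by (simp_all add: algebra_def)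

lemma mult_assoc:
  "x \<in> carrier H \<Longrightarrow> y \<in> carrier H \<Longrightarrow> z \<in> carrier H \<Longrightarrow> x \<cdot> y \<cdot> z = x \<cdot> (y \<cdot> z)"
  using hopf(1) by (simp add: algebra_def)

lemma mult_unit:
  "x \<in> carrier H \<Longrightarrow> unit H \<cdot> x = x" "x \<in> carrier H \<Longrightarrow> x \<cdot> unit H = x"
  "y \<in> carrier L \<Longrightarrow> unit L \<star> y = y" "y \<in> carrier L \<Longrightarrow> y \<star> unit L = y"
  using hopf(1) comodule(1) by (simp_all add: algebra_def)

lemma rho_linear: "linear_map L (H \<otimes> L) \<rho>"
  and Delta_linear: "linear_map H (H \<otimes> H) \<Delta>"
  and counit_linear: "linear_map H ground_algebra \<epsilon>"
  using comodule(2) hopf(3,4) by (simp_all add: algebra_hom_def linear_map_def tensor_algebra_def)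

lemma counit_scale_linear: "bilinear_map H L L (\<lambda>h l. scale L (\<epsilon> h) l)"
proof -
  interpret L: vector_space "scale L" using vL by (simp add: vspace_def)
  show ?thesis
    using counit_linear by (auto simp: bilinear_map_def linear_map_def ground_algebra_def
        L.scale_left_distrib L.scale_right_distrib mult.commute vspace_scale[OF vL])
qed

text \<open>Every summand below is a composite of structure maps, so its linearity in each variable,
  and likewise membership in carriers, can be read off from the shape of the term.\<close>

lemmas linear_rules =
  linear_map_id
  linear_map_bilinear_left[OF mult_bilinear(1)] linear_map_bilinear_right[OF mult_bilinear(1)]
  linear_map_bilinear_left[OF mult_bilinear(2)] linear_map_bilinear_right[OF mult_bilinear(2)]
  linear_map_compose[OF refl rho_linear] linear_map_compose[OF refl Delta_linear]
  linear_map_compose[OF refl hopf(5)]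
  linear_map_compose[OF refl linear_map_component[OF vH grH]]
  linear_map_compose[OF refl linear_map_component[OF vL grL]]
  linear_map_tens_left linear_map_tens_right
  linear_map_sweedler_arg linear_map_sweedler_body
  vH vL vspace_tensor

lemmas carrier_rules =
  bilinear_map_carrier[OF mult_bilinear(1)] bilinear_map_carrier[OF mult_bilinear(2)]
  linear_map_carrier[OF rho_linear] linear_map_carrier[OF Delta_linear]
  linear_map_carrier[OF hopf(5)]
  linear_map_carrier[OF linear_map_component[OF vH grH]]
  linear_map_carrier[OF linear_map_component[OF vL grL]]
  tens_in_carrier sweedler_carrier unit_carrier
  vspace_scale[OF vH] vspace_scale[OF vL]

lemmas lin = bilinear_mapI trilinear_mapI linear_rules carrier_rules

lemma rho_coassoc:
  assumes X: "vspace X" and F: "trilinear_map H H L X F" and x: "x \<in> carrier L"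
  shows "\<Sigma>L (\<rho> x) (\<lambda>h l. \<Sigma>H (\<Delta> h) (\<lambda>h1 h2. F h1 h2 l)) =
    \<Sigma>L (\<rho> x) (\<lambda>h l. \<Sigma>L (\<rho> l) (\<lambda>a b. F h a b))"
proof -
  let ?T = "H \<otimes> H \<otimes> L"
  \<comment> \<open>\<open>?K\<close> is the linear map on \<open>H \<otimes> H \<otimes> L\<close>
    induced by \<open>F\<close>. Applied to the coassociativity axiom, an equation between two
    tensors, it produces the two double sums.\<close>
  let ?K = "\<lambda>t. sweedler H (H \<otimes> L) t (\<lambda>h u. \<Sigma>L u (\<lambda>a b. F h a b))"
  note F' = linear_map_trilinear[OF F]
  have K: "linear_map ?T X ?K"
    by (intro lin X F')
  have K1: "?K (tens H (H \<otimes> L) a (tens H L b c)) = F a b c"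
    if "a \<in> carrier H" "b \<in> carrier H" "c \<in> carrier L" for a b c
  proof -
    have "?K (tens H (H \<otimes> L) a (tens H L b c)) = \<Sigma>L (tens H L b c) (\<lambda>b c. F a b c)"
      by (rule sweedler_tens[OF vH vspace_tensor X]; (intro lin X F' that)?)
    also have "\<dots> = F a b c"
      by (rule sweedler_tens[OF vH vL X]; (intro lin X F' that)?)
    finally show ?thesis .
  qed
  have K2: "?K (tens H (H \<otimes> L) a u) = \<Sigma>L u (\<lambda>b c. F a b c)"
    if "a \<in> carrier H" "u \<in> carrier (H \<otimes> L)" for a u
    by (rule sweedler_tens[OF vH vspace_tensor X]; (intro lin X F' that)?)
  have "tlift H L ?T (\<lambda>h l. tlift H H ?T (\<lambda>h1 h2. tens H (H \<otimes> L) h1 (tens H L h2 l)) (\<Delta> h)) (\<rho> x)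
      = \<Sigma>L (\<rho> x) (\<lambda>h l. \<Sigma>H (\<Delta> h) (\<lambda>h1 h2. tens H (H \<otimes> L) h1 (tens H L h2 l)))"
    by (rule tlift_sweedler_cong[OF vH vL vspace_tensor]; (rule tlift_sweedler)?; (intro lin x)?)
  moreover have "tlift H L ?T (\<lambda>h l. tens H (H \<otimes> L) h (\<rho> l)) (\<rho> x) =
      \<Sigma>L (\<rho> x) (\<lambda>h l. tens H (H \<otimes> L) h (\<rho> l))"
    by (rule tlift_sweedler; (intro lin x)?)
  ultimately have "\<Sigma>L (\<rho> x) (\<lambda>h l. \<Sigma>H (\<Delta> h) (\<lambda>h1 h2. tens H (H \<otimes> L) h1 (tens H L h2 l))) =
      \<Sigma>L (\<rho> x) (\<lambda>h l. tens H (H \<otimes> L) h (\<rho> l))"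
    using graded_comodule x by (simp add: graded_comodule_algebra_def comodule_algebra_def)
  then have "?K (\<Sigma>L (\<rho> x) (\<lambda>h l. \<Sigma>H (\<Delta> h) (\<lambda>h1 h2. tens H (H \<otimes> L) h1 (tens H L h2 l)))) =
      ?K (\<Sigma>L (\<rho> x) (\<lambda>h l. tens H (H \<otimes> L) h (\<rho> l)))"
    by (rule arg_cong)
  also have "?K (\<Sigma>L (\<rho> x) (\<lambda>h l. tens H (H \<otimes> L) h (\<rho> l))) =
      \<Sigma>L (\<rho> x) (\<lambda>h l. ?K (tens H (H \<otimes> L) h (\<rho> l)))"
    by (rule linear_map_sweedler[OF vH vL vspace_tensor K]) (intro lin)
  also have "\<dots> = \<Sigma>L (\<rho> x) (\<lambda>h l. \<Sigma>L (\<rho> l) (\<lambda>a b. F h a b))"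
    by (rule sweedler_cong[OF vH vL refl]) (intro K2 lin)
  also have "?K (\<Sigma>L (\<rho> x) (\<lambda>h l. \<Sigma>H (\<Delta> h) (\<lambda>h1 h2. tens H (H \<otimes> L) h1 (tens H L h2 l)))) =
      \<Sigma>L (\<rho> x) (\<lambda>h l. ?K (\<Sigma>H (\<Delta> h) (\<lambda>h1 h2. tens H (H \<otimes> L) h1 (tens H L h2 l))))"
    by (rule linear_map_sweedler[OF vH vL vspace_tensor K]) (intro lin)
  also have "\<dots> = \<Sigma>L (\<rho> x) (\<lambda>h l. \<Sigma>H (\<Delta> h) (\<lambda>h1 h2. ?K (tens H (H \<otimes> L) h1 (tens H L h2 l))))"
    by (intro sweedler_cong[OF vH vL refl] linear_map_sweedler[OF vH vH vspace_tensor K]) (intro lin)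
  also have "\<dots> = \<Sigma>L (\<rho> x) (\<lambda>h l. \<Sigma>H (\<Delta> h) (\<lambda>h1 h2. F h1 h2 l))"
    by (intro sweedler_cong[OF vH vL refl] sweedler_cong[OF vH vH refl] K1)
  finally show ?thesis .
qed

lemma rho_counit: "x \<in> carrier L \<Longrightarrow> \<Sigma>L (\<rho> x) (\<lambda>h l. scale L (\<epsilon> h) l) = x"
  using graded_comodule tlift_sweedler[OF vH vL vL counit_scale_linear linear_map_carrier[OF rho_linear]]
  by (simp add: graded_comodule_algebra_def comodule_algebra_def)

lemma antipode_sweedler:
  assumes "x \<in> carrier H"
  shows "\<Sigma>H (\<Delta> x) (\<lambda>a b. \<S> a \<cdot> b) = scale H (\<epsilon> x) (unit H)"
    and "\<Sigma>H (\<Delta> x) (\<lambda>a b. a \<cdot> \<S> b) = scale H (\<epsilon> x) (unit H)"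
proof -
  have "tlift H H H (\<lambda>a b. \<S> a \<cdot> b) (\<Delta> x) = \<Sigma>H (\<Delta> x) (\<lambda>a b. \<S> a \<cdot> b)"
    by (rule tlift_sweedler; (intro lin assms)?)
  then show "\<Sigma>H (\<Delta> x) (\<lambda>a b. \<S> a \<cdot> b) = scale H (\<epsilon> x) (unit H)"
    using hopf(6)[OF assms] by simp
  have "tlift H H H (\<lambda>a b. a \<cdot> \<S> b) (\<Delta> x) = \<Sigma>H (\<Delta> x) (\<lambda>a b. a \<cdot> \<S> b)"
    by (rule tlift_sweedler; (intro lin assms)?)
  then show "\<Sigma>H (\<Delta> x) (\<lambda>a b. a \<cdot> \<S> b) = scale H (\<epsilon> x) (unit H)"
    using hopf(7)[OF assms] by simp
qed

text \<open>By coassociativity the adjacent legs a and c become the two legs of one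
  comultiplication, where \<open>m\<close> collapses to the counit. Taking \<open>m\<close> to be
  \<open>\<S> a \<cdot> b\<close> or \<open>a \<cdot> \<S> b\<close> gives both antipode
  cancellations.\<close>

lemma rho_cancel:
  assumes X: "vspace X" and F: "bilinear_map H L X F" and m: "bilinear_map H H H m"
    and eq: "\<And>x. x \<in> carrier H \<Longrightarrow> \<Sigma>H (\<Delta> x) m = scale H (\<epsilon> x) (unit H)"
    and l: "l \<in> carrier L"
  shows "\<Sigma>L (\<rho> l) (\<lambda>a b. \<Sigma>L (\<rho> b) (\<lambda>c d. F (m a c) d)) = F (unit H) l"
proof -
  note lin' = linear_map_bilinear_left[OF F] linear_map_bilinear_right[OF F]
    linear_map_bilinear_left[OF m] linear_map_bilinear_right[OF m] bilinear_map_carrier[OF F]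
    bilinear_map_carrier[OF m] X lin
  have "\<Sigma>L (\<rho> l) (\<lambda>a b. \<Sigma>L (\<rho> b) (\<lambda>c d. F (m a c) d)) =
      \<Sigma>L (\<rho> l) (\<lambda>a b. \<Sigma>H (\<Delta> a) (\<lambda>a1 a2. F (m a1 a2) b))"
    by (rule rho_coassoc[OF X _ l, symmetric]; (intro lin')?)
  also have "\<dots> = \<Sigma>L (\<rho> l) (\<lambda>a b. F (\<Sigma>H (\<Delta> a) m) b)"
    by (rule sweedler_cong[OF vH vL refl],
        rule linear_map_sweedler[OF vH vH vH bilinear_map_left[OF F], symmetric]; (intro lin')?)
  \<comment> \<open>The scalar \<open>\<epsilon> a\<close> moves from the first leg to the second,
    where the counit law of the coaction absorbs it.\<close>
  also have "\<dots> = \<Sigma>L (\<rho> l) (\<lambda>a b. F (unit H) (scale L (\<epsilon> a) b))"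
    by (rule sweedler_cong[OF vH vL refl])
      (simp add: eq linear_map_scale[OF bilinear_map_left[OF F]] linear_map_scale[OF bilinear_map_right[OF F]]
        unit_carrier)
  also have "\<dots> = F (unit H) (\<Sigma>L (\<rho> l) (\<lambda>a b. scale L (\<epsilon> a) b))"
    by (rule linear_map_sweedler[OF vH vL vL bilinear_map_right[OF F], symmetric]; (intro lin')?)
  finally show ?thesis using rho_counit[OF l] by simp
qed

lemma antipode_bilinear: "bilinear_map H H H (\<lambda>a b. \<S> a \<cdot> b)" "bilinear_map H H H (\<lambda>a b. a \<cdot> \<S> b)"
  by (intro lin; assumption)+

lemmas rho_cancel_left = rho_cancel[OF _ _ antipode_bilinear(1) antipode_sweedler(1)]
lemmas rho_cancel_right = rho_cancel[OF _ _ antipode_bilinear(2) antipode_sweedler(2)]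

lemma tensor_algebra_mult:
  assumes "t \<in> carrier (H \<otimes> L)" "u \<in> carrier (H \<otimes> L)"
  shows "mult (tensor_algebra H L) t u =
    \<Sigma>L t (\<lambda>a b. \<Sigma>L u (\<lambda>c d. tens H L (a \<cdot> c) (b \<star> d)))"
proof -
  have "mult (tensor_algebra H L) t u = tlift H L (H \<otimes> L) (\<lambda>a b. tlift H L (H \<otimes> L)
       (\<lambda>a' b'. tens H L (a \<cdot> a') (b \<star> b')) u) t"
    by (simp add: tensor_algebra_def)
  also have "\<dots> = \<Sigma>L t (\<lambda>a b. \<Sigma>L u (\<lambda>c d. tens H L (a \<cdot> c) (b \<star> d)))"
    by (rule tlift_sweedler_cong[OF vH vL vspace_tensor]; (rule tlift_sweedler)?; (intro lin assms)?)
  finally show ?thesis .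
qed

lemma rho_mult:
  assumes X: "vspace X" and F: "bilinear_map H L X F" and x: "x \<in> carrier L" and y: "y \<in> carrier L"
  shows "\<Sigma>L (\<rho> (x \<star> y)) F = \<Sigma>L (\<rho> x) (\<lambda>a b. \<Sigma>L (\<rho> y) (\<lambda>c d. F (a \<cdot> c) (b \<star> d)))"
proof -
  have eq: "\<rho> (x \<star> y) = \<Sigma>L (\<rho> x) (\<lambda>a b. \<Sigma>L (\<rho> y) (\<lambda>c d. tens H L (a \<cdot> c) (b \<star> d)))"
    using comodule(2) x y
    by (simp add: algebra_hom_def tensor_algebra_mult linear_map_carrier[OF rho_linear])
  have "\<Sigma>L (\<rho> (x \<star> y)) F = \<Sigma>L (\<rho> x) (\<lambda>a b. \<Sigma>L (\<Sigma>L (\<rho> y) (\<lambda>c d. tens H L (a \<cdot> c) (b \<star> d))) F)"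
    unfolding eq by (rule sweedler_sweedler[OF vH vL vH vL X F]; (intro lin)?)
  also have "\<dots> = \<Sigma>L (\<rho> x) (\<lambda>a b. \<Sigma>L (\<rho> y) (\<lambda>c d. \<Sigma>L (tens H L (a \<cdot> c) (b \<star> d)) F))"
    by (rule sweedler_cong[OF vH vL refl], rule sweedler_sweedler[OF vH vL vH vL X F]; (intro lin)?)
  also have "\<dots> = \<Sigma>L (\<rho> x) (\<lambda>a b. \<Sigma>L (\<rho> y) (\<lambda>c d. F (a \<cdot> c) (b \<star> d)))"
    by (intro sweedler_cong[OF vH vL refl] sweedler_tens[OF vH vL X F]; (intro lin)?)
  finally show ?thesis .
qed

lemma Delta_mult:
  assumes X: "vspace X" and F: "bilinear_map H H X F" and x: "x \<in> carrier H" and y: "y \<in> carrier H"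
  shows "\<Sigma>H (\<Delta> (x \<cdot> y)) F = \<Sigma>H (\<Delta> x) (\<lambda>a b. \<Sigma>H (\<Delta> y) (\<lambda>c d. F (a \<cdot> c) (b \<cdot> d)))"
proof -
  have "\<Delta> (x \<cdot> y) = tlift H H (H \<otimes> H) (\<lambda>a b. tlift H H (H \<otimes> H)
       (\<lambda>a' b'. tens H H (a \<cdot> a') (b \<cdot> b')) (\<Delta> y)) (\<Delta> x)"
    using hopf(3) x y by (simp add: algebra_hom_def tensor_algebra_def)
  also have "\<dots> = \<Sigma>H (\<Delta> x) (\<lambda>a b. \<Sigma>H (\<Delta> y) (\<lambda>c d. tens H H (a \<cdot> c) (b \<cdot> d)))"
    by (rule tlift_sweedler_cong[OF vH vH vspace_tensor]; (rule tlift_sweedler)?; (intro lin x y)?)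
  finally have eq: "\<Delta> (x \<cdot> y) = \<Sigma>H (\<Delta> x) (\<lambda>a b. \<Sigma>H (\<Delta> y) (\<lambda>c d. tens H H (a \<cdot> c) (b \<cdot> d)))" .
  have "\<Sigma>H (\<Delta> (x \<cdot> y)) F = \<Sigma>H (\<Delta> x) (\<lambda>a b. \<Sigma>H (\<Sigma>H (\<Delta> y) (\<lambda>c d. tens H H (a \<cdot> c) (b \<cdot> d))) F)"
    unfolding eq by (rule sweedler_sweedler[OF vH vH vH vH X F]; (intro lin)?)
  also have "\<dots> = \<Sigma>H (\<Delta> x) (\<lambda>a b. \<Sigma>H (\<Delta> y) (\<lambda>c d. \<Sigma>H (tens H H (a \<cdot> c) (b \<cdot> d)) F))"
    by (rule sweedler_cong[OF vH vH refl], rule sweedler_sweedler[OF vH vH vH vH X F]; (intro lin)?)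
  also have "\<dots> = \<Sigma>H (\<Delta> x) (\<lambda>a b. \<Sigma>H (\<Delta> y) (\<lambda>c d. F (a \<cdot> c) (b \<cdot> d)))"
    by (intro sweedler_cong[OF vH vH refl] sweedler_tens[OF vH vH X F]; (intro lin)?)
  finally show ?thesis .
qed

section \<open>The cotensor product and its untwisting\<close>

abbreviation "pr \<equiv> component LG 0"
abbreviation "E \<equiv> degree_zero L LG"
abbreviation "H0 \<equiv> degree_zero H HG"

lemma zero_part: "vspace H0" "vspace E" "carrier H0 = HG 0" "carrier E = LG 0"
  "scale H0 = scale H" "scale E = scale L" "HG 0 \<subseteq> carrier H" "LG 0 \<subseteq> carrier L"
  using grading_vspace[OF vH grH] grading_vspace[OF vL grL] grading_subset[OF grH] grading_subset[OF grL]
  by (simp_all add: degree_zero_def)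

lemma pr_in: "x \<in> carrier L \<Longrightarrow> pr x \<in> LG 0"
  by (rule component_in[OF grL])

lemma tens_degree_zero: "tens H E = tens H L" "tens H0 E = tens H L"
  by (intro tens_cong zero_part refl)+

lemma HE_subset: "carrier (H \<otimes> E) \<subseteq> carrier (H \<otimes> L)"
  by (intro tensor_mono zero_part order_refl refl) (simp add: zero_part)

lemma rho_zero_in: "l \<in> LG 0 \<Longrightarrow> \<rho> l \<in> carrier (H0 \<otimes> E)"
  using comodule(4)[of l 0] by (simp add: tensor_grading_0 degree_zero_def)

text \<open>The coaction of \<open>l\<close> has total degree zero, so it is spanned by simple
  tensors with both legs in degree zero; \<open>F\<close> and \<open>G\<close> are compared only on
  these.\<close>

lemma rho_zero_cong:
  assumes "vspace X" "bilinear_map H L X F" "bilinear_map H L X G" "l \<in> LG 0"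
    and "\<And>a b. a \<in> HG 0 \<Longrightarrow> b \<in> LG 0 \<Longrightarrow> F a b = G a b"
  shows "\<Sigma>L (\<rho> l) F = \<Sigma>L (\<rho> l) G"
proof (rule linear_map_eq_on_tensor_grading[OF vH grH vL grL _ _ _ comodule(4)[OF assms(4)]])
  show "linear_map (H \<otimes> L) X (\<lambda>t. \<Sigma>L t F)" "linear_map (H \<otimes> L) X (\<lambda>t. \<Sigma>L t G)"
    by (intro linear_map_sweedler_tensor vH vL assms)+
  fix i j v w assume "v \<in> HG i" "w \<in> LG j" "i + j = 0"
  then have vw: "v \<in> HG 0" "w \<in> LG 0" by simp_all
  then have c: "v \<in> carrier H" "w \<in> carrier L" using zero_part by blast+
  show "\<Sigma>L (tens H L v w) F = \<Sigma>L (tens H L v w) G"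
    unfolding sweedler_tens[OF vH vL assms(1,2) c] sweedler_tens[OF vH vL assms(1,3) c]
    by (rule assms(5)[OF vw])
qed

text \<open>The projections onto degree zero are compatible with the coaction. In positive degree
  both sides vanish: the degrees of the legs add up to \<open>n\<close>, so one of the two
  projections kills each simple tensor.\<close>

lemma rho_pr:
  assumes X: "vspace X" and F: "bilinear_map H L X F" and l: "l \<in> carrier L"
  shows "\<Sigma>L (\<rho> l) (\<lambda>a b. F (component HG 0 a) (pr b)) = \<Sigma>L (\<rho> (pr l)) F"
proof (rule linear_map_eq_on_homogeneous[OF vL grL _ _ _ l])
  note lin' = linear_map_bilinear_left[OF F] linear_map_bilinear_right[OF F] bilinear_map_carrier[OF F]
    X F lin
  let ?F = "\<lambda>a b. F (component HG 0 a) (pr b)"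
  have F': "bilinear_map H L X ?F"
    by (intro lin')
  show "linear_map L X (\<lambda>l. \<Sigma>L (\<rho> l) ?F)"
    by (rule linear_map_sweedler_arg[OF vH vL X F' rho_linear])
  show "linear_map L X (\<lambda>l. \<Sigma>L (\<rho> (pr l)) F)"
    by (intro lin')
  fix n x assume x: "x \<in> LG n"
  note lins = linear_map_sweedler_tensor[OF vH vL X F] linear_map_sweedler_tensor[OF vH vL X F']
  show "\<Sigma>L (\<rho> x) ?F = \<Sigma>L (\<rho> (pr x)) F"
  proof (cases "n = 0")
    case True
    then have "\<Sigma>L (\<rho> x) ?F = \<Sigma>L (\<rho> x) F"
      using x component_homogeneous[OF vH grH, of _ 0 0] component_homogeneous[OF vL grL, of _ 0 0]
      by (intro rho_zero_cong[OF X F' F]) simp_all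
    then show ?thesis
      using True component_homogeneous[OF vL grL x] by simp
  next
    case False
    have "\<Sigma>L (\<rho> x) ?F = 0"
    proof (rule linear_map_eq_on_tensor_grading[OF vH grH vL grL lins(2) linear_map_zero_fun[OF X] _ comodule(4)[OF x]])
      fix i j v w assume vw: "v \<in> HG i" "w \<in> LG j" "i + j = n"
      then have c: "v \<in> carrier H" "w \<in> carrier L"
        using grading_subset[OF grH] grading_subset[OF grL] by blast+
      have z: "F 0 (pr w) = 0" "F (component HG 0 v) 0 = 0"
        using linear_map_zero[OF vH bilinear_map_left[OF F]] linear_map_zero[OF vL bilinear_map_right[OF F]]
          carrier_rules(6,7) c by blast+
      have "component HG 0 v = 0 \<or> pr w = 0"
        using component_homogeneous[OF vH grH vw(1), of 0] component_homogeneous[OF vL grL vw(2), of 0]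
          vw(3) False by auto
      then show "\<Sigma>L (tens H L v w) ?F = 0"
        unfolding sweedler_tens[OF vH vL X F' c] using z by auto
    qed
    moreover have "\<rho> (pr x) = 0"
      using False component_homogeneous[OF vL grL x, of 0] linear_map_zero[OF vL rho_linear] by simp
    ultimately show ?thesis
      using linear_map_zero[OF vspace_tensor lins(1)] by simp
  qed
qed

section \<open>The map \<open>\<psi>\<close> into the cotensor product\<close>

definition \<psi> where "\<psi> x = \<Sigma>L (\<rho> x) (\<lambda>a b. tens H L a (pr b))"

lemma psi_linear: "linear_map L (H \<otimes> L) \<psi>"
  unfolding \<psi>_def[abs_def] by (intro lin)

lemma psi_in: "x \<in> carrier L \<Longrightarrow> \<psi> x \<in> carrier (H \<otimes> E)"
  unfolding \<psi>_def
  by (rule sweedler_carrier[OF vH vL vspace_tensor])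
    (auto simp: tens_degree_zero(1)[symmetric] zero_part pr_in intro!: tens_in_carrier)

lemma psi_sweedler:
  assumes X: "vspace X" and F: "bilinear_map H L X F"
  shows "\<Sigma>L (\<psi> x) F = \<Sigma>L (\<rho> x) (\<lambda>a b. F a (pr b))"
proof -
  have "\<Sigma>L (\<psi> x) F = \<Sigma>L (\<rho> x) (\<lambda>a b. \<Sigma>L (tens H L a (pr b)) F)"
    unfolding \<psi>_def by (rule sweedler_sweedler[OF vH vL vH vL X F]; (intro lin)?)
  also have "\<dots> = \<Sigma>L (\<rho> x) (\<lambda>a b. F a (pr b))"
    by (intro sweedler_cong[OF vH vL refl] sweedler_tens[OF vH vL X F]; (intro lin)?)
  finally show ?thesis .
qed

lemma psi_mult:
  assumes x: "x \<in> carrier L" and y: "y \<in> carrier L"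
  shows "\<psi> (x \<star> y) = \<Sigma>L (\<psi> x) (\<lambda>a b. \<Sigma>L (\<psi> y) (\<lambda>c d. tens H L (a \<cdot> c) (b \<star> d)))"
proof -
  have "\<psi> (x \<star> y) = \<Sigma>L (\<rho> x) (\<lambda>a b. \<Sigma>L (\<rho> y) (\<lambda>c d. tens H L (a \<cdot> c) (pr (b \<star> d))))"
    unfolding \<psi>_def by (rule rho_mult[OF vspace_tensor[of H L] _ x y]; (intro lin)?)
  also have "\<dots> = \<Sigma>L (\<rho> x) (\<lambda>a b. \<Sigma>L (\<rho> y) (\<lambda>c d. tens H L (a \<cdot> c) (pr b \<star> pr d)))"
    by (intro sweedler_cong[OF vH vL refl]) (simp add: component_zero_mult[OF comodule(3)])
  also have "\<dots> = \<Sigma>L (\<rho> x) (\<lambda>a b. \<Sigma>L (\<psi> y) (\<lambda>c d. tens H L (a \<cdot> c) (pr b \<star> d)))"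
    by (rule sweedler_cong[OF vH vL refl], rule psi_sweedler[OF vspace_tensor[of H L], symmetric]; (intro lin)?)
  also have "\<dots> = \<Sigma>L (\<psi> x) (\<lambda>a b. \<Sigma>L (\<psi> y) (\<lambda>c d. tens H L (a \<cdot> c) (b \<star> d)))"
    by (rule psi_sweedler[OF vspace_tensor[of H L], symmetric]; (intro lin)?)
  finally show ?thesis .
qed

text \<open>Colinearity of \<open>\<psi>\<close>, with \<open>H\<close> coacting on
  \<open>H \<otimes> L\<close> through the first leg alone. It is coassociativity, since
  \<open>pr\<close> touches only the last leg.\<close>

lemma psi_comodule:
  assumes X: "vspace X" and F: "trilinear_map H H L X F" and x: "x \<in> carrier L"
  shows "\<Sigma>L (\<rho> x) (\<lambda>h l. \<Sigma>L (\<psi> l) (F h)) = \<Sigma>L (\<psi> x) (\<lambda>h l. \<Sigma>H (\<Delta> h) (\<lambda>h1 h2. F h1 h2 l))"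
proof -
  note lin' = linear_map_trilinear[OF F] X lin
  have "\<Sigma>L (\<rho> x) (\<lambda>h l. \<Sigma>L (\<psi> l) (F h)) = \<Sigma>L (\<rho> x) (\<lambda>h l. \<Sigma>L (\<rho> l) (\<lambda>a b. F h a (pr b)))"
    by (rule sweedler_cong[OF vH vL refl], rule psi_sweedler[OF X]; (intro lin')?)
  also have "\<dots> = \<Sigma>L (\<rho> x) (\<lambda>h l. \<Sigma>H (\<Delta> h) (\<lambda>h1 h2. F h1 h2 (pr l)))"
    by (rule rho_coassoc[OF X _ x, symmetric]; (intro lin')?)
  also have "\<dots> = \<Sigma>L (\<psi> x) (\<lambda>h l. \<Sigma>H (\<Delta> h) (\<lambda>h1 h2. F h1 h2 l))"
    by (rule psi_sweedler[OF X, symmetric]; (intro lin')?)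
  finally show ?thesis .
qed

text \<open>The cotensor condition over \<open>H(0)\<close>. Coassociativity moves the projected leg
  of \<open>\<Delta> h\<close> into a coaction of the second leg, where \<open>rho_pr\<close> turns
  the two projections into the coaction of \<open>pr l\<close>.\<close>

lemma psi_cotensor:
  assumes X: "vspace X" and F: "trilinear_map H H L X F" and x: "x \<in> carrier L"
  shows "\<Sigma>L (\<psi> x) (\<lambda>h l. \<Sigma>H (\<Delta> h) (\<lambda>h1 h2. F h1 (component HG 0 h2) l)) =
    \<Sigma>L (\<psi> x) (\<lambda>h l. \<Sigma>L (\<rho> l) (F h))"
proof -
  note lin' = linear_map_trilinear[OF F] X lin
  have "\<Sigma>L (\<psi> x) (\<lambda>h l. \<Sigma>H (\<Delta> h) (\<lambda>h1 h2. F h1 (component HG 0 h2) l)) =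
      \<Sigma>L (\<rho> x) (\<lambda>h l. \<Sigma>H (\<Delta> h) (\<lambda>h1 h2. F h1 (component HG 0 h2) (pr l)))"
    by (rule psi_sweedler[OF X]; (intro lin')?)
  also have "\<dots> = \<Sigma>L (\<rho> x) (\<lambda>h l. \<Sigma>L (\<rho> l) (\<lambda>a b. F h (component HG 0 a) (pr b)))"
    by (rule rho_coassoc[OF X _ x]; (intro lin')?)
  also have "\<dots> = \<Sigma>L (\<rho> x) (\<lambda>h l. \<Sigma>L (\<rho> (pr l)) (F h))"
    by (rule sweedler_cong[OF vH vL refl], rule rho_pr[OF X]; (intro lin')?)
  also have "\<dots> = \<Sigma>L (\<psi> x) (\<lambda>h l. \<Sigma>L (\<rho> l) (F h))"
    by (rule psi_sweedler[OF X, symmetric]; (intro lin')?)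
  finally show ?thesis .
qed

section \<open>The untwisting maps \<open>\<theta>\<close> and \<open>\<theta>'\<close>\<close>

definition twist where
  "twist s t = \<Sigma>L t (\<lambda>h l. \<Sigma>L (\<rho> l) (\<lambda>a b. tens H L (h \<cdot> s a) b))"

lemma twist_linear:
  assumes s: "linear_map H H s"
  shows "linear_map (H \<otimes> L) (H \<otimes> L) (twist s)"
  unfolding twist_def[abs_def] by (intro lin linear_map_compose[OF refl s] linear_map_carrier[OF s])

lemma twist_sweedler:
  assumes X: "vspace X" and F: "bilinear_map H L X F" and s: "linear_map H H s"
  shows "\<Sigma>L (twist s t) F = \<Sigma>L t (\<lambda>h l. \<Sigma>L (\<rho> l) (\<lambda>a b. F (h \<cdot> s a) b))"
proof -
  note lin' = lin linear_map_compose[OF refl s] linear_map_carrier[OF s]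
  have "\<Sigma>L (twist s t) F = \<Sigma>L t (\<lambda>h l. \<Sigma>L (\<Sigma>L (\<rho> l) (\<lambda>a b. tens H L (h \<cdot> s a) b)) F)"
    unfolding twist_def by (rule sweedler_sweedler[OF vH vL vH vL X F]; (intro lin')?)
  also have "\<dots> = \<Sigma>L t (\<lambda>h l. \<Sigma>L (\<rho> l) (\<lambda>a b. \<Sigma>L (tens H L (h \<cdot> s a) b) F))"
    by (rule sweedler_cong[OF vH vL refl], rule sweedler_sweedler[OF vH vL vH vL X F]; (intro lin')?)
  also have "\<dots> = \<Sigma>L t (\<lambda>h l. \<Sigma>L (\<rho> l) (\<lambda>a b. F (h \<cdot> s a) b))"
    by (intro sweedler_cong[OF vH vL refl] sweedler_tens[OF vH vL X F]; (intro lin')?)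
  finally show ?thesis .
qed

lemma twist_tens:
  assumes "h \<in> carrier H" "l \<in> carrier L" "linear_map H H s"
  shows "twist s (tens H L h l) = \<Sigma>L (\<rho> l) (\<lambda>a b. tens H L (h \<cdot> s a) b)"
  unfolding twist_def
  by (rule sweedler_tens[OF vH vL vspace_tensor[of H L]];
      (intro assms lin linear_map_compose[OF refl assms(3)] linear_map_carrier[OF assms(3)])?)

text \<open>The composite multiplies the first leg by \<open>s a \<cdot> s' c\<close> for adjacent
  legs a and c of one coaction, so it is trivial if \<open>s\<close> and \<open>s'\<close> are
  convolution inverse in this order. The antipode and the identity are so in both orders.\<close>

lemma twist_inverse:
  assumes t: "t \<in> carrier (H \<otimes> L)" and s: "linear_map H H s" "linear_map H H s'"
    and eq: "\<And>x. x \<in> carrier H \<Longrightarrow> \<Sigma>H (\<Delta> x) (\<lambda>a b. s a \<cdot> s' b) = scale H (\<epsilon> x) (unit H)"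
  shows "twist s' (twist s t) = t"
proof -
  note lin' = lin linear_map_compose[OF refl s(1)] linear_map_carrier[OF s(1)]
    linear_map_compose[OF refl s(2)] linear_map_carrier[OF s(2)]
  have "twist s' (twist s t) =
      \<Sigma>L t (\<lambda>h l. \<Sigma>L (\<rho> l) (\<lambda>a b. \<Sigma>L (\<rho> b) (\<lambda>c d. tens H L (h \<cdot> s a \<cdot> s' c) d)))"
    by (subst (1) twist_def, rule twist_sweedler[OF vspace_tensor[of H L] _ s(1)]; (intro lin')?)
  also have "\<dots> = \<Sigma>L t (\<lambda>h l. \<Sigma>L (\<rho> l) (\<lambda>a b. \<Sigma>L (\<rho> b) (\<lambda>c d. tens H L (h \<cdot> (s a \<cdot> s' c)) d)))"
    by (intro sweedler_cong[OF vH vL refl]) (simp add: mult_assoc linear_map_carrier[OF s(1)] linear_map_carrier[OF s(2)])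
  also have "\<dots> = \<Sigma>L t (\<lambda>h l. tens H L (h \<cdot> unit H) l)"
    by (rule sweedler_cong[OF vH vL refl], rule rho_cancel[OF vspace_tensor[of H L] _ _ eq]; (intro lin')?)
  also have "\<dots> = \<Sigma>L t (tens H L)"
    by (rule sweedler_cong[OF vH vL refl]) (simp add: mult_unit)
  finally show ?thesis using sweedler_tens_id[OF vH vL t] by simp
qed

abbreviation "\<theta> \<equiv> twist \<S>"
abbreviation "\<theta>' \<equiv> twist (\<lambda>x. x)"

lemma theta_inverse:
  assumes "t \<in> carrier (H \<otimes> L)"
  shows "\<theta> (\<theta>' t) = t" "\<theta>' (\<theta> t) = t"
  by (rule twist_inverse[OF assms linear_map_id hopf(5) antipode_sweedler(2)]; assumption)
    (rule twist_inverse[OF assms hopf(5) linear_map_id antipode_sweedler(1)]; assumption)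

lemma HE_cong:
  assumes "vspace X" "bilinear_map H L X F" "bilinear_map H L X G" "t \<in> carrier (H \<otimes> E)"
    and "\<And>a b. a \<in> carrier H \<Longrightarrow> b \<in> LG 0 \<Longrightarrow> F a b = G a b"
  shows "\<Sigma>L t F = \<Sigma>L t G"
proof -
  note sub = sweedler_sub[OF vH zero_part(2) vH vL assms(1) refl zero_part(6) order_refl _ _ assms(4)]
  have "\<Sigma>L t F = sweedler H E t F" "\<Sigma>L t G = sweedler H E t G"
    using assms(2,3) zero_part by (auto intro!: sub)
  moreover have "sweedler H E t F = sweedler H E t G"
    using assms(5) by (intro sweedler_cong vH zero_part refl) (simp add: zero_part)
  ultimately show ?thesis by simp
qed

lemma rho_zero_carrier:
  assumes "vspace X" "vspace X'" "bilinear_map H L X F" "l \<in> LG 0"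
    and "\<And>a b. a \<in> HG 0 \<Longrightarrow> b \<in> LG 0 \<Longrightarrow> F a b \<in> carrier X'"
  shows "\<Sigma>L (\<rho> l) F \<in> carrier X'"
  by (rule sweedler_sub_carrier[OF zero_part(1,2) vH vL assms(1,2) zero_part(5,6) _ _ assms(3) rho_zero_in[OF assms(4)]])
    (simp_all add: zero_part assms(5))

text \<open>The second legs in the coaction of a degree-zero element again have degree zero.\<close>

lemma twist_in_HE:
  assumes t: "t \<in> carrier (H \<otimes> E)" and s: "linear_map H H s"
  shows "twist s t \<in> carrier (H \<otimes> E)"
proof -
  note lin' = lin linear_map_compose[OF refl s] linear_map_carrier[OF s]
  note HL = vspace_tensor[of H L]
  show ?thesis
    unfolding twist_def
  proof (rule sweedler_sub_carrier[OF vH zero_part(2) vH vL HL vspace_tensor refl zero_part(6)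
        order_refl _ _ t])
    show "carrier E \<subseteq> carrier L" by (simp add: zero_part)
    show "bilinear_map H L (H \<otimes> L) (\<lambda>h l. \<Sigma>L (\<rho> l) (\<lambda>a b. tens H L (h \<cdot> s a) b))"
      by (intro lin')
    fix h l assume h: "h \<in> carrier H" and "l \<in> carrier E"
    then have l: "l \<in> LG 0" by (simp add: zero_part)
    show "\<Sigma>L (\<rho> l) (\<lambda>a b. tens H L (h \<cdot> s a) b) \<in> carrier (H \<otimes> E)"
    proof (rule rho_zero_carrier[OF HL vspace_tensor _ l])
      show "bilinear_map H L (H \<otimes> L) (\<lambda>a b. tens H L (h \<cdot> s a) b)"
        by (intro lin' h)
      fix a b assume ab: "a \<in> HG 0" "b \<in> LG 0"
      then have "a \<in> carrier H" using zero_part by blast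
      then have "tens H E (h \<cdot> s a) b \<in> carrier (H \<otimes> E)"
        using ab by (intro tens_in_carrier lin' h) (simp_all add: zero_part)
      then show "tens H L (h \<cdot> s a) b \<in> carrier (H \<otimes> E)"
        by (simp add: tens_degree_zero)
    qed
  qed
qed

section \<open>The embedding \<open>\<phi>\<close> and the coinvariance of its values\<close>

definition \<phi> where "\<phi> x = \<theta> (\<psi> x)"

lemma phi_linear: "linear_map L (H \<otimes> L) \<phi>"
  unfolding \<phi>_def[abs_def] by (rule linear_map_compose[OF refl twist_linear[OF hopf(5)] psi_linear])

lemma phi_in: "x \<in> carrier L \<Longrightarrow> \<phi> x \<in> carrier (H \<otimes> E)"
  unfolding \<phi>_def by (intro twist_in_HE psi_in hopf(5))

lemma theta_phi: "x \<in> carrier L \<Longrightarrow> \<theta>' (\<phi> x) = \<psi> x"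
  unfolding \<phi>_def by (intro theta_inverse subsetD[OF HE_subset] psi_in)

text \<open>Injectivity of \<open>\<theta>'\<close> as a rule: degrees, products and the unit are
  compared after \<open>\<theta>'\<close>, where \<open>\<phi>\<close> has become
  \<open>\<psi>\<close>.\<close>

lemma eq_phiI:
  assumes "t \<in> carrier (H \<otimes> L)" "x \<in> carrier L" "\<theta>' t = \<psi> x"
  shows "t = \<phi> x"
  using theta_inverse(1)[OF assms(1)] assms(3) by (simp add: \<phi>_def)

text \<open>\<open>G\<close> undoes the diagonal action \<open>x \<otimes> y \<otimes> l \<mapsto> x l\<^sub>(\<^sub>-\<^sub>2\<^sub>) \<otimes> y l\<^sub>(\<^sub>-\<^sub>1\<^sub>) \<otimes> l\<^sub>(\<^sub>0\<^sub>)\<close> of the coaction.\<close>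

lemma double_untwist:
  assumes X: "vspace X" and F: "trilinear_map H H L X F"
    and x: "x \<in> carrier H" and y: "y \<in> carrier H" and l: "l \<in> carrier L"
  defines "G \<equiv> \<lambda>h g l. \<Sigma>L (\<rho> l) (\<lambda>p q. \<Sigma>L (\<rho> q) (\<lambda>r s. F (h \<cdot> \<S> r) (g \<cdot> \<S> p) s))"
  shows "\<Sigma>L (\<rho> l) (\<lambda>a b. \<Sigma>L (\<rho> b) (\<lambda>c d. G (x \<cdot> a) (y \<cdot> c) d)) = F x y l"
proof -
  note lin' = linear_map_trilinear[OF F] X lin
  have "\<Sigma>L (\<rho> l) (\<lambda>a b. \<Sigma>L (\<rho> b) (\<lambda>c d. G (x \<cdot> a) (y \<cdot> c) d)) =
      \<Sigma>L (\<rho> l) (\<lambda>a b. \<Sigma>L (\<rho> b) (\<lambda>c d. \<Sigma>L (\<rho> d) (\<lambda>p q. \<Sigma>L (\<rho> q)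
        (\<lambda>r s. F (x \<cdot> a \<cdot> \<S> r) (y \<cdot> (c \<cdot> \<S> p)) s))))"
    unfolding G_def
    by (intro sweedler_cong[OF vH vL refl]) (simp add: mult_assoc y linear_map_carrier[OF hopf(5)])
  \<comment> \<open>The iterated legs of \<open>l\<close> are, in order, a, c, p, r. As
    \<open>G\<close> pairs c with p and a with r, the adjacent pair \<open>c \<cdot> \<S> p\<close>
    cancels first, which makes a and r adjacent.\<close>
  also have "\<dots> = \<Sigma>L (\<rho> l) (\<lambda>a b. \<Sigma>L (\<rho> b) (\<lambda>r s. F (x \<cdot> a \<cdot> \<S> r) (y \<cdot> unit H) s))"
    by (rule sweedler_cong[OF vH vL refl], rule rho_cancel_right[OF X]; (intro lin' x y)?)
  also have "\<dots> = \<Sigma>L (\<rho> l) (\<lambda>a b. \<Sigma>L (\<rho> b) (\<lambda>r s. F (x \<cdot> (a \<cdot> \<S> r)) (y \<cdot> unit H) s))"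
    by (intro sweedler_cong[OF vH vL refl]) (simp add: mult_assoc x linear_map_carrier[OF hopf(5)])
  also have "\<dots> = F (x \<cdot> unit H) (y \<cdot> unit H) l"
    by (rule rho_cancel_right[OF X]; (intro lin' x y l)?)
  finally show ?thesis by (simp add: mult_unit x y)
qed

text \<open>Writing \<open>F\<close> through \<open>G\<close> brings in the diagonal coaction, which
  merges with \<open>\<Delta> h\<close> into \<open>\<Delta> (h \<cdot> a)\<close>. The products
  \<open>h \<cdot> a\<close> are the first legs of \<open>\<theta>' (\<phi> x) = \<psi> x\<close>,
  so the cotensor condition applies; the untwisting then leaves the unit in the middle
  position.\<close>

lemma phi_coinvariant:
  assumes X: "vspace X" and F: "trilinear_map H H L X F" and x: "x \<in> carrier L"
  shows "\<Sigma>L (\<phi> x) (\<lambda>h l. \<Sigma>H (\<Delta> h) (\<lambda>h1 h2. F h1 (component HG 0 h2) l)) =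
    \<Sigma>L (\<phi> x) (\<lambda>h l. F h (unit H) l)"
proof -
  let ?\<pi> = "component HG 0"
  define G where "G = (\<lambda>h g l. \<Sigma>L (\<rho> l) (\<lambda>p q. \<Sigma>L (\<rho> q) (\<lambda>r s. F (h \<cdot> \<S> r) (g \<cdot> \<S> p) s)))"
  note linF = linear_map_trilinear[OF F] X lin
  have G: "trilinear_map H H L X G"
    unfolding G_def by (intro linF)
  have untwist: "\<Sigma>L (\<rho> l) (\<lambda>a b. \<Sigma>L (\<rho> b) (\<lambda>c d. G (x \<cdot> a) (y \<cdot> c) d)) = F x y l"
    if "x \<in> carrier H" "y \<in> carrier H" "l \<in> carrier L" for x y l
    unfolding G_def by (rule double_untwist[OF X F that])
  note lin' = linear_map_trilinear[OF G] linF
  have "\<Sigma>L (\<phi> x) (\<lambda>h l. \<Sigma>H (\<Delta> h) (\<lambda>h1 h2. F h1 (?\<pi> h2) l)) =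
      \<Sigma>L (\<phi> x) (\<lambda>h l. \<Sigma>H (\<Delta> h) (\<lambda>h1 h2. \<Sigma>L (\<rho> l) (\<lambda>a b. \<Sigma>L (\<rho> b)
        (\<lambda>c d. G (h1 \<cdot> a) (?\<pi> h2 \<cdot> c) d))))"
    by (intro sweedler_cong[OF vH vL refl] sweedler_cong[OF vH vH refl] untwist[symmetric] lin)
  \<comment> \<open>As \<open>l\<close> has degree zero, so do the legs of its iterated coaction.
    Hence \<open>?\<pi>\<close> fixes c and may be inserted, after which multiplicativity of
    \<open>?\<pi>\<close> joins h2 and c.\<close>
  also have "\<dots> = \<Sigma>L (\<phi> x) (\<lambda>h l. \<Sigma>H (\<Delta> h) (\<lambda>h1 h2. \<Sigma>L (\<rho> l) (\<lambda>a b. \<Sigma>L (\<rho> b)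
        (\<lambda>c d. G (h1 \<cdot> a) (?\<pi> h2 \<cdot> ?\<pi> c) d))))"
  proof (rule HE_cong[OF X _ _ phi_in[OF x]])
    fix h l assume l: "l \<in> LG 0"
    show "\<Sigma>H (\<Delta> h) (\<lambda>h1 h2. \<Sigma>L (\<rho> l) (\<lambda>a b. \<Sigma>L (\<rho> b) (\<lambda>c d. G (h1 \<cdot> a) (?\<pi> h2 \<cdot> c) d))) =
      \<Sigma>H (\<Delta> h) (\<lambda>h1 h2. \<Sigma>L (\<rho> l) (\<lambda>a b. \<Sigma>L (\<rho> b) (\<lambda>c d. G (h1 \<cdot> a) (?\<pi> h2 \<cdot> ?\<pi> c) d)))"
    proof (rule sweedler_cong[OF vH vH refl], rule rho_zero_cong[OF X _ _ l])
      fix h1 h2 a b assume h: "h1 \<in> carrier H" "h2 \<in> carrier H" and a: "a \<in> HG 0" and b: "b \<in> LG 0"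
      have a': "a \<in> carrier H" using a zero_part by blast
      show "\<Sigma>L (\<rho> b) (\<lambda>c d. G (h1 \<cdot> a) (?\<pi> h2 \<cdot> c) d) =
          \<Sigma>L (\<rho> b) (\<lambda>c d. G (h1 \<cdot> a) (?\<pi> h2 \<cdot> ?\<pi> c) d)"
        by (rule rho_zero_cong[OF X _ _ b]; (intro lin' h a')?;
            simp add: component_homogeneous[OF vH grH, of _ 0])
    qed (intro lin'; assumption)+
  qed (intro lin'; assumption)+
  also have "\<dots> = \<Sigma>L (\<phi> x) (\<lambda>h l. \<Sigma>H (\<Delta> h) (\<lambda>h1 h2. \<Sigma>L (\<rho> l) (\<lambda>a b. \<Sigma>H (\<Delta> a)
        (\<lambda>a1 a2. G (h1 \<cdot> a1) (?\<pi> h2 \<cdot> ?\<pi> a2) b))))"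
    by (intro sweedler_cong[OF vH vL refl] sweedler_cong[OF vH vH refl] rho_coassoc[OF X, symmetric]; (intro lin')?)
  also have "\<dots> = \<Sigma>L (\<phi> x) (\<lambda>h l. \<Sigma>L (\<rho> l) (\<lambda>a b. \<Sigma>H (\<Delta> h) (\<lambda>h1 h2. \<Sigma>H (\<Delta> a)
        (\<lambda>a1 a2. G (h1 \<cdot> a1) (?\<pi> h2 \<cdot> ?\<pi> a2) b))))"
    by (intro sweedler_cong[OF vH vL refl] sweedler_swap)
  also have "\<dots> = \<Sigma>L (\<phi> x) (\<lambda>h l. \<Sigma>L (\<rho> l) (\<lambda>a b. \<Sigma>H (\<Delta> h) (\<lambda>h1 h2. \<Sigma>H (\<Delta> a)
        (\<lambda>a1 a2. G (h1 \<cdot> a1) (?\<pi> (h2 \<cdot> a2)) b))))"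
    by (intro sweedler_cong[OF vH vL refl] sweedler_cong[OF vH vH refl]) (simp add: component_zero_mult[OF hopf(8)])
  also have "\<dots> = \<Sigma>L (\<phi> x) (\<lambda>h l. \<Sigma>L (\<rho> l) (\<lambda>a b. \<Sigma>H (\<Delta> (h \<cdot> a)) (\<lambda>h1 h2. G h1 (?\<pi> h2) b)))"
    by (intro sweedler_cong[OF vH vL refl] Delta_mult[OF X, symmetric]; (intro lin')?)
  also have "\<dots> = \<Sigma>L (\<psi> x) (\<lambda>h l. \<Sigma>H (\<Delta> h) (\<lambda>h1 h2. G h1 (?\<pi> h2) l))"
    unfolding theta_phi[OF x, symmetric] by (rule twist_sweedler[OF X, symmetric]; (intro lin')?)
  also have "\<dots> = \<Sigma>L (\<psi> x) (\<lambda>h l. \<Sigma>L (\<rho> l) (G h))"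
    by (rule psi_cotensor[OF X G x])
  also have "\<dots> = \<Sigma>L (\<phi> x) (\<lambda>h l. \<Sigma>L (\<rho> l) (\<lambda>a b. \<Sigma>L (\<rho> b) (\<lambda>c d. G (h \<cdot> a) c d)))"
    unfolding theta_phi[OF x, symmetric] by (rule twist_sweedler[OF X]; (intro lin')?)
  \<comment> \<open>The unit is inserted so that \<open>untwist\<close> applies with
    \<open>unit H\<close> as second argument.\<close>
  also have "\<dots> = \<Sigma>L (\<phi> x) (\<lambda>h l. \<Sigma>L (\<rho> l) (\<lambda>a b. \<Sigma>L (\<rho> b) (\<lambda>c d. G (h \<cdot> a) (unit H \<cdot> c) d)))"
    by (intro sweedler_cong[OF vH vL refl]) (simp add: mult_unit)
  also have "\<dots> = \<Sigma>L (\<phi> x) (\<lambda>h l. F h (unit H) l)"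
    by (intro sweedler_cong[OF vH vL refl] untwist unit_carrier)
  finally show ?thesis .
qed

abbreviation "R \<equiv> H\<lparr>carrier := coinvariants H HG\<rparr>"

lemma coinvariants_eq:
  "coinvariants H HG = {r \<in> carrier H.
    \<Sigma>H (\<Delta> r) (\<lambda>a b. tens H H a (component HG 0 b)) = tens H H r (unit H)}"
proof -
  have "tlift H H (H \<otimes> H) (\<lambda>a b. tens H H a (component HG 0 b)) (\<Delta> r) =
      \<Sigma>H (\<Delta> r) (\<lambda>a b. tens H H a (component HG 0 b))" if "r \<in> carrier H" for r
    by (rule tlift_sweedler; (intro lin that)?)
  then show ?thesis unfolding coinvariants_def by auto
qed

lemma R_vspace: "vspace R"
  unfolding coinvariants_eq by (rule linear_map_equalizer[OF vH, where W = "H \<otimes> H"]; (intro lin)?)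

lemma R_subset: "coinvariants H HG \<subseteq> carrier H"
  by (auto simp: coinvariants_eq)

text \<open>Contraction of the last leg by \<open>f\<close> scales the first leg, so it commutes
  with comultiplying that leg and projecting; coinvariance of the whole tensor thus passes to each
  slice.\<close>

lemma phi_slice_coinvariant:
  assumes x: "x \<in> carrier L" and f: "Vector_Spaces.linear (scale L) (*) f"
  shows "\<Sigma>L (\<phi> x) (\<lambda>h l. scale H (f l) h) \<in> coinvariants H HG"
proof -
  let ?\<pi> = "component HG 0"
  let ?r = "\<Sigma>L (\<phi> x) (\<lambda>h l. scale H (f l) h)"
  note b = bilinear_map_slice_right[OF vH f]
  note lin' = linear_map_bilinear_left[OF b] linear_map_bilinear_right[OF b] lin
  have lD: "linear_map H (H \<otimes> H) (\<lambda>r. \<Sigma>H (\<Delta> r) (\<lambda>a b. tens H H a (?\<pi> b)))"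
    by (intro lin)
  have "\<Sigma>H (\<Delta> ?r) (\<lambda>a b. tens H H a (?\<pi> b)) =
      \<Sigma>L (\<phi> x) (\<lambda>h l. \<Sigma>H (\<Delta> (scale H (f l) h)) (\<lambda>a b. tens H H a (?\<pi> b)))"
    by (rule linear_map_sweedler[OF vH vL vH lD]) (intro lin)
  also have "\<dots> = \<Sigma>L (\<phi> x) (\<lambda>h l. \<Sigma>H (\<Delta> h) (\<lambda>a b. tens H H (scale H (f l) a) (?\<pi> b)))"
  proof (rule sweedler_cong[OF vH vL refl])
    fix h l assume h: "h \<in> carrier H"
    have "\<Sigma>H (\<Delta> (scale H (f l) h)) (\<lambda>a b. tens H H a (?\<pi> b)) =
        scale (H \<otimes> H) (f l) (\<Sigma>H (\<Delta> h) (\<lambda>a b. tens H H a (?\<pi> b)))"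
      by (rule linear_map_scale[OF lD h])
    also have "\<dots> = \<Sigma>H (\<Delta> h) (\<lambda>a b. scale (H \<otimes> H) (f l) (tens H H a (?\<pi> b)))"
      by (rule linear_map_sweedler[OF vH vH vspace_tensor linear_map_scaling[OF vspace_tensor]]) (intro lin)
    also have "\<dots> = \<Sigma>H (\<Delta> h) (\<lambda>a b. tens H H (scale H (f l) a) (?\<pi> b))"
      by (intro sweedler_cong[OF vH vH refl] tens_scale_left[OF vH vH, symmetric] lin)
    finally show "\<Sigma>H (\<Delta> (scale H (f l) h)) (\<lambda>a b. tens H H a (?\<pi> b)) = \<dots>" .
  qed
  \<comment> \<open>This is \<open>phi_coinvariant\<close> with \<open>F h1 h2 l\<close> equal to
    f(l) h1 \<otimes> h2.\<close>
  also have "\<dots> = \<Sigma>L (\<phi> x) (\<lambda>h l. tens H H (scale H (f l) h) (unit H))"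
    by (rule phi_coinvariant[OF vspace_tensor[of H H] _ x]; (intro lin')?)
  also have "\<dots> = tens H H ?r (unit H)"
    by (rule linear_map_sweedler[OF vH vL vH bilinear_map_left[OF tens_bilinear[OF vH vH] unit_carrier(1)], symmetric])
      (intro lin)
  finally show ?thesis
    unfolding coinvariants_eq by (intro CollectI conjI lin)
qed

lemma slice_HE:
  assumes t: "t \<in> carrier (H \<otimes> E)" and f: "Vector_Spaces.linear (scale L) (*) f"
  shows "sweedler H E t (\<lambda>h l. scale H (f l) h) = \<Sigma>L t (\<lambda>h l. scale H (f l) h)"
  by (rule sweedler_sub[OF vH zero_part(2) vH vL vH refl zero_part(6) order_refl _ bilinear_map_slice_right[OF vH f] t, symmetric])
    (simp add: zero_part)

lemma phi_in_R: "x \<in> carrier L \<Longrightarrow> \<phi> x \<in> carrier (R \<otimes> E)"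
proof (rule tensor_slices_right[OF vH zero_part(2) R_vspace _ phi_in])
  fix f assume x: "x \<in> carrier L" and f: "Vector_Spaces.linear (scale E) (*) f"
  then have f: "Vector_Spaces.linear (scale L) (*) f" by (simp add: zero_part)
  show "sweedler H E (\<phi> x) (\<lambda>h l. scale H (f l) h) \<in> carrier R"
    using phi_slice_coinvariant[OF x f] slice_HE[OF phi_in[OF x] f] by simp
qed simp_all

section \<open>Compatibility of \<open>\<phi>\<close> with the gradings\<close>

definition hproj where "hproj n t = \<Sigma>L t (\<lambda>h l. tens H L (component HG n h) l)"

lemma hproj_bilinear: "bilinear_map H L (H \<otimes> L) (\<lambda>h l. tens H L (component HG n h) l)"
  by (intro lin)

lemma hproj_linear: "linear_map (H \<otimes> L) (H \<otimes> L) (hproj n)"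
  unfolding hproj_def[abs_def] by (intro lin)

text \<open>The factors multiplied in by \<open>\<theta>'\<close> come from the coaction on
  \<open>L(0)\<close> and have degree zero, so the degree of the first leg is unchanged.\<close>

lemma twist_hproj:
  assumes t: "t \<in> carrier (H \<otimes> E)"
  shows "\<theta>' (hproj n t) = hproj n (\<theta>' t)"
proof -
  note HL = vspace_tensor[of H L]
  have "\<theta>' (hproj n t) = \<Sigma>L t (\<lambda>h l. \<theta>' (tens H L (component HG n h) l))"
    unfolding hproj_def by (rule linear_map_sweedler[OF vH vL HL twist_linear[OF linear_map_id]]; (intro lin)?)
  also have "\<dots> = \<Sigma>L t (\<lambda>h l. \<Sigma>L (\<rho> l) (\<lambda>a b. tens H L (component HG n h \<cdot> a) b))"
    by (intro sweedler_cong[OF vH vL refl] twist_tens lin)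
  also have "\<dots> = \<Sigma>L t (\<lambda>h l. \<Sigma>L (\<rho> l) (\<lambda>a b. tens H L (component HG n (h \<cdot> a)) b))"
  proof (rule HE_cong[OF HL _ _ t])
    fix h l assume h: "h \<in> carrier H" and l: "l \<in> LG 0"
    show "\<Sigma>L (\<rho> l) (\<lambda>a b. tens H L (component HG n h \<cdot> a) b) =
        \<Sigma>L (\<rho> l) (\<lambda>a b. tens H L (component HG n (h \<cdot> a)) b)"
      by (rule rho_zero_cong[OF HL _ _ l]; (intro lin h)?; simp add: component_mult_zero[OF hopf(8) h])
  qed (intro lin; assumption)+
  also have "\<dots> = hproj n (\<theta>' t)"
    unfolding hproj_def by (rule twist_sweedler[OF HL hproj_bilinear linear_map_id, symmetric])
  finally show ?thesis .
qed

text \<open>The coaction preserves the total degree, and \<open>pr\<close> retains only second legs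
  of degree zero, so the surviving first legs carry the whole degree.\<close>

lemma psi_hproj:
  assumes x: "x \<in> carrier L"
  shows "hproj n (\<psi> x) = \<psi> (component LG n x)"
proof (rule linear_map_eq_on_homogeneous[OF vL grL _ _ _ x])
  note HL = vspace_tensor[of H L]
  show "linear_map L (H \<otimes> L) (\<lambda>x. hproj n (\<psi> x))"
    by (rule linear_map_compose[OF refl hproj_linear psi_linear])
  show "linear_map L (H \<otimes> L) (\<lambda>x. \<psi> (component LG n x))"
    by (rule linear_map_compose[OF refl psi_linear linear_map_component[OF vL grL]])
  fix m x assume x: "x \<in> LG m"
  let ?F = "\<lambda>a b. tens H L (component HG n a) (pr b)" and ?G = "\<lambda>a b. tens H L a (pr b)"
  have F: "bilinear_map H L (H \<otimes> L) ?F" and G: "bilinear_map H L (H \<otimes> L) ?G"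
    by (intro lin; assumption)+
  have *: "hproj n (\<psi> x) = \<Sigma>L (\<rho> x) ?F"
    unfolding hproj_def by (rule psi_sweedler[OF HL hproj_bilinear])
  have z: "v \<in> carrier H \<Longrightarrow> tens H L v 0 = 0" "w \<in> carrier L \<Longrightarrow> tens H L 0 w = 0" for v w
    using linear_map_zero[OF vH bilinear_map_left[OF tens_bilinear[OF vH vL]]]
      linear_map_zero[OF vL bilinear_map_right[OF tens_bilinear[OF vH vL]]] by blast+
  have "\<Sigma>L (\<rho> x) ?F = (if n = m then \<Sigma>L (\<rho> x) ?G else 0)"
  proof (rule linear_map_eq_on_tensor_grading[OF vH grH vL grL linear_map_sweedler_tensor[OF vH vL HL F] _ _ comodule(4)[OF x]])
    show "linear_map (H \<otimes> L) (H \<otimes> L) (\<lambda>t. if n = m then \<Sigma>L t ?G else 0)"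
    proof (cases "n = m")
      case True
      then show ?thesis using linear_map_sweedler_tensor[OF vH vL HL G] by simp
    next
      case False
      then show ?thesis using linear_map_zero_fun[OF HL] by simp
    qed
    fix i j v w assume vw: "v \<in> HG i" "w \<in> LG j" "i + j = m"
    have c: "v \<in> carrier H" "w \<in> carrier L"
      using vw grading_subset[OF grH] grading_subset[OF grL] by blast+
    have "component HG n v = (if n = i then v else 0)" "pr w = (if 0 = j then w else 0)"
      using component_homogeneous[OF vH grH vw(1)] component_homogeneous[OF vL grL vw(2)] by blast+
    then show "\<Sigma>L (tens H L v w) ?F = (if n = m then \<Sigma>L (tens H L v w) ?G else 0)"
      unfolding sweedler_tens[OF vH vL HL F c] sweedler_tens[OF vH vL HL G c]
      using vw(3) z c vspace_zero[OF vH] vspace_zero[OF vL] by (cases "n = i"; cases "j = 0") auto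
  qed
  also have "(if n = m then \<Sigma>L (\<rho> x) ?G else 0) = \<psi> (component LG n x)"
    using component_homogeneous[OF vL grL x] linear_map_zero[OF vL psi_linear] by (simp add: \<psi>_def)
  finally show "hproj n (\<psi> x) = \<psi> (component LG n x)" using * by simp
qed

lemma phi_hproj:
  assumes x: "x \<in> carrier L"
  shows "hproj n (\<phi> x) = \<phi> (component LG n x)"
proof (rule eq_phiI)
  show "hproj n (\<phi> x) \<in> carrier (H \<otimes> L)"
    by (intro linear_map_carrier[OF hproj_linear] linear_map_carrier[OF phi_linear] x)
  show "component LG n x \<in> carrier L" by (intro lin x)
  show "\<theta>' (hproj n (\<phi> x)) = \<psi> (component LG n x)"
    by (simp add: twist_hproj[OF phi_in[OF x]] theta_phi[OF x] psi_hproj[OF x])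
qed

abbreviation "SG \<equiv> smash_grading H HG E"

lemma SG_eq: "SG n = carrier (H\<lparr>carrier := HG n \<inter> coinvariants H HG\<rparr> \<otimes> E)"
  by (simp add: smash_grading_def)

lemma HGR_vspace: "vspace (H\<lparr>carrier := HG n \<inter> coinvariants H HG\<rparr>)"
proof -
  interpret H: vector_space "scale H" using vH by (simp add: vspace_def)
  show ?thesis
    using grading_vspace[OF vH grH, of n] R_vspace by (simp add: vspace_def H.subspace_inter)
qed

text \<open>The degree in the smash product is that of the first leg alone, so here
  \<open>hproj n\<close> is the projection onto degree \<open>n\<close>.\<close>

lemma hproj_SG:
  assumes t: "t \<in> SG m"
  shows "hproj n t = (if n = m then t else 0)"
proof -
  let ?V = "H\<lparr>carrier := HG m \<inter> coinvariants H HG\<rparr>"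
  note t' = t[unfolded SG_eq]
  have sub: "carrier ?V \<subseteq> carrier H" using grading_subset[OF grH] by auto
  have subE: "carrier E \<subseteq> carrier L" by (simp add: zero_part)
  have HE: "tens H L = tens ?V E" by (intro tens_cong) (simp_all add: zero_part)
  have "hproj n t = sweedler ?V E t (\<lambda>h l. tens H L (component HG n h) l)"
    unfolding hproj_def
    by (rule sweedler_sub[OF HGR_vspace zero_part(2) vH vL vspace_tensor _ zero_part(6) sub subE hproj_bilinear t'])
      simp
  also have "\<dots> = sweedler ?V E t (\<lambda>h l. if n = m then tens ?V E h l else 0)"
  proof (rule sweedler_cong[OF HGR_vspace zero_part(2) refl])
    fix h l assume "h \<in> carrier ?V" "l \<in> carrier E"
    then have h: "h \<in> HG m" and l: "l \<in> carrier L" using subE by auto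
    show "tens H L (component HG n h) l = (if n = m then tens ?V E h l else 0)"
      using component_homogeneous[OF vH grH h, of n]
        linear_map_zero[OF vH bilinear_map_left[OF tens_bilinear[OF vH vL] l]] HE by simp
  qed
  also have "\<dots> = (if n = m then t else 0)"
    using sweedler_tens_id[OF HGR_vspace zero_part(2) t'] by (simp add: sweedler_def)
  finally show ?thesis .
qed

text \<open>Degree and coinvariance are tested on the same slices: each slice is fixed by the
  projection onto degree \<open>n\<close> and is coinvariant. This places the tensor directly in the
  product of \<open>E\<close> with the intersection of the two subspaces.\<close>

lemma phi_in_SG:
  assumes x: "x \<in> LG n"
  shows "\<phi> x \<in> SG n"
proof -
  have c: "x \<in> carrier L" using x grading_subset[OF grL] by blast
  show ?thesis
    unfolding SG_eq
  proof (rule tensor_slices_right[OF vH zero_part(2) HGR_vspace _ phi_in[OF c]])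
    fix f assume "Vector_Spaces.linear (scale E) (*) f"
    then have f: "Vector_Spaces.linear (scale L) (*) f" by (simp add: zero_part)
    note b = bilinear_map_slice_right[OF vH f]
    let ?r = "\<Sigma>L (\<phi> x) (\<lambda>h l. scale H (f l) h)"
    have r: "?r \<in> carrier H" by (intro lin)
    have "?r = \<Sigma>L (hproj n (\<phi> x)) (\<lambda>h l. scale H (f l) h)"
      using phi_hproj[OF c, of n] component_homogeneous[OF vL grL x, of n] by simp
    also have "\<dots> = \<Sigma>L (\<phi> x) (\<lambda>h l. \<Sigma>L (tens H L (component HG n h) l) (\<lambda>h l. scale H (f l) h))"
      unfolding hproj_def by (rule sweedler_sweedler[OF vH vL vH vL vH b]; (intro lin)?)
    also have "\<dots> = \<Sigma>L (\<phi> x) (\<lambda>h l. scale H (f l) (component HG n h))"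
      by (intro sweedler_cong[OF vH vL refl] sweedler_tens[OF vH vL vH b] lin)
    also have "\<dots> = \<Sigma>L (\<phi> x) (\<lambda>h l. component HG n (scale H (f l) h))"
      by (intro sweedler_cong[OF vH vL refl] linear_map_scale[OF linear_map_component[OF vH grH], symmetric])
    also have "\<dots> = component HG n ?r"
      by (rule linear_map_sweedler[OF vH vL vH linear_map_component[OF vH grH], symmetric]) (intro lin)
    finally have "?r \<in> HG n" using component_in[OF grH r, of n] by simp
    then show "sweedler H E (\<phi> x) (\<lambda>h l. scale H (f l) h) \<in> carrier (H\<lparr>carrier := HG n \<inter> coinvariants H HG\<rparr>)"
      using phi_slice_coinvariant[OF c f] slice_HE[OF phi_in[OF c] f] by simp
  qed simp
qed

section \<open>Products, the unit and the coaction under \<open>\<phi>\<close>\<close>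

abbreviation "\<M> t u \<equiv> \<Sigma>L t (\<lambda>a l. \<Sigma>L u (\<lambda>b m. \<Sigma>L (\<rho> l) (\<lambda>l2 e. \<Sigma>L (\<rho> e)
    (\<lambda>l1 l0. tens H L (a \<cdot> l2 \<cdot> b \<cdot> \<S> l1) (l0 \<star> m)))))"

lemma phi_mult:
  assumes x: "x \<in> carrier L" and y: "y \<in> carrier L"
  shows "\<M> (\<phi> x) (\<phi> y) = \<phi> (x \<star> y)"
proof (rule eq_phiI)
  let ?t = "\<phi> x" and ?u = "\<phi> y"
  note HL = vspace_tensor[of H L]
  note T = twist_linear[OF linear_map_id]
  show "\<M> ?t ?u \<in> carrier (H \<otimes> L)" by (intro lin)
  show "x \<star> y \<in> carrier L" by (intro lin x y)
  have "\<theta>' (\<M> ?t ?u) = \<Sigma>L ?t (\<lambda>a l. \<theta>' (\<Sigma>L ?u (\<lambda>b m. \<Sigma>L (\<rho> l) (\<lambda>l2 e. \<Sigma>L (\<rho> e)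
      (\<lambda>l1 l0. tens H L (a \<cdot> l2 \<cdot> b \<cdot> \<S> l1) (l0 \<star> m))))))"
    by (rule linear_map_sweedler[OF vH vL HL T]) (intro lin)
  also have "\<dots> = \<Sigma>L ?t (\<lambda>a l. \<Sigma>L ?u (\<lambda>b m. \<theta>' (\<Sigma>L (\<rho> l) (\<lambda>l2 e. \<Sigma>L (\<rho> e)
      (\<lambda>l1 l0. tens H L (a \<cdot> l2 \<cdot> b \<cdot> \<S> l1) (l0 \<star> m))))))"
    by (intro sweedler_cong[OF vH vL refl] linear_map_sweedler[OF vH vL HL T]) (intro lin)
  also have "\<dots> = \<Sigma>L ?t (\<lambda>a l. \<Sigma>L ?u (\<lambda>b m. \<Sigma>L (\<rho> l) (\<lambda>l2 e. \<theta>' (\<Sigma>L (\<rho> e)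
      (\<lambda>l1 l0. tens H L (a \<cdot> l2 \<cdot> b \<cdot> \<S> l1) (l0 \<star> m))))))"
    by (intro sweedler_cong[OF vH vL refl] linear_map_sweedler[OF vH vL HL T]) (intro lin)
  also have "\<dots> = \<Sigma>L ?t (\<lambda>a l. \<Sigma>L ?u (\<lambda>b m. \<Sigma>L (\<rho> l) (\<lambda>l2 e. \<Sigma>L (\<rho> e)
      (\<lambda>l1 l0. \<theta>' (tens H L (a \<cdot> l2 \<cdot> b \<cdot> \<S> l1) (l0 \<star> m))))))"
    by (intro sweedler_cong[OF vH vL refl] linear_map_sweedler[OF vH vL HL T]) (intro lin)
  also have "\<dots> = \<Sigma>L ?t (\<lambda>a l. \<Sigma>L ?u (\<lambda>b m. \<Sigma>L (\<rho> l) (\<lambda>l2 e. \<Sigma>L (\<rho> e)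
      (\<lambda>l1 l0. \<Sigma>L (\<rho> (l0 \<star> m)) (\<lambda>c d. tens H L (a \<cdot> l2 \<cdot> b \<cdot> \<S> l1 \<cdot> c) d)))))"
    by (intro sweedler_cong[OF vH vL refl] twist_tens lin)
  also have "\<dots> = \<Sigma>L ?t (\<lambda>a l. \<Sigma>L ?u (\<lambda>b m. \<Sigma>L (\<rho> l) (\<lambda>l2 e. \<Sigma>L (\<rho> e)
      (\<lambda>l1 l0. \<Sigma>L (\<rho> l0) (\<lambda>c d. \<Sigma>L (\<rho> m) (\<lambda>c' d'. tens H L (a \<cdot> l2 \<cdot> b \<cdot> \<S> l1 \<cdot> (c \<cdot> c')) (d \<star> d')))))))"
    by (intro sweedler_cong[OF vH vL refl] rho_mult[OF HL]; (intro lin)?)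
  \<comment> \<open>The brackets are moved so that \<open>\<S> l1\<close> meets c, a leg created by
    \<open>\<theta>'\<close>. Both are adjacent legs in the iterated coaction of e, so they cancel
    in the next step.\<close>
  also have "\<dots> = \<Sigma>L ?t (\<lambda>a l. \<Sigma>L ?u (\<lambda>b m. \<Sigma>L (\<rho> l) (\<lambda>l2 e. \<Sigma>L (\<rho> e)
      (\<lambda>l1 l0. \<Sigma>L (\<rho> l0) (\<lambda>c d. \<Sigma>L (\<rho> m) (\<lambda>c' d'. tens H L (a \<cdot> l2 \<cdot> (b \<cdot> (\<S> l1 \<cdot> c \<cdot> c'))) (d \<star> d')))))))"
    by (intro sweedler_cong[OF vH vL refl]) (simp add: mult_assoc carrier_rules)
  also have "\<dots> = \<Sigma>L ?t (\<lambda>a l. \<Sigma>L ?u (\<lambda>b m. \<Sigma>L (\<rho> l) (\<lambda>l2 e.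
      \<Sigma>L (\<rho> m) (\<lambda>c' d'. tens H L (a \<cdot> l2 \<cdot> (b \<cdot> (unit H \<cdot> c'))) (e \<star> d')))))"
    by (intro sweedler_cong[OF vH vL refl] rho_cancel_left[OF HL]; (intro lin)?)
  also have "\<dots> = \<Sigma>L ?t (\<lambda>a l. \<Sigma>L ?u (\<lambda>b m. \<Sigma>L (\<rho> l) (\<lambda>l2 e.
      \<Sigma>L (\<rho> m) (\<lambda>c' d'. tens H L (a \<cdot> l2 \<cdot> (b \<cdot> c')) (e \<star> d')))))"
    by (intro sweedler_cong[OF vH vL refl]) (simp add: mult_unit)
  \<comment> \<open>After the exchange, the inner sums over \<open>b \<cdot> c'\<close> and d' form
    \<open>\<theta>' ?u\<close> and the outer ones over \<open>a \<cdot> l2\<close> and e form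
    \<open>\<theta>' ?t\<close>, so the total is their product in the tensor product
    algebra.\<close>
  also have "\<dots> = \<Sigma>L ?t (\<lambda>a l. \<Sigma>L (\<rho> l) (\<lambda>l2 e. \<Sigma>L ?u (\<lambda>b m.
      \<Sigma>L (\<rho> m) (\<lambda>c' d'. tens H L (a \<cdot> l2 \<cdot> (b \<cdot> c')) (e \<star> d')))))"
    by (intro sweedler_cong[OF vH vL refl] sweedler_swap)
  also have "\<dots> = \<Sigma>L ?t (\<lambda>a l. \<Sigma>L (\<rho> l) (\<lambda>l2 e. \<Sigma>L (\<theta>' ?u) (\<lambda>c' d'. tens H L (a \<cdot> l2 \<cdot> c') (e \<star> d'))))"
    by (intro sweedler_cong[OF vH vL refl] twist_sweedler[OF HL, symmetric]; (intro lin)?)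
  also have "\<dots> = \<Sigma>L (\<theta>' ?t) (\<lambda>a l. \<Sigma>L (\<theta>' ?u) (\<lambda>b m. tens H L (a \<cdot> b) (l \<star> m)))"
    by (rule twist_sweedler[OF HL, symmetric]; (intro lin)?)
  also have "\<dots> = \<psi> (x \<star> y)"
    unfolding theta_phi[OF x] theta_phi[OF y] by (rule psi_mult[OF x y, symmetric])
  finally show "\<theta>' (\<M> ?t ?u) = \<psi> (x \<star> y)" .
qed

lemma phi_unit: "\<phi> (unit L) = tens H L (unit H) (unit L)"
proof (rule eq_phiI[symmetric])
  note HL = vspace_tensor[of H L]
  have r: "\<rho> (unit L) = tens H L (unit H) (unit L)"
    using comodule(2) by (simp add: algebra_hom_def tensor_algebra_def)
  have u: "unit L \<in> LG 0" using comodule(3) by (simp add: graded_algebra_def)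
  have "\<theta>' (tens H L (unit H) (unit L)) = \<Sigma>L (\<rho> (unit L)) (\<lambda>a b. tens H L (unit H \<cdot> a) b)"
    by (intro twist_tens lin)
  also have "\<dots> = tens H L (unit H \<cdot> unit H) (unit L)"
    unfolding r by (rule sweedler_tens[OF vH vL HL]; (intro lin)?)
  also have "\<dots> = tens H L (unit H) (unit L)"
    by (simp add: mult_unit unit_carrier)
  also have "\<dots> = tens H L (unit H) (pr (unit L))"
    using component_homogeneous[OF vL grL u, of 0] by simp
  also have "\<dots> = \<psi> (unit L)"
    unfolding \<psi>_def r by (rule sweedler_tens[OF vH vL HL, symmetric]; (intro lin)?)
  finally show "\<theta>' (tens H L (unit H) (unit L)) = \<psi> (unit L)" .
qed (intro lin; assumption)+

abbreviation "\<C> t \<equiv> \<Sigma>L t (\<lambda>a l. \<Sigma>H (\<Delta> a) (\<lambda>a1 a2. \<Sigma>L (\<rho> l) (\<lambda>l1 l0.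
    tens H (H \<otimes> L) (a1 \<cdot> l1) (tens H L a2 l0))))"

text \<open>Transports \<open>psi_comodule\<close> along \<open>\<theta>\<close>. Replacing
  \<open>\<psi> x\<close> by \<open>\<theta>' (\<phi> x)\<close> puts a leg of the coaction of l
  under \<open>\<Delta>\<close>; one half of it lands in the outer leg and gives the codiagonal
  coaction, the other is removed by \<open>\<theta>\<close>.\<close>

lemma phi_coact:
  assumes x: "x \<in> carrier L"
  shows "\<C> (\<phi> x) = \<Sigma>L (\<rho> x) (\<lambda>h l. tens H (H \<otimes> L) h (\<phi> l))"
proof -
  note HL = vspace_tensor[of H L] and HHL = vspace_tensor[of H "H \<otimes> L"]
  note T = twist_linear[OF hopf(5)]
  note lin' = lin linear_map_compose[OF refl T] linear_map_carrier[OF T]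
  have *: "linear_map (H \<otimes> L) (H \<otimes> H \<otimes> L) (\<lambda>t. tens H (H \<otimes> L) h (\<theta> t))" if "h \<in> carrier H" for h
    by (intro lin' that)
  have "\<Sigma>L (\<rho> x) (\<lambda>h l. tens H (H \<otimes> L) h (\<phi> l)) =
      \<Sigma>L (\<rho> x) (\<lambda>h l. tens H (H \<otimes> L) h (\<theta> (\<Sigma>L (\<psi> l) (tens H L))))"
    by (intro sweedler_cong[OF vH vL refl])
      (simp add: \<phi>_def sweedler_tens_id[OF vH vL] subsetD[OF HE_subset psi_in])
  also have "\<dots> = \<Sigma>L (\<rho> x) (\<lambda>h l. \<Sigma>L (\<psi> l) (\<lambda>a b. tens H (H \<otimes> L) h (\<theta> (tens H L a b))))"
    by (rule sweedler_cong[OF vH vL refl], rule linear_map_sweedler[OF vH vL HL *]; (intro lin)?)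
  also have "\<dots> = \<Sigma>L (\<psi> x) (\<lambda>h l. \<Sigma>H (\<Delta> h) (\<lambda>h1 h2. tens H (H \<otimes> L) h1 (\<theta> (tens H L h2 l))))"
    by (rule psi_comodule[OF HHL _ x]; (intro lin')?)
  also have "\<dots> = \<Sigma>L (\<phi> x) (\<lambda>h l. \<Sigma>L (\<rho> l) (\<lambda>a b. \<Sigma>H (\<Delta> (h \<cdot> a))
      (\<lambda>h1 h2. tens H (H \<otimes> L) h1 (\<theta> (tens H L h2 b)))))"
    unfolding theta_phi[OF x, symmetric] by (rule twist_sweedler[OF HHL]; (intro lin')?)
  also have "\<dots> = \<Sigma>L (\<phi> x) (\<lambda>h l. \<Sigma>L (\<rho> l) (\<lambda>a b. \<Sigma>H (\<Delta> h) (\<lambda>h1 h2. \<Sigma>H (\<Delta> a)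
      (\<lambda>a1 a2. tens H (H \<otimes> L) (h1 \<cdot> a1) (\<theta> (tens H L (h2 \<cdot> a2) b))))))"
    by (intro sweedler_cong[OF vH vL refl] Delta_mult[OF HHL]; (intro lin')?)
  also have "\<dots> = \<Sigma>L (\<phi> x) (\<lambda>h l. \<Sigma>H (\<Delta> h) (\<lambda>h1 h2. \<Sigma>L (\<rho> l) (\<lambda>a b. \<Sigma>H (\<Delta> a)
      (\<lambda>a1 a2. tens H (H \<otimes> L) (h1 \<cdot> a1) (\<theta> (tens H L (h2 \<cdot> a2) b))))))"
    by (intro sweedler_cong[OF vH vL refl] sweedler_swap)
  also have "\<dots> = \<Sigma>L (\<phi> x) (\<lambda>h l. \<Sigma>H (\<Delta> h) (\<lambda>h1 h2. \<Sigma>L (\<rho> l) (\<lambda>a b. \<Sigma>L (\<rho> b)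
      (\<lambda>c d. tens H (H \<otimes> L) (h1 \<cdot> a) (\<theta> (tens H L (h2 \<cdot> c) d))))))"
    by (intro sweedler_cong[OF vH vL refl] sweedler_cong[OF vH vH refl] rho_coassoc[OF HHL]; (intro lin')?)
  also have "\<dots> = \<Sigma>L (\<phi> x) (\<lambda>h l. \<Sigma>H (\<Delta> h) (\<lambda>h1 h2. \<Sigma>L (\<rho> l) (\<lambda>a b.
      tens H (H \<otimes> L) (h1 \<cdot> a) (tens H L h2 b))))"
  proof (intro sweedler_cong[OF vH vL refl] sweedler_cong[OF vH vH refl])
    fix h1 h2 a b assume c: "h1 \<in> carrier H" "h2 \<in> carrier H" "a \<in> carrier H" "b \<in> carrier L"
    have "\<Sigma>L (\<rho> b) (\<lambda>c d. tens H (H \<otimes> L) (h1 \<cdot> a) (\<theta> (tens H L (h2 \<cdot> c) d))) =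
        tens H (H \<otimes> L) (h1 \<cdot> a) (\<theta> (\<Sigma>L (\<rho> b) (\<lambda>c d. tens H L (h2 \<cdot> c) d)))"
      by (rule linear_map_sweedler[OF vH vL HL *, symmetric]; (intro lin c)?)
    also have "\<Sigma>L (\<rho> b) (\<lambda>c d. tens H L (h2 \<cdot> c) d) = \<theta>' (tens H L h2 b)"
      by (intro twist_tens[symmetric] lin c)
    also have "\<theta> \<dots> = tens H L h2 b"
      by (intro theta_inverse lin c)
    finally show "\<Sigma>L (\<rho> b) (\<lambda>c d. tens H (H \<otimes> L) (h1 \<cdot> a) (\<theta> (tens H L (h2 \<cdot> c) d))) =
        tens H (H \<otimes> L) (h1 \<cdot> a) (tens H L h2 b)" .
  qed
  finally show ?thesis by simp
qed

section \<open>Injectivity and the smash product\<close>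

text \<open>Contracting the first leg of \<open>\<rho> x\<close> with a functional and then applying
  \<open>\<psi>\<close> amounts, by colinearity, to contracting a comultiplication inside
  \<open>\<psi> x\<close>, which is zero.\<close>

lemma psi_kernel_subcomodule:
  assumes x: "x \<in> carrier L" and zero: "\<psi> x = 0"
  shows "\<rho> x \<in> carrier (H \<otimes> L\<lparr>carrier := {x \<in> carrier L. \<psi> x = 0}\<rparr>)"
proof (rule tensor_slices_left[OF vH vL])
  note HL = vspace_tensor[of H L]
  show "vspace (L\<lparr>carrier := {x \<in> carrier L. \<psi> x = 0}\<rparr>)"
    by (rule linear_map_equalizer[OF vL psi_linear linear_map_zero_fun[OF HL]])
  show "\<rho> x \<in> carrier (H \<otimes> L)" by (intro lin x)
  fix f assume f: "Vector_Spaces.linear (scale H) (*) f"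
  note b = bilinear_map_slice_left[OF vH f]
  note lin' = linear_map_bilinear_left[OF b] linear_map_bilinear_right[OF b] lin
  have F: "trilinear_map H H L (H \<otimes> L) (\<lambda>h a b. tens H L (scale H (f h) a) b)"
    by (intro lin')
  let ?s = "\<Sigma>L (\<rho> x) (\<lambda>h l. scale L (f h) l)"
  have "\<psi> ?s = \<Sigma>L (\<rho> x) (\<lambda>h l. \<psi> (scale L (f h) l))"
    by (rule linear_map_sweedler[OF vH vL vL psi_linear]) (intro lin)
  also have "\<dots> = \<Sigma>L (\<rho> x) (\<lambda>h l. scale (H \<otimes> L) (f h) (\<Sigma>L (\<psi> l) (tens H L)))"
    using sweedler_tens_id[OF vH vL linear_map_carrier[OF psi_linear]] linear_map_scale[OF psi_linear]
    by (intro sweedler_cong[OF vH vL refl]) (simp only:)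
  also have "\<dots> = \<Sigma>L (\<rho> x) (\<lambda>h l. \<Sigma>L (\<psi> l) (\<lambda>a b. scale (H \<otimes> L) (f h) (tens H L a b)))"
    by (intro sweedler_cong[OF vH vL refl] linear_map_sweedler[OF vH vL HL linear_map_scaling[OF HL]])
      (intro lin)
  also have "\<dots> = \<Sigma>L (\<rho> x) (\<lambda>h l. \<Sigma>L (\<psi> l) (\<lambda>a b. tens H L (scale H (f h) a) b))"
    by (intro sweedler_cong[OF vH vL refl] tens_scale_left[OF vH vL, symmetric])
  also have "\<dots> = \<Sigma>L (\<psi> x) (\<lambda>h l. \<Sigma>H (\<Delta> h) (\<lambda>h1 h2. tens H L (scale H (f h1) h2) l))"
    by (rule psi_comodule[OF HL F x])
  also have "\<dots> = 0"
    unfolding zero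
    by (rule linear_map_zero[OF HL linear_map_sweedler_tensor[OF vH vL HL]]) (intro lin')
  finally have "\<psi> ?s = 0" .
  moreover have "?s \<in> carrier L" by (intro lin)
  ultimately show "?s \<in> carrier (L\<lparr>carrier := {x \<in> carrier L. \<psi> x = 0}\<rparr>)" by simp
qed simp

text \<open>Makes the kernel of \<open>\<psi>\<close> proper: if it contained the unit, then
  \<open>pr (unit L)\<close> would vanish, whereas \<open>pr\<close> fixes the unit.\<close>

lemma psi_counit:
  assumes x: "x \<in> carrier L"
  shows "\<Sigma>L (\<psi> x) (\<lambda>h l. scale L (\<epsilon> h) l) = pr x"
proof -
  have "\<Sigma>L (\<psi> x) (\<lambda>h l. scale L (\<epsilon> h) l) = \<Sigma>L (\<rho> x) (\<lambda>h l. scale L (\<epsilon> h) (pr l))"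
    by (rule psi_sweedler[OF vL counit_scale_linear])
  also have "\<dots> = \<Sigma>L (\<rho> x) (\<lambda>h l. pr (scale L (\<epsilon> h) l))"
    by (intro sweedler_cong[OF vH vL refl] linear_map_scale[OF linear_map_component[OF vL grL], symmetric])
  also have "\<dots> = pr (\<Sigma>L (\<rho> x) (\<lambda>h l. scale L (\<epsilon> h) l))"
    by (rule linear_map_sweedler[OF vH vL vL linear_map_component[OF vL grL], symmetric]) (intro lin)
  finally show ?thesis using rho_counit[OF x] by simp
qed

lemma phi_inj_on:
  assumes simple: "right_simple H L"
  shows "inj_on \<phi> (carrier L)"
proof -
  let ?I = "{x \<in> carrier L. \<psi> x = 0}"
  note HL = vspace_tensor[of H L]
  have sub: "module.subspace (scale L) ?I"
    using linear_map_equalizer[OF vL psi_linear linear_map_zero_fun[OF HL]] by (simp add: vspace_def)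
  have "\<psi> (x \<star> y) = 0" if "x \<in> ?I" "y \<in> carrier L" for x y
  proof -
    have x: "x \<in> carrier L" and 0: "\<psi> x = 0" using that by auto
    show ?thesis
      unfolding psi_mult[OF x that(2)] 0
      by (rule linear_map_zero[OF HL linear_map_sweedler_tensor[OF vH vL HL]]) (intro lin)
  qed
  then have "right_ideal L ?I"
    using sub by (auto simp: right_ideal_def carrier_rules)
  moreover have "subcomodule H L ?I"
    using sub psi_kernel_subcomodule by (auto simp: subcomodule_def)
  moreover have "?I \<noteq> carrier L"
  proof
    assume "?I = carrier L"
    then have "\<psi> (unit L) = 0" using unit_carrier by blast
    then have "pr (unit L) = 0"
      using psi_counit[OF unit_carrier(2)]
        linear_map_zero[OF HL linear_map_sweedler_tensor[OF vH vL vL counit_scale_linear]] by simp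
    moreover have "pr (unit L) = unit L"
      using component_homogeneous[OF vL grL, of "unit L" 0 0] comodule(3) by (simp add: graded_algebra_def)
    ultimately have "unit L = 0" by simp
    \<comment> \<open>A vanishing unit would make the whole carrier zero, which
      \<open>right_simple\<close> excludes.\<close>
    then have "x = 0" if "x \<in> carrier L" for x
      using mult_unit(3)[OF that] linear_map_zero[OF vL bilinear_map_left[OF mult_bilinear(2) that]] by simp
    then show False
      using simple vspace_zero[OF vL] unfolding right_simple_def by blast
  qed
  ultimately have I: "?I = {0}"
    using simple unfolding right_simple_def by blast
  show ?thesis
  proof (rule inj_onI)
    fix x y assume xy: "x \<in> carrier L" "y \<in> carrier L" and "\<phi> x = \<phi> y"
    then have "\<psi> x = \<psi> y" using theta_phi by metis
    then have "\<psi> (x - y) = 0" using linear_map_diff[OF vL psi_linear xy] by simp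
    then have "x - y \<in> ?I" using vspace_diff[OF vL xy] by simp
    then show "x = y" unfolding I by simp
  qed
qed

section \<open>The smash product operations as sums over \<open>H\<close> and
  \<open>L\<close>\<close>

abbreviation "SM \<equiv> smash H HG E"

lemma degree_zero_simps:
  "coact E = \<rho>" "mult E = mult L" "unit E = unit L" "antipode H0 = \<S>"
  by (simp_all add: degree_zero_def)

lemma zero_part_mult: "x \<in> LG 0 \<Longrightarrow> y \<in> LG 0 \<Longrightarrow> x \<star> y \<in> LG 0"
  using comodule(3) by (auto simp: graded_algebra_def dest!: spec[of _ 0])

text \<open>The definition nests four lifts over \<open>R \<otimes> E\<close> and
  \<open>H0 \<otimes> E\<close>, whereas bilinearity is at hand over \<open>H\<close> and
  \<open>L\<close>. Each level is translated separately, and the membership in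
  \<open>H \<otimes> E\<close> that it returns feeds the enclosing level.\<close>

lemma smash_mult:
  assumes t: "t \<in> carrier (R \<otimes> E)" and u: "u \<in> carrier (R \<otimes> E)"
  shows "mult SM t u = \<M> t u"
proof -
  note HL = vspace_tensor[of H L]
  note HE = vspace_tensor[of H E]
  have sc: "scale (H \<otimes> E) = scale (H \<otimes> L)" by simp
  note subR = tlift_sub_sweedler[OF R_vspace zero_part(2) vH vL HL HE _ zero_part(6) _ _ sc]
  note sub0 = tlift_sub_sweedler[OF zero_part(1,2) vH vL HL HE zero_part(5,6) _ _ sc]
  have RE: "scale R = scale H" "carrier R \<subseteq> carrier H" "carrier E \<subseteq> carrier L" "carrier H0 \<subseteq> carrier H"
    using R_subset by (simp_all add: zero_part)
  have "tlift R E (H \<otimes> E) (\<lambda>a l. tlift R E (H \<otimes> E) (\<lambda>b m.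
         tlift H0 E (H \<otimes> E) (\<lambda>l2 e. tlift H0 E (H \<otimes> E) (\<lambda>l1 l0.
           tens H E (a \<cdot> l2 \<cdot> b \<cdot> \<S> l1) (l0 \<star> m))
         (\<rho> e)) (\<rho> l)) u) t = \<M> t u \<and> \<M> t u \<in> carrier (H \<otimes> E)"
  proof (rule subR[OF RE(1-3) _ t])
    show "bilinear_map H L (H \<otimes> L) (\<lambda>a l. \<Sigma>L u (\<lambda>b m. \<Sigma>L (\<rho> l) (\<lambda>l2 e. \<Sigma>L (\<rho> e)
        (\<lambda>l1 l0. tens H L (a \<cdot> l2 \<cdot> b \<cdot> \<S> l1) (l0 \<star> m)))))"
      by (intro lin)
    fix a l assume a: "a \<in> carrier R" and l: "l \<in> carrier E"
    have a': "a \<in> carrier H" and l': "l \<in> LG 0" using a l RE(2) zero_part by auto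
    show "tlift R E (H \<otimes> E) (\<lambda>b m. tlift H0 E (H \<otimes> E) (\<lambda>l2 e. tlift H0 E (H \<otimes> E) (\<lambda>l1 l0.
           tens H E (a \<cdot> l2 \<cdot> b \<cdot> \<S> l1) (l0 \<star> m)) (\<rho> e)) (\<rho> l)) u =
        \<Sigma>L u (\<lambda>b m. \<Sigma>L (\<rho> l) (\<lambda>l2 e. \<Sigma>L (\<rho> e) (\<lambda>l1 l0. tens H L (a \<cdot> l2 \<cdot> b \<cdot> \<S> l1) (l0 \<star> m)))) \<and>
        \<Sigma>L u (\<lambda>b m. \<Sigma>L (\<rho> l) (\<lambda>l2 e. \<Sigma>L (\<rho> e) (\<lambda>l1 l0. tens H L (a \<cdot> l2 \<cdot> b \<cdot> \<S> l1) (l0 \<star> m))))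
          \<in> carrier (H \<otimes> E)"
    proof (rule subR[OF RE(1-3) _ u])
      show "bilinear_map H L (H \<otimes> L) (\<lambda>b m. \<Sigma>L (\<rho> l) (\<lambda>l2 e. \<Sigma>L (\<rho> e)
          (\<lambda>l1 l0. tens H L (a \<cdot> l2 \<cdot> b \<cdot> \<S> l1) (l0 \<star> m))))"
        by (intro lin a')
      fix b m assume b: "b \<in> carrier R" and m: "m \<in> carrier E"
      have b': "b \<in> carrier H" and m': "m \<in> LG 0" "m \<in> carrier L" using b m RE(2) zero_part by auto
      show "tlift H0 E (H \<otimes> E) (\<lambda>l2 e. tlift H0 E (H \<otimes> E) (\<lambda>l1 l0.
           tens H E (a \<cdot> l2 \<cdot> b \<cdot> \<S> l1) (l0 \<star> m)) (\<rho> e)) (\<rho> l) =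
        \<Sigma>L (\<rho> l) (\<lambda>l2 e. \<Sigma>L (\<rho> e) (\<lambda>l1 l0. tens H L (a \<cdot> l2 \<cdot> b \<cdot> \<S> l1) (l0 \<star> m))) \<and>
        \<Sigma>L (\<rho> l) (\<lambda>l2 e. \<Sigma>L (\<rho> e) (\<lambda>l1 l0. tens H L (a \<cdot> l2 \<cdot> b \<cdot> \<S> l1) (l0 \<star> m)))
          \<in> carrier (H \<otimes> E)"
      proof (rule sub0[OF RE(4,3) _ rho_zero_in[OF l']])
        show "bilinear_map H L (H \<otimes> L) (\<lambda>l2 e. \<Sigma>L (\<rho> e)
            (\<lambda>l1 l0. tens H L (a \<cdot> l2 \<cdot> b \<cdot> \<S> l1) (l0 \<star> m)))"
          by (intro lin a' b' m')
        fix l2 e assume l2: "l2 \<in> carrier H0" and e: "e \<in> carrier E"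
        have l2': "l2 \<in> carrier H" and e': "e \<in> LG 0" using l2 e RE(4) zero_part by auto
        show "tlift H0 E (H \<otimes> E) (\<lambda>l1 l0. tens H E (a \<cdot> l2 \<cdot> b \<cdot> \<S> l1) (l0 \<star> m)) (\<rho> e) =
            \<Sigma>L (\<rho> e) (\<lambda>l1 l0. tens H L (a \<cdot> l2 \<cdot> b \<cdot> \<S> l1) (l0 \<star> m)) \<and>
            \<Sigma>L (\<rho> e) (\<lambda>l1 l0. tens H L (a \<cdot> l2 \<cdot> b \<cdot> \<S> l1) (l0 \<star> m)) \<in> carrier (H \<otimes> E)"
        proof (rule sub0[OF RE(4,3) _ rho_zero_in[OF e']])
          show "bilinear_map H L (H \<otimes> L) (\<lambda>l1 l0. tens H L (a \<cdot> l2 \<cdot> b \<cdot> \<S> l1) (l0 \<star> m))"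
            by (intro lin a' b' m' l2')
          fix l1 l0 assume l1: "l1 \<in> carrier H0" and l0: "l0 \<in> carrier E"
          have "l1 \<in> carrier H" "l0 \<star> m \<in> carrier E"
            using l1 l0 RE(4) m' zero_part_mult zero_part by auto
          then have "tens H E (a \<cdot> l2 \<cdot> b \<cdot> \<S> l1) (l0 \<star> m) \<in> carrier (H \<otimes> E)"
            by (intro tens_in_carrier) (intro lin a' b' l2')
          then show "tens H E (a \<cdot> l2 \<cdot> b \<cdot> \<S> l1) (l0 \<star> m) = tens H L (a \<cdot> l2 \<cdot> b \<cdot> \<S> l1) (l0 \<star> m) \<and>
              tens H L (a \<cdot> l2 \<cdot> b \<cdot> \<S> l1) (l0 \<star> m) \<in> carrier (H \<otimes> E)"
            by (simp add: tens_degree_zero)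
        qed
      qed
    qed
  qed
  then show ?thesis
    by (simp add: smash_def Let_def degree_zero_simps)
qed

text \<open>Proved level by level like the product; here the middle lift, over the comultiplication,
  runs through all of \<open>H \<otimes> H\<close>.\<close>

lemma smash_coact:
  assumes t: "t \<in> carrier (R \<otimes> E)"
  shows "coact SM t = \<C> t"
proof -
  note HHL = vspace_tensor[of H "H \<otimes> L"]
  note HHE = vspace_tensor[of H "H \<otimes> E"]
  have sc: "scale (H \<otimes> H \<otimes> E) = scale (H \<otimes> H \<otimes> L)" by simp
  have tt: "tens H (H \<otimes> E) = tens H (H \<otimes> L)" by (intro tens_cong) simp_all
  note subR = tlift_sub_sweedler[OF R_vspace zero_part(2) vH vL HHL HHE _ zero_part(6) _ _ sc]
  note sub0 = tlift_sub_sweedler[OF zero_part(1,2) vH vL HHL HHE zero_part(5,6) _ _ sc]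
  note subH = tlift_sub_sweedler[OF vH vH vH vH HHL HHE refl refl order_refl order_refl sc]
  have RE: "scale R = scale H" "carrier R \<subseteq> carrier H" "carrier E \<subseteq> carrier L" "carrier H0 \<subseteq> carrier H"
    using R_subset by (simp_all add: zero_part)
  have "tlift R E (H \<otimes> H \<otimes> E) (\<lambda>a l.
         tlift H H (H \<otimes> H \<otimes> E) (\<lambda>a1 a2. tlift H0 E (H \<otimes> H \<otimes> E) (\<lambda>l1 l0.
           tens H (H \<otimes> E) (a1 \<cdot> l1) (tens H E a2 l0)) (\<rho> l)) (\<Delta> a)) t = \<C> t \<and>
      \<C> t \<in> carrier (H \<otimes> H \<otimes> E)"
  proof (rule subR[OF RE(1-3) _ t])
    show "bilinear_map H L (H \<otimes> H \<otimes> L) (\<lambda>a l. \<Sigma>H (\<Delta> a) (\<lambda>a1 a2. \<Sigma>L (\<rho> l) (\<lambda>l1 l0.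
        tens H (H \<otimes> L) (a1 \<cdot> l1) (tens H L a2 l0))))"
      by (intro lin)
    fix a l assume a: "a \<in> carrier R" and l: "l \<in> carrier E"
    have a': "a \<in> carrier H" and l': "l \<in> LG 0" "l \<in> carrier L" using a l RE zero_part by auto
    show "tlift H H (H \<otimes> H \<otimes> E) (\<lambda>a1 a2. tlift H0 E (H \<otimes> H \<otimes> E) (\<lambda>l1 l0.
           tens H (H \<otimes> E) (a1 \<cdot> l1) (tens H E a2 l0)) (\<rho> l)) (\<Delta> a) =
        \<Sigma>H (\<Delta> a) (\<lambda>a1 a2. \<Sigma>L (\<rho> l) (\<lambda>l1 l0. tens H (H \<otimes> L) (a1 \<cdot> l1) (tens H L a2 l0))) \<and>
        \<Sigma>H (\<Delta> a) (\<lambda>a1 a2. \<Sigma>L (\<rho> l) (\<lambda>l1 l0. tens H (H \<otimes> L) (a1 \<cdot> l1) (tens H L a2 l0)))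
          \<in> carrier (H \<otimes> H \<otimes> E)"
    proof (rule subH[OF _ linear_map_carrier[OF Delta_linear a']])
      show "bilinear_map H H (H \<otimes> H \<otimes> L) (\<lambda>a1 a2. \<Sigma>L (\<rho> l) (\<lambda>l1 l0.
          tens H (H \<otimes> L) (a1 \<cdot> l1) (tens H L a2 l0)))"
        by (intro lin l')
      fix a1 a2 assume a12: "a1 \<in> carrier H" "a2 \<in> carrier H"
      show "tlift H0 E (H \<otimes> H \<otimes> E) (\<lambda>l1 l0. tens H (H \<otimes> E) (a1 \<cdot> l1) (tens H E a2 l0)) (\<rho> l) =
          \<Sigma>L (\<rho> l) (\<lambda>l1 l0. tens H (H \<otimes> L) (a1 \<cdot> l1) (tens H L a2 l0)) \<and>
          \<Sigma>L (\<rho> l) (\<lambda>l1 l0. tens H (H \<otimes> L) (a1 \<cdot> l1) (tens H L a2 l0)) \<in> carrier (H \<otimes> H \<otimes> E)"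
      proof (rule sub0[OF RE(4,3) _ rho_zero_in[OF l'(1)]])
        show "bilinear_map H L (H \<otimes> H \<otimes> L) (\<lambda>l1 l0. tens H (H \<otimes> L) (a1 \<cdot> l1) (tens H L a2 l0))"
          by (intro lin a12)
        fix l1 l0 assume l1: "l1 \<in> carrier H0" and l0: "l0 \<in> carrier E"
        have "l1 \<in> carrier H" using l1 RE(4) by auto
        then have "tens H (H \<otimes> E) (a1 \<cdot> l1) (tens H E a2 l0) \<in> carrier (H \<otimes> H \<otimes> E)"
          by (intro tens_in_carrier l0 a12) (intro lin a12)
        then show "tens H (H \<otimes> E) (a1 \<cdot> l1) (tens H E a2 l0) = tens H (H \<otimes> L) (a1 \<cdot> l1) (tens H L a2 l0) \<and>
            tens H (H \<otimes> L) (a1 \<cdot> l1) (tens H L a2 l0) \<in> carrier (H \<otimes> H \<otimes> E)"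
          by (simp add: tens_degree_zero tt)
      qed
    qed
  qed
  then show ?thesis
    by (simp add: smash_def Let_def degree_zero_simps)
qed

lemma smash_simps: "carrier SM = carrier (R \<otimes> E)" "scale SM = scale (H \<otimes> L)"
  "unit SM = tens H L (unit H) (unit L)"
  by (simp_all add: smash_def Let_def degree_zero_simps tens_degree_zero)

section \<open>The image of \<open>\<phi>\<close> as a graded comodule subalgebra\<close>

abbreviation "M \<equiv> \<phi> ` carrier L"
abbreviation "SMM \<equiv> SM\<lparr>carrier := M\<rparr>"

lemma SMM_simps: "carrier SMM = M" "scale SMM = scale (H \<otimes> L)" "mult SMM = mult SM"
  "unit SMM = unit SM" "coact SMM = coact SM"
  by (simp_all add: smash_simps)

lemma SMM_vspace: "vspace SMM"
proof -
  interpret T: vector_space "scale (H \<otimes> L)" using vspace_tensor[of H L] by (simp only: vspace_def)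
  have "T.subspace M"
  proof (rule T.subspaceI)
    show "0 \<in> M"
      using imageI[OF vspace_zero[OF vL], of \<phi>] unfolding linear_map_zero[OF vL phi_linear] .
    show "x + y \<in> M" if x: "x \<in> M" and y: "y \<in> M" for x y
    proof -
      obtain a b where ab: "a \<in> carrier L" "b \<in> carrier L" and xy: "x = \<phi> a" "y = \<phi> b"
        using x y by blast
      show ?thesis
        unfolding xy linear_map_add[OF phi_linear ab, symmetric] by (intro imageI vspace_add vL ab)
    qed
    show "scale (H \<otimes> L) c x \<in> M" if x: "x \<in> M" for c x
    proof -
      obtain a where a: "a \<in> carrier L" and x: "x = \<phi> a"
        using x by blast
      show ?thesis
        unfolding x linear_map_scale[OF phi_linear a, symmetric] by (intro imageI vspace_scale vL a)
    qed
  qed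
  then show ?thesis
    unfolding vspace_def SMM_simps using T.vector_space_axioms by (rule conjI[rotated])
qed

lemma phi_linear_SMM: "linear_map L SMM \<phi>"
  using phi_linear unfolding linear_map_def SMM_simps by blast

lemma tens_SMM: "tens H SMM = tens H (H \<otimes> L)"
  by (intro tens_cong refl SMM_simps)

lemma phi_mult_SM:
  assumes "x \<in> carrier L" "y \<in> carrier L"
  shows "mult SM (\<phi> x) (\<phi> y) = \<phi> (x \<star> y)"
  using assms by (simp add: smash_mult phi_in_R phi_mult)

lemma phi_coact_SM:
  assumes "x \<in> carrier L"
  shows "coact SM (\<phi> x) = \<Sigma>L (\<rho> x) (\<lambda>h l. tens H SMM h (\<phi> l))"
  unfolding tens_SMM using assms by (simp add: smash_coact phi_in_R phi_coact)

text \<open>\<open>hproj n\<close> fixes \<open>SG n\<close> and acts on the image as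
  \<open>component LG n\<close> does on \<open>L\<close>. So an element of the image that has degree
  \<open>n\<close> comes from an element of degree \<open>n\<close>.\<close>

lemma SG_phi:
  assumes x: "x \<in> carrier L"
  shows "\<phi> x \<in> SG n \<longleftrightarrow> \<phi> x = \<phi> (component LG n x)"
  using hproj_SG[of "\<phi> x" n n] phi_hproj[OF x, of n] phi_in_SG[OF component_in[OF grL x, of n]] by auto

text \<open>Existence of decompositions is transported from \<open>L\<close> along
  \<open>\<phi>\<close>; uniqueness holds because \<open>hproj n\<close> reads the term of index
  \<open>n\<close> off any decomposition.\<close>

lemma SM_grading: "grading SMM (\<lambda>n. SG n \<inter> M)"
  unfolding grading_def
proof (intro conjI allI ballI)
  interpret T: vector_space "scale (H \<otimes> L)" using vspace_tensor[of H L] by (simp only: vspace_def)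
  show "SG n \<inter> M \<subseteq> carrier SMM" for n by (simp add: SMM_simps)
  have "T.subspace (SG n)" for n
    using vspace_tensor[of "H\<lparr>carrier := HG n \<inter> coinvariants H HG\<rparr>" E]
    unfolding SG_eq vspace_def scale_tensor by blast
  moreover have "T.subspace M"
    using SMM_vspace unfolding vspace_def SMM_simps by blast
  ultimately show "module.subspace (scale SMM) (SG n \<inter> M)" for n
    unfolding SMM_simps by (rule T.subspace_inter)
  fix y assume "y \<in> carrier SMM"
  then obtain x where x: "x \<in> carrier L" and y: "y = \<phi> x" unfolding SMM_simps by blast
  note D = is_decomp_component[OF grL x, unfolded is_decomp_def]
  have c: "component LG n x \<in> carrier L" for n by (intro lin x)
  show "\<exists>!f. is_decomp (\<lambda>n. SG n \<inter> M) y f"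
  proof (rule ex1I)
    show "is_decomp (\<lambda>n. SG n \<inter> M) y (\<lambda>n. \<phi> (component LG n x))"
    proof (rule is_decompI)
      show "\<phi> (component LG n x) \<in> SG n \<inter> M" for n
        using phi_in_SG[OF component_in[OF grL x]] c by blast
      show "finite {n. component LG n x \<noteq> 0}" using D by blast
      show "\<phi> (component LG n x) = 0" if "n \<notin> {n. component LG n x \<noteq> 0}" for n
        using that linear_map_zero[OF vL phi_linear] by simp
      have "\<phi> (\<Sum>n | component LG n x \<noteq> 0. component LG n x) =
          (\<Sum>n | component LG n x \<noteq> 0. \<phi> (component LG n x))"
        by (rule linear_map_sum[OF vL phi_linear c])
      then show "y = (\<Sum>n | component LG n x \<noteq> 0. \<phi> (component LG n x))"
        using D y by simp
    qed
    fix f assume f: "is_decomp (\<lambda>n. SG n \<inter> M) y f"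
    show "f = (\<lambda>n. \<phi> (component LG n x))"
    proof
      fix n
      have fS: "f m \<in> SG m" "f m \<in> M" for m using f unfolding is_decomp_def by blast+
      have fc: "f m \<in> carrier (H \<otimes> L)" for m
        using fS(2)[of m] by (rule imageE) (simp only: linear_map_carrier[OF phi_linear])
      have fin: "finite {m. f m \<noteq> 0}" and sum: "y = (\<Sum>m | f m \<noteq> 0. f m)"
        using f unfolding is_decomp_def by blast+
      have "\<phi> (component LG n x) = hproj n y"
        unfolding y by (rule phi_hproj[OF x, symmetric])
      also have "\<dots> = (\<Sum>m | f m \<noteq> 0. hproj n (f m))"
        unfolding sum by (rule linear_map_sum[OF vspace_tensor hproj_linear fc])
      also have "\<dots> = (\<Sum>m | f m \<noteq> 0. if n = m then f m else 0)"
        using hproj_SG[OF fS(1)] by (intro sum.cong refl)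
      also have "\<dots> = f n"
        using fin by (cases "f n = 0") (auto simp: sum.delta')
      finally show "f n = \<phi> (component LG n x)" by simp
    qed
  qed
qed

lemma phi_image_subalgebra: "graded_comodule_subalgebra H SM SG M"
  unfolding graded_comodule_subalgebra_def subcomodule_def
proof (intro conjI ballI)
  show "M \<subseteq> carrier SM" using phi_in_R by (auto simp: smash_simps)
  show "module.subspace (scale SM) M"
    using SMM_vspace unfolding vspace_def SMM_simps smash_simps by blast
  show "unit SM \<in> M"
    unfolding smash_simps phi_unit[symmetric] by (intro imageI unit_carrier)
  show "grading SMM (\<lambda>n. SG n \<inter> M)" by (rule SM_grading)
  fix t assume "t \<in> M"
  then obtain x where x: "x \<in> carrier L" and t: "t = \<phi> x" by blast
  show "coact SM t \<in> carrier (H \<otimes> SMM)"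
    unfolding t phi_coact_SM[OF x]
    by (intro sweedler_carrier vH vL vspace_tensor tens_in_carrier linear_map_carrier[OF phi_linear_SMM])
  fix u assume "u \<in> M"
  then obtain y where y: "y \<in> carrier L" and u: "u = \<phi> y" by blast
  show "mult SM t u \<in> M"
    unfolding t u phi_mult_SM[OF x y] by (intro imageI lin x y)
qed

lemma phi_iso:
  assumes "right_simple H L"
  shows "graded_comodule_algebra_iso H L LG SMM (\<lambda>n. SG n \<inter> M) \<phi>"
  unfolding graded_comodule_algebra_iso_def algebra_hom_def
proof (intro conjI ballI allI)
  note inj = phi_inj_on[OF assms]
  show "linear_map L SMM \<phi>" by (rule phi_linear_SMM)
  show "\<phi> (unit L) = unit SMM" by (simp only: SMM_simps smash_simps phi_unit)
  show "\<phi> (x \<star> y) = mult SMM (\<phi> x) (\<phi> y)" if "x \<in> carrier L" "y \<in> carrier L" for x y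
    by (simp only: SMM_simps phi_mult_SM[OF that])
  show "bij_betw \<phi> (carrier L) (carrier SMM)"
    unfolding SMM_simps by (intro inj_on_imp_bij_betw inj)
  show "\<phi> ` LG n = SG n \<inter> M" for n
  proof
    show "\<phi> ` LG n \<subseteq> SG n \<inter> M"
      using phi_in_SG grading_subset[OF grL] by blast
    show "SG n \<inter> M \<subseteq> \<phi> ` LG n"
      using SG_phi component_in[OF grL] by blast
  qed
  show "coact SMM (\<phi> x) = tlift H L (H \<otimes> SMM) (\<lambda>h l. tens H SMM h (\<phi> l)) (\<rho> x)"
    if x: "x \<in> carrier L" for x
  proof -
    have "tlift H L (H \<otimes> SMM) (\<lambda>h l. tens H SMM h (\<phi> l)) (\<rho> x) =
        \<Sigma>L (\<rho> x) (\<lambda>h l. tens H SMM h (\<phi> l))"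
      by (rule tlift_sweedler[OF vH vL vspace_tensor _ linear_map_carrier[OF rho_linear x]])
        (intro bilinear_mapI linear_map_tens_left linear_map_tens_right linear_map_id vH SMM_vspace
          phi_linear_SMM linear_map_carrier[OF phi_linear_SMM])
    then show ?thesis by (simp only: SMM_simps phi_coact_SM[OF x])
  qed
qed

end

theorem lemma6p11:
  fixes H :: "('k::field, 'h::ab_group_add) hopf_algebra"
    and HG :: "nat \<Rightarrow> 'h set"
    and L :: "('k, 'h, 'l::ab_group_add) comodule_algebra"
    and LG :: "nat \<Rightarrow> 'l set"
  assumes "graded_hopf_algebra H HG"
    and "graded_comodule_algebra H HG L LG"
    and "right_simple H L"
  shows "let S = smash H HG (degree_zero L LG);
             SG = smash_grading H HG (degree_zero L LG)
    in \<exists>M. graded_comodule_subalgebra H S SG M \<and>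
      (\<exists>\<phi>. graded_comodule_algebra_iso H L LG (S\<lparr>carrier := M\<rparr>) (\<lambda>n. SG n \<inter> M) \<phi>)"
proof -
  interpret graded_comodule_setting H HG L LG
    using assms by unfold_locales
  show ?thesis
    unfolding Let_def using phi_image_subalgebra phi_iso[OF assms(3)] by blast
qed

end
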